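(* For any $\epsilon>0$, there exists a polynomial-time randomized $(1/2-\epsilon)$-approximation algorithm for the maximum weight bipartite matching problem whose pointwise Lipschitz constant with respect to the unweighted mapping, at any input $(G,w)$, is $O(\epsilon^{-1}n^{3/2}\log m/\mathrm{opt})$, where $n$ and $m$ are the numbers of vertices in the left and right parts of $G$, respectively, and $\mathrm{opt}$ is the maximum weight of a matching in $G$ with respect to $w$.
   Context: Maximum weight bipartite matching problem: given a complete bipartite graph $G=(U\cup V,E=U\times V)$ with $|U|=n$, $|V|=m$, and $w\in\mathbb{R}_{\geq0}^E$, output a matching $M\subseteq E$ maximizing $\sum_{e\in M}w(e)$; an $\alpha$-approximation outputs a matching whose expected weight is at least $\alpha\cdot\mathrm{opt}$. For distributions $\mathcal{F},\mathcal{F}'$ over edge sets, $\mathrm{EM}_\mathrm{u}(\mathcal{F},\mathcal{F}')=\min_{\mathcal{D}}\mathbb{E}_{(F,F')\sim\mathcal{D}}|F\triangle F'|$ over couplings $\mathcal{D}$. The pointwise Lipschitz constant of $\mathcal{A}$ on $G$ at $w$ with respect to the unweighted mapping is $\limsup_{w'\in\mathbb{R}_{\geq0}^E,\,w'\to w}\mathrm{EM}_\mathrm{u}(\mathcal{A}(G,w),\mathcal{A}(G,w'))/\|w-w'\|_1$.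
   Formalization: The factor log m is read as log max(2, m), since for m = 1 the literal bound would be 0 and fails for n ≥ 3 and small ε; for opt = 0 the bound is read as infinite; polynomial time is counted in unit-cost real arithmetic with exact uniform samples. *)

theory Defs
  imports "HOL-Probability.Probability" "HOL-Computational_Algebra.Polynomial"
begin

text \<open>
  The graph is the complete bipartite graph on the left part \<open>{..<n}\<close> and the right part
  \<open>{..<m}\<close>.  A weight vector in $R_{\ge 0}^E$ is represented by its extension by zero to all
  pairs, so that equality and convergence of weight functions are those of weight vectors.
\<close>

type_synonym edge = "nat \<times> nat"

definition edges :: "nat \<Rightarrow> nat \<Rightarrow> edge set" where
  "edges n m = {..<n} \<times> {..<m}"

definition weightings :: "nat \<Rightarrow> nat \<Rightarrow> (edge \<Rightarrow> real) set" where
  "weightings n m = {w. (\<forall>e\<in>edges n m. 0 \<le> w e) \<and> (\<forall>e. e \<notin> edges n m \<longrightarrow> w e = 0)}"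

definition matchings :: "nat \<Rightarrow> nat \<Rightarrow> edge set set" where
  "matchings n m = {M. M \<subseteq> edges n m \<and>
     (\<forall>e\<in>M. \<forall>f\<in>M. e \<noteq> f \<longrightarrow> fst e \<noteq> fst f \<and> snd e \<noteq> snd f)}"

definition opt :: "nat \<Rightarrow> nat \<Rightarrow> (edge \<Rightarrow> real) \<Rightarrow> real" where
  "opt n m w = Max ((\<lambda>M. \<Sum>e\<in>M. w e) ` matchings n m)"

definition l1_dist :: "nat \<Rightarrow> nat \<Rightarrow> (edge \<Rightarrow> real) \<Rightarrow> (edge \<Rightarrow> real) \<Rightarrow> real" where
  "l1_dist n m w w' = (\<Sum>e\<in>edges n m. \<bar>w e - w' e\<bar>)"

definition couplings :: "'a pmf \<Rightarrow> 'b pmf \<Rightarrow> ('a \<times> 'b) pmf set" where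
  "couplings p q = {D. map_pmf fst D = p \<and> map_pmf snd D = q}"

definition EM_u :: "edge set pmf \<Rightarrow> edge set pmf \<Rightarrow> ennreal" where
  "EM_u p q = (INF D\<in>couplings p q. \<integral>\<^sup>+ (F, F'). of_nat (card (sym_diff F F')) \<partial>measure_pmf D)"

text \<open>
  The input-output behaviour of a randomized algorithm: the distribution of the edge set that it
  outputs on the complete bipartite graph with parts of size \<open>n\<close> and \<open>m\<close>, weighted by \<open>w\<close>.
\<close>

type_synonym algorithm = "nat \<Rightarrow> nat \<Rightarrow> (edge \<Rightarrow> real) \<Rightarrow> edge set pmf"

definition approximates_matching :: "real \<Rightarrow> algorithm \<Rightarrow> bool" where
  "approximates_matching \<alpha> A \<longleftrightarrow> (\<forall>n m. \<forall>w\<in>weightings n m.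
     set_pmf (A n m w) \<subseteq> matchings n m \<and>
     \<alpha> * opt n m w \<le> measure_pmf.expectation (A n m w) (\<lambda>M. \<Sum>e\<in>M. w e))"

text \<open>
  \<open>at w within weightings n m\<close> refers to the product topology on functions; on \<open>weightings n m\<close>,
  whose members vanish off a finite set, this is the topology of the \<open>l1\<close> norm.
\<close>

definition pointwise_lipschitz :: "algorithm \<Rightarrow> nat \<Rightarrow> nat \<Rightarrow> (edge \<Rightarrow> real) \<Rightarrow> ennreal" where
  "pointwise_lipschitz A n m w =
     Limsup (at w within weightings n m)
       (\<lambda>w'. EM_u (A n m w) (A n m w') / ennreal (l1_dist n m w w'))"

text \<open>
  Polynomial time is meant with respect to a randomized real RAM, given here as a WHILE language
  with unit-cost steps.  Storage consists of two-dimensional arrays, named by numbers, of natural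
  numbers and of reals, accessed by computed indices.  Reals support field operations,
  comparison and sampling from the uniform distribution on \<open>{0..1}\<close>; there is no rounding of
  reals to integers, and program constants are rational, so that they cannot carry advice.
  Natural numbers have no unit-cost multiplication, so that their bit length stays
  polynomial in the number of steps.
\<close>

datatype nexp =
    NConst nat
  | NArr nat nexp nexp
  | NAdd nexp nexp
  | NSub nexp nexp

datatype rexp =
    RConst rat
  | ROfNat nexp
  | RArr nat nexp nexp
  | RAdd rexp rexp
  | RSub rexp rexp
  | RMul rexp rexp
  | RDiv rexp rexp

datatype bexp =
    NLess nexp nexp
  | RLess rexp rexp
  | BNot bexp
  | BAnd bexp bexp

datatype com =
    Skip
  | NAssign nat nexp nexp nexp
  | RAssign nat nexp nexp rexp
  | Sample nat nexp nexp
  | Seq com com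
  | Cond bexp com com
  | While bexp com

text \<open>\<open>tpos\<close> is the number of random samples drawn so far.\<close>

record state =
  nmem :: "nat \<Rightarrow> nat \<Rightarrow> nat \<Rightarrow> nat"
  rmem :: "nat \<Rightarrow> nat \<Rightarrow> nat \<Rightarrow> real"
  tpos :: nat

fun nval :: "nexp \<Rightarrow> state \<Rightarrow> nat" where
  "nval (NConst k) s = k"
| "nval (NArr a i j) s = nmem s a (nval i s) (nval j s)"
| "nval (NAdd x y) s = nval x s + nval y s"
| "nval (NSub x y) s = nval x s - nval y s"

fun rval :: "rexp \<Rightarrow> state \<Rightarrow> real" where
  "rval (RConst q) s = of_rat q"
| "rval (ROfNat x) s = real (nval x s)"
| "rval (RArr a i j) s = rmem s a (nval i s) (nval j s)"
| "rval (RAdd x y) s = rval x s + rval y s"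
| "rval (RSub x y) s = rval x s - rval y s"
| "rval (RMul x y) s = rval x s * rval y s"
| "rval (RDiv x y) s = rval x s / rval y s"

fun bval :: "bexp \<Rightarrow> state \<Rightarrow> bool" where
  "bval (NLess x y) s \<longleftrightarrow> nval x s < nval y s"
| "bval (RLess x y) s \<longleftrightarrow> rval x s < rval y s"
| "bval (BNot b) s \<longleftrightarrow> \<not> bval b s"
| "bval (BAnd b c) s \<longleftrightarrow> bval b s \<and> bval c s"

definition upd :: "(nat \<Rightarrow> nat \<Rightarrow> nat \<Rightarrow> 'v) \<Rightarrow> nat \<Rightarrow> nat \<Rightarrow> nat \<Rightarrow> 'v \<Rightarrow> nat \<Rightarrow> nat \<Rightarrow> nat \<Rightarrow> 'v" where
  "upd f a i j v = f(a := (f a)(i := (f a i)(j := v)))"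

text \<open>
  Small-step semantics relative to a tape \<open>\<omega>\<close> of random samples.  Expressions occur in the program
  text and thus have constant size, so a step costs a constant number of elementary operations.
\<close>

fun step :: "(nat \<Rightarrow> real) \<Rightarrow> com \<times> state \<Rightarrow> com \<times> state" where
  "step \<omega> (Skip, s) = (Skip, s)"
| "step \<omega> (NAssign a i j x, s) =
     (Skip, s\<lparr>nmem := upd (nmem s) a (nval i s) (nval j s) (nval x s)\<rparr>)"
| "step \<omega> (RAssign a i j x, s) =
     (Skip, s\<lparr>rmem := upd (rmem s) a (nval i s) (nval j s) (rval x s)\<rparr>)"
| "step \<omega> (Sample a i j, s) =
     (Skip, s\<lparr>rmem := upd (rmem s) a (nval i s) (nval j s) (\<omega> (tpos s)), tpos := Suc (tpos s)\<rparr>)"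
| "step \<omega> (Seq c d, s) =
     (if c = Skip then (d, s) else (case step \<omega> (c, s) of (c', s') \<Rightarrow> (Seq c' d, s')))"
| "step \<omega> (Cond b c d, s) = (if bval b s then (c, s) else (d, s))"
| "step \<omega> (While b c, s) = (if bval b s then (Seq c (While b c), s) else (Skip, s))"

text \<open>
  Input: \<open>n\<close> and \<open>m\<close> in cells \<open>(0, 0)\<close> and \<open>(0, 1)\<close> of array 0 of naturals, the weights in array 0
  of reals.  Output: the nonzero entries of array 1 of naturals in the range of the graph.
\<close>

definition init :: "nat \<Rightarrow> nat \<Rightarrow> (edge \<Rightarrow> real) \<Rightarrow> state" where
  "init n m w =
     \<lparr>nmem = upd (upd (\<lambda>_ _ _. 0) 0 0 0 n) 0 0 1 m,
      rmem = (\<lambda>a i j. if a = 0 then w (i, j) else 0),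
      tpos = 0\<rparr>"

definition run :: "com \<Rightarrow> nat \<Rightarrow> nat \<Rightarrow> (edge \<Rightarrow> real) \<Rightarrow> nat \<Rightarrow> (nat \<Rightarrow> real) \<Rightarrow> com \<times> state" where
  "run P n m w t \<omega> = (step \<omega> ^^ t) (P, init n m w)"

definition out_edges :: "nat \<Rightarrow> nat \<Rightarrow> state \<Rightarrow> edge set" where
  "out_edges n m s = {(i, j) \<in> edges n m. nmem s 1 i j \<noteq> 0}"

definition tapes :: "(nat \<Rightarrow> real) measure" where
  "tapes = Pi\<^sub>M UNIV (\<lambda>_. uniform_measure lborel {0..1})"

text \<open>
  One program \<open>P\<close> serves all inputs; it halts within \<open>poly p (n + m)\<close> steps whatever the samples
  are, and its output has the distribution prescribed by \<open>A\<close>.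
\<close>

definition polynomial_time :: "algorithm \<Rightarrow> bool" where
  "polynomial_time A \<longleftrightarrow> (\<exists>(P :: com) (p :: nat poly). \<forall>n m. \<forall>w\<in>weightings n m.
     (let t = poly p (n + m); out = (\<lambda>\<omega>. out_edges n m (snd (run P n m w t \<omega>))) in
       (\<forall>\<omega>. range \<omega> \<subseteq> {0..1} \<longrightarrow> fst (run P n m w t \<omega>) = Skip) \<and>
       out \<in> tapes \<rightarrow>\<^sub>M count_space UNIV \<and>
       distr tapes (count_space UNIV) out = measure_pmf (A n m w)))"

end

theory Submission
  imports Defs
begin

text \<open>
  The fractional solution is the (approximate) zero of the strongly monotone operator
  \<open>\<lambda> ent(x) + penalties - w / (W + \<langle>w, x\<rangle>)\<close>, where \<open>W\<close> is the largest weight, the penalties enforce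
  the matching constraints up to a small error, and \<open>ent\<close> is a rational substitute for the logarithm,
  the derivative of the entropy.  The last term is the gradient of a logarithm, which makes the problem
  scale-free: no estimate of \<open>opt\<close> is needed.  Testing the operator equation with an optimal matching
  gives near-optimality; testing the equations for \<open>w\<close> and \<open>w'\<close> with the difference of their
  solutions gives an energy bound, and since the slope of \<open>ent\<close> at \<open>x\<close> is at least
  \<open>1 / (x + 1/m)\<close>, the Cauchy-Schwarz inequality turns it into a bound on the l1 distance with a loss
  of only \<open>sqrt n\<close>.

  The zero itself is not computable with field operations.  A fixed number of gradient steps is used
  instead; as the operator is smooth, not only the residual but also its dependence on the
  weights decays geometrically, so the iterate inherits the Lipschitz bound of the exact solution.

  For rounding, every left vertex \<open>u\<close> independently picks \<open>v\<close> with probability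
  \<open>y u v / (2 - (\<Sum>u'<u. y u' v))\<close>, and \<open>v\<close> goes to the first vertex that picked it: each edge is
  then matched with probability exactly \<open>y u v / 2\<close>, and changing one pick changes at most four edges.
\<close>

section \<open>A rational substitute for the logarithm\<close>

text \<open>The factor \<open>n powr (3/2) * ln m / \<epsilon>\<close> is a product of two costs.
  The entropy of a matching is at most about \<open>n * H\<close> with \<open>H\<close> of order
  \<open>ln m\<close>, so a regularization \<open>lam\<close> of order
  \<open>\<epsilon> / (n * H)\<close> loses only a fraction \<epsilon>; dividing the energy bound by
  \<open>lam\<close> costs \<open>n * H / \<epsilon>\<close>, and Cauchy-Schwarz costs
  \<open>sqrt n\<close>. The slope bound \<open>1 / (x + 1/m)\<close> keeps the latter free of
  \<open>m\<close>, because \<open>x + 1/m\<close> summed over all edges is of order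
  \<open>n\<close>. Two obstacles shape the rest. The normalizer
  \<open>W + \<langle>w, x\<rangle>\<close> moves with the solution; this movement need not be small
  and is absorbed by the monotonicity of the logarithmic term. And the Lipschitz constant is a limit
  for \<open>w'\<close> tending to \<open>w\<close>, so no fixed precision of the computed solution
  suffices: the computational error must itself be Lipschitz in the weights, with a small constant.
  This is also why the number of steps is independent of the weights; a stopping test could make the
  output jump.\<close>

text \<open>
  For \<open>t \<ge> 0\<close> one has \<open>1 - phi t = 1 / (1 + t)\<close>; the linear extension to negative arguments makes
  \<open>phi\<close> and \<open>theta t = t - phi t\<close> globally Lipschitz with Lipschitz derivatives.
\<close>

definition phi :: "real \<Rightarrow> real" where
  "phi t = t / (1 + max t 0)"

definition theta :: "real \<Rightarrow> real" where
  "theta t = (max t 0)\<^sup>2 / (1 + max t 0)"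

lemma theta_eq: "theta t = t - phi t"
  by (auto simp: theta_def phi_def max_def field_simps power2_eq_square)

lemma phi_0 [simp]: "phi 0 = 0"
  by (simp add: phi_def)

lemma theta_nonneg: "0 \<le> theta t"
  by (simp add: theta_def)

lemma theta_nonpos [simp]: "t \<le> 0 \<Longrightarrow> theta t = 0"
  by (simp add: theta_def)

text \<open>The two pieces meet at \<open>0\<close> with the common slope \<open>1\<close>; there
  the difference quotient is \<open>1 / (1 + max h 0)\<close>.\<close>

lemma phi_deriv: "(phi has_real_derivative 1 / (1 + max t 0)\<^sup>2) (at t)"
proof -
  consider "t < 0" | "t > 0" | "t = 0" by linarith
  then show ?thesis
  proof cases
    case 1
    have "((\<lambda>x. x) has_real_derivative 1) (at t)" by (auto intro!: derivative_eq_intros)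
    moreover have "\<forall>\<^sub>F x in nhds t. phi x = x"
      using eventually_nhds_in_open[of "{..<0::real}" t] 1
      by (auto elim!: eventually_mono simp: phi_def)
    ultimately have "(phi has_real_derivative 1) (at t)"
      by (subst DERIV_cong_ev[OF refl _ refl])
    then show ?thesis using 1 by simp
  next
    case 2
    have "((\<lambda>x. x / (1 + x)) has_real_derivative 1 / (1 + t)\<^sup>2) (at t)"
      using 2 by (auto intro!: derivative_eq_intros simp: field_simps power2_eq_square)
    moreover have "\<forall>\<^sub>F x in nhds t. phi x = x / (1 + x)"
      using eventually_nhds_in_open[of "{0::real<..}" t] 2
      by (auto elim!: eventually_mono simp: phi_def)
    ultimately have "(phi has_real_derivative 1 / (1 + t)\<^sup>2) (at t)"
      by (subst DERIV_cong_ev[OF refl _ refl])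
    then show ?thesis using 2 by simp
  next
    case 3
    have "((\<lambda>h. 1 / (1 + max h 0)) \<longlongrightarrow> 1 / (1 + max 0 0)) (at (0::real))"
      by (intro tendsto_intros) auto
    moreover have "(\<lambda>h. (phi (t + h) - phi t) / h) = (\<lambda>h. if h = 0 then 0 else 1 / (1 + max h 0))"
      by (auto simp: fun_eq_iff phi_def 3)
    moreover have "((\<lambda>h. if h = 0 then 0 else 1 / (1 + max h 0)) \<longlongrightarrow> (1::real)) (at (0::real))"
      using calculation(1) by (subst filterlim_cong[OF refl refl, where g = "\<lambda>h. 1 / (1 + max h 0)"])
        (auto simp: eventually_at_filter)
    ultimately show ?thesis
      by (simp add: DERIV_def 3)
  qed
qed

lemma phi_diff_bounds:
  assumes "b \<le> a"
  shows "(a - b) / ((1 + max a 0) * (1 + max b 0)) \<le> phi a - phi b" "phi a - phi b \<le> a - b"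
proof -
  have le1: "y / (p * r) \<le> y" if "0 \<le> y" "1 \<le> p" "1 \<le> r" for y p r :: real
    using that mult_mono[of 1 p 1 r] by (simp add: divide_le_eq mult_left_mono mult_le_cancel_left1)
  have "(a - b) / ((1 + max a 0) * (1 + max b 0)) \<le> phi a - phi b \<and> phi a - phi b \<le> a - b"
  proof (cases "0 \<le> b")
    case True
    then have "phi a - phi b = (a - b) / ((1 + max a 0) * (1 + max b 0))"
      using assms by (simp add: phi_def field_simps)
    then show ?thesis using le1[of "a - b" "1 + max a 0" "1 + max b 0"] assms by simp
  next
    case False
    show ?thesis
    proof (cases "0 \<le> a")
      case True
      have "- b / (1 + a) \<le> - b" using le1[of "- b" "1 + a" 1] True False by simp
      then have "(a - b) / (1 + a) \<le> a / (1 + a) - b" by (simp add: diff_divide_distrib)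
      moreover have "a / (1 + a) \<le> a" using le1[of a "1 + a" 1] True by simp
      ultimately show ?thesis using True False by (simp add: phi_def)
    next
      case False
      then show ?thesis using assms by (simp add: phi_def)
    qed
  qed
  then show "(a - b) / ((1 + max a 0) * (1 + max b 0)) \<le> phi a - phi b" "phi a - phi b \<le> a - b"
    by auto
qed

lemma phi_lipschitz: "\<bar>phi a - phi b\<bar> \<le> \<bar>a - b\<bar>"
proof (cases "b \<le> a")
  case True
  moreover have "0 \<le> (a - b) / ((1 + max a 0) * (1 + max b 0))"
    using True by (intro divide_nonneg_nonneg mult_nonneg_nonneg) auto
  ultimately show ?thesis using phi_diff_bounds[of b a] by linarith
next
  case False
  moreover have "0 \<le> (b - a) / ((1 + max b 0) * (1 + max a 0))"
    using False by (intro divide_nonneg_nonneg mult_nonneg_nonneg) auto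
  ultimately show ?thesis using phi_diff_bounds[of a b] by linarith
qed

lemma phi_mono: "a \<le> b \<Longrightarrow> phi a \<le> phi b"
proof -
  assume "a \<le> b"
  then have "0 \<le> (b - a) / ((1 + max b 0) * (1 + max a 0))"
    by (intro divide_nonneg_nonneg mult_nonneg_nonneg) auto
  then show ?thesis using phi_diff_bounds(1)[OF \<open>a \<le> b\<close>] by linarith
qed

lemma deriv_phi_lipschitz:
  "\<bar>1 / (1 + max s 0)\<^sup>2 - 1 / (1 + max t 0)\<^sup>2\<bar> \<le> 2 * \<bar>s - t :: real\<bar>"
proof -
  have sq: "\<bar>1 / (1 + p)\<^sup>2 - 1 / (1 + r)\<^sup>2\<bar> \<le> 2 * \<bar>p - r\<bar>" if "0 \<le> p" "0 \<le> r" for p r :: real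
  proof -
    have inv: "\<bar>1 / (1 + p) - 1 / (1 + r)\<bar> \<le> \<bar>p - r\<bar>"
    proof -
      have "1 / (1 + p) - 1 / (1 + r) = (r - p) / ((1 + p) * (1 + r))"
        using that by (simp add: field_simps)
      also have "\<bar>\<dots>\<bar> = \<bar>p - r\<bar> / ((1 + p) * (1 + r))"
        using that by (simp add: abs_divide abs_mult)
      also have "\<dots> \<le> \<bar>p - r\<bar> / 1"
        using that mult_mono[of 1 "1 + p" 1 "1 + r"] by (intro divide_left_mono) auto
      finally show ?thesis by simp
    qed
    have "1 / (1 + p)\<^sup>2 - 1 / (1 + r)\<^sup>2 = (1 / (1 + p) - 1 / (1 + r)) * (1 / (1 + p) + 1 / (1 + r))"
      by (simp add: algebra_simps power2_eq_square)
    also have "\<bar>\<dots>\<bar> = \<bar>1 / (1 + p) - 1 / (1 + r)\<bar> * (1 / (1 + p) + 1 / (1 + r))"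
      using that by (simp add: abs_mult)
    also have "\<dots> \<le> \<bar>p - r\<bar> * (1 + 1)"
      using that inv by (intro mult_mono add_mono) auto
    finally show ?thesis by simp
  qed
  have "\<bar>max s 0 - max t 0\<bar> \<le> \<bar>s - t\<bar>" by linarith
  then show ?thesis using sq[of "max s 0" "max t 0", OF max.cobounded2 max.cobounded2] by linarith
qed

text \<open>The derivative of \<open>\<lambda>y. phi y - phi (y - s)\<close> is bounded by
  \<open>2 * \<bar>s\<bar>\<close>. Second differences of this kind replace a second derivative,
  which \<open>phi\<close> lacks at \<open>0\<close>.\<close>

lemma phi_second_difference:
  "\<bar>(phi a - phi (a - s)) - (phi b - phi (b - s))\<bar> \<le> 2 * \<bar>s\<bar> * \<bar>a - b\<bar>"
proof -
  have "norm ((\<lambda>y. phi y - phi (y - s)) a - (\<lambda>y. phi y - phi (y - s)) b) \<le> 2 * \<bar>s\<bar> * norm (a - b)"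
  proof (rule field_differentiable_bound[where S = UNIV
      and f' = "\<lambda>y. 1 / (1 + max y 0)\<^sup>2 - 1 / (1 + max (y - s) 0)\<^sup>2"])
    fix z :: real
    show "((\<lambda>y. phi y - phi (y - s)) has_field_derivative
        1 / (1 + max z 0)\<^sup>2 - 1 / (1 + max (z - s) 0)\<^sup>2) (at z within UNIV)"
      by (auto intro!: derivative_eq_intros DERIV_chain2[of phi] phi_deriv)
    show "norm (1 / (1 + max z 0)\<^sup>2 - 1 / (1 + max (z - s) 0)\<^sup>2) \<le> 2 * \<bar>s\<bar>"
      using deriv_phi_lipschitz[of z "z - s"] by simp
  qed auto
  then show ?thesis by simp
qed

lemma theta_lipschitz: "\<bar>theta a - theta b\<bar> \<le> \<bar>a - b\<bar>"
proof (cases "b \<le> a")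
  case True
  then show ?thesis using phi_diff_bounds(2)[of b a] phi_mono[of b a] by (simp add: theta_eq)
next
  case False
  then show ?thesis using phi_diff_bounds(2)[of a b] phi_mono[of a b] by (simp add: theta_eq)
qed

lemma theta_mono: "a \<le> b \<Longrightarrow> theta a \<le> theta b"
  using phi_diff_bounds(2)[of a b] by (simp add: theta_eq)

lemma theta_second_difference:
  "\<bar>(theta a - theta (a - s)) - (theta b - theta (b - s))\<bar> \<le> 2 * \<bar>s\<bar> * \<bar>a - b\<bar>"
  using phi_second_difference[of a s b] by (simp add: theta_eq algebra_simps)

section \<open>The entropy derivative\<close>

text \<open>For \<open>x \<ge> 0\<close> a Riemann sum for the integral of
  \<open>x / (1 + k * x)\<close> over \<open>k\<close> from \<open>0\<close> to \<open>m\<close>,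
  which is \<open>ln (1 + m * x)\<close>. The summand \<open>k = 0\<close> is linear and supplies
  the slope \<open>1\<close> that strong monotonicity needs.\<close>

definition ent :: "nat \<Rightarrow> real \<Rightarrow> real" where
  "ent m x = (\<Sum>k\<le>m. x / (1 + real k * max x 0))"

lemma ent_term_eq: "0 < k \<Longrightarrow> x / (1 + real k * max x 0) = phi (real k * x) / real k"
  by (simp add: phi_def max_def mult_le_0_iff)

lemma ent_term_diff:
  assumes "b \<le> a"
  shows "(a - b) / ((1 + real k * max a 0) * (1 + real k * max b 0))
      \<le> a / (1 + real k * max a 0) - b / (1 + real k * max b 0)"
    and "a / (1 + real k * max a 0) - b / (1 + real k * max b 0) \<le> a - b"
proof -
  have mx: "max (real k * y) 0 = real k * max y 0" for y :: real
    by (simp add: max_def zero_le_mult_iff mult_le_0_iff)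
  have "(a - b) / ((1 + real k * max a 0) * (1 + real k * max b 0))
      \<le> a / (1 + real k * max a 0) - b / (1 + real k * max b 0)
    \<and> a / (1 + real k * max a 0) - b / (1 + real k * max b 0) \<le> a - b"
  proof (cases "k = 0")
    case False
    have kab: "real k * b \<le> real k * a" using assms by (simp add: mult_left_mono)
    have "(a - b) / ((1 + real k * max a 0) * (1 + real k * max b 0))
        = (real k * a - real k * b) / ((1 + real k * max a 0) * (1 + real k * max b 0)) / real k"
      using False by (simp add: right_diff_distrib[symmetric])
    also have "\<dots> \<le> (phi (real k * a) - phi (real k * b)) / real k"
      using phi_diff_bounds(1)[OF kab] by (intro divide_right_mono) (auto simp: mx)
    finally have 1: "(a - b) / ((1 + real k * max a 0) * (1 + real k * max b 0))
        \<le> (phi (real k * a) - phi (real k * b)) / real k" .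
    have "(phi (real k * a) - phi (real k * b)) / real k \<le> (real k * a - real k * b) / real k"
      using phi_diff_bounds(2)[OF kab] by (intro divide_right_mono) auto
    also have "\<dots> = a - b" using False by (simp add: right_diff_distrib[symmetric])
    finally show ?thesis using 1 False by (simp add: ent_term_eq diff_divide_distrib)
  qed simp
  then show "(a - b) / ((1 + real k * max a 0) * (1 + real k * max b 0))
      \<le> a / (1 + real k * max a 0) - b / (1 + real k * max b 0)"
    and "a / (1 + real k * max a 0) - b / (1 + real k * max b 0) \<le> a - b" by auto
qed

text \<open>The summand is the difference of \<open>k / (1 + k * c)\<close> at \<open>Suc k\<close>
  and at \<open>k\<close>.\<close>

lemma sum_reciprocal_telescope:
  assumes "0 \<le> (c::real)"
  shows "(\<Sum>k<M. 1 / ((1 + real k * c) * (1 + real (Suc k) * c))) = real M / (1 + real M * c)"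
proof (induction M)
  case (Suc M)
  have "0 < 1 + real M * c" "0 < 1 + real (Suc M) * c"
    using assms by (auto intro!: add_pos_nonneg mult_nonneg_nonneg)
  then have "real M / (1 + real M * c) + 1 / ((1 + real M * c) * (1 + real (Suc M) * c))
      = real (Suc M) / (1 + real (Suc M) * c)"
    by (simp add: divide_simps del: of_nat_Suc) (simp add: algebra_simps)
  then show ?case using Suc by simp
qed simp

text \<open>The difference quotients of the summands dominate the terms of the telescoping sum above.\<close>

lemma ent_diff_lower:
  assumes "b \<le> a"
  shows "a - b \<le> ent m a - ent m b"
    and "(a - b) * (real m / (1 + real m * max a 0)) \<le> ent m a - ent m b"
proof -
  let ?d = "\<lambda>k. a / (1 + real k * max a 0) - b / (1 + real k * max b 0)"
  have ediff: "ent m a - ent m b = (\<Sum>k\<le>m. ?d k)" by (simp add: ent_def sum_subtractf)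
  have nn: "0 \<le> ?d k" for k
  proof -
    have "0 \<le> (a - b) / ((1 + real k * max a 0) * (1 + real k * max b 0))"
      using assms by (intro divide_nonneg_nonneg mult_nonneg_nonneg add_nonneg_nonneg) auto
    then show ?thesis using ent_term_diff(1)[OF assms, of k] by linarith
  qed
  have "?d 0 \<le> (\<Sum>k\<le>m. ?d k)" using nn by (intro member_le_sum) auto
  then show "a - b \<le> ent m a - ent m b" by (simp add: ediff)
  let ?c = "max a 0"
  have "(a - b) * (real m / (1 + real m * ?c))
      = (a - b) * (\<Sum>k<m. 1 / ((1 + real k * ?c) * (1 + real (Suc k) * ?c)))"
    by (subst sum_reciprocal_telescope) auto
  also have "\<dots> = (\<Sum>k<m. (a - b) / ((1 + real k * ?c) * (1 + real (Suc k) * ?c)))"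
    by (simp add: sum_distrib_left)
  also have "\<dots> \<le> (\<Sum>k<m. ?d k)"
  proof (intro sum_mono)
    fix k
    have p: "0 < 1 + real k * y" if "0 \<le> y" for y k using that by (auto intro!: add_pos_nonneg)
    have "(a - b) / ((1 + real k * ?c) * (1 + real (Suc k) * ?c))
        \<le> (a - b) / ((1 + real k * ?c) * (1 + real k * max b 0))"
    proof (intro divide_left_mono mult_left_mono mult_pos_pos)
      show "1 + real k * max b 0 \<le> 1 + real (Suc k) * ?c"
        using assms by (intro add_left_mono mult_mono) auto
    qed (use assms p[of ?c] p[of "max b 0"] in \<open>auto simp del: of_nat_Suc simp: less_imp_le\<close>)
    also have "\<dots> \<le> ?d k" by (rule ent_term_diff(1)[OF assms])
    finally show "(a - b) / ((1 + real k * ?c) * (1 + real (Suc k) * ?c)) \<le> ?d k" .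
  qed
  also have "\<dots> \<le> (\<Sum>k\<le>m. ?d k)" using nn by (intro sum_mono2) auto
  finally show "(a - b) * (real m / (1 + real m * max a 0)) \<le> ent m a - ent m b"
    by (simp add: ediff)
qed

lemma ent_strongly_monotone: "(a - b)\<^sup>2 \<le> (ent m a - ent m b) * (a - b)"
proof -
  have *: "(a - b)\<^sup>2 \<le> (ent m a - ent m b) * (a - b)" if "b \<le> a" for a b
    using mult_right_mono[OF ent_diff_lower(1)[OF that, of m], of "a - b"] that
    by (simp add: power2_eq_square)
  show ?thesis
  proof (cases "b \<le> a")
    case False
    then have "(b - a)\<^sup>2 \<le> (ent m b - ent m a) * (b - a)" using *[of a b] by auto
    then show ?thesis by (simp add: power2_commute algebra_simps)
  qed (use * in auto)
qed

text \<open>The product form is what Cauchy-Schwarz consumes in \<open>sol_l1_le_energy\<close>. The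
  slope of \<open>ent\<close> is smallest at the larger argument; the weight contains both arguments
  so as to be symmetric.\<close>

lemma ent_local_monotone:
  assumes "0 < m"
  shows "(a - b)\<^sup>2 \<le> (max a 0 + max b 0 + 1 / real m) * ((ent m a - ent m b) * (a - b))"
proof -
  have *: "(a - b)\<^sup>2 \<le> (max a 0 + max b 0 + 1 / real m) * ((ent m a - ent m b) * (a - b))"
    if ba: "b \<le> a" for a b
  proof -
    have pos: "0 < max a 0 + 1 / real m" using assms by (simp add: add_nonneg_pos)
    have "real m / (1 + real m * max a 0) = 1 / (max a 0 + 1 / real m)"
      using assms by (simp add: field_simps)
    then have "(a - b) / (max a 0 + 1 / real m) \<le> ent m a - ent m b"
      using ent_diff_lower(2)[OF ba, of m] by simp
    then have 1: "a - b \<le> (max a 0 + 1 / real m) * (ent m a - ent m b)"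
      using pos by (simp add: pos_divide_le_eq mult.commute)
    have "0 \<le> ent m a - ent m b" using ent_diff_lower(1)[OF ba, of m] ba by linarith
    then have "(max a 0 + 1 / real m) * (ent m a - ent m b)
        \<le> (max a 0 + max b 0 + 1 / real m) * (ent m a - ent m b)"
      by (intro mult_right_mono) auto
    then have "(a - b) * (a - b) \<le> ((max a 0 + max b 0 + 1 / real m) * (ent m a - ent m b)) * (a - b)"
      using 1 ba by (intro mult_right_mono) auto
    then show ?thesis by (simp add: power2_eq_square mult.assoc)
  qed
  show ?thesis
  proof (cases "b \<le> a")
    case False
    then have "(b - a)\<^sup>2 \<le> (max b 0 + max a 0 + 1 / real m) * ((ent m b - ent m a) * (b - a))"
      using *[of a b] by auto
    moreover have "(ent m b - ent m a) * (b - a) = (ent m a - ent m b) * (a - b)"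
      by (simp add: algebra_simps)
    ultimately show ?thesis by (simp add: power2_commute add.commute)
  qed (use * in auto)
qed

lemma ent_lipschitz: "\<bar>ent m a - ent m b\<bar> \<le> (real m + 1) * \<bar>a - b\<bar>"
proof -
  have *: "\<bar>a / (1 + real k * max a 0) - b / (1 + real k * max b 0)\<bar> \<le> \<bar>a - b\<bar>" for k
  proof (cases "k = 0")
    case False
    have "\<bar>phi (real k * a) - phi (real k * b)\<bar> \<le> \<bar>real k * a - real k * b\<bar>"
      by (rule phi_lipschitz)
    also have "\<dots> = real k * \<bar>a - b\<bar>"
      by (simp add: right_diff_distrib[symmetric] abs_mult)
    finally have "\<bar>phi (real k * a) - phi (real k * b)\<bar> / real k \<le> \<bar>a - b\<bar>"
      using False by (simp add: field_simps)
    then show ?thesis using False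
      by (simp add: ent_term_eq diff_divide_distrib[symmetric] abs_divide)
  qed simp
  have "\<bar>ent m a - ent m b\<bar>
      = \<bar>\<Sum>k\<le>m. a / (1 + real k * max a 0) - b / (1 + real k * max b 0)\<bar>"
    by (simp add: ent_def sum_subtractf)
  also have "\<dots> \<le> (\<Sum>k\<le>m. \<bar>a / (1 + real k * max a 0) - b / (1 + real k * max b 0)\<bar>)"
    by (rule sum_abs)
  also have "\<dots> \<le> (\<Sum>k\<le>m. \<bar>a - b\<bar>)" using * by (intro sum_mono) auto
  finally show ?thesis by (simp add: algebra_simps)
qed

lemma ent_second_difference:
  "\<bar>(ent m a - ent m (a - s)) - (ent m b - ent m (b - s))\<bar> \<le> 2 * (real m + 1)\<^sup>2 * (\<bar>s\<bar> * \<bar>a - b\<bar>)"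
proof -
  let ?g = "\<lambda>k x. x / (1 + real k * max x 0) :: real"
  have *: "\<bar>(?g k a - ?g k (a - s)) - (?g k b - ?g k (b - s))\<bar> \<le> 2 * (real m + 1) * (\<bar>s\<bar> * \<bar>a - b\<bar>)"
    if "k \<le> m" for k
  proof (cases "k = 0")
    case False
    let ?D = "(phi (real k * a) - phi (real k * a - real k * s))
        - (phi (real k * b) - phi (real k * b - real k * s))"
    have "\<bar>?D\<bar> \<le> 2 * \<bar>real k * s\<bar> * \<bar>real k * a - real k * b\<bar>"
      by (rule phi_second_difference)
    also have "\<dots> = real k * (2 * real k * (\<bar>s\<bar> * \<bar>a - b\<bar>))"
      by (simp add: right_diff_distrib[symmetric] abs_mult)
    finally have "\<bar>?D\<bar> / real k \<le> 2 * real k * (\<bar>s\<bar> * \<bar>a - b\<bar>)"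
      using False by (simp add: field_simps)
    also have "\<dots> \<le> 2 * (real m + 1) * (\<bar>s\<bar> * \<bar>a - b\<bar>)"
      using that by (intro mult_right_mono) auto
    finally show ?thesis using False
      by (simp add: ent_term_eq diff_divide_distrib[symmetric] abs_divide right_diff_distrib)
  qed simp
  have "\<bar>(ent m a - ent m (a - s)) - (ent m b - ent m (b - s))\<bar>
      = \<bar>\<Sum>k\<le>m. (?g k a - ?g k (a - s)) - (?g k b - ?g k (b - s))\<bar>"
    by (simp add: ent_def sum_subtractf)
  also have "\<dots> \<le> (\<Sum>k\<le>m. \<bar>(?g k a - ?g k (a - s)) - (?g k b - ?g k (b - s))\<bar>)"
    by (rule sum_abs)
  also have "\<dots> \<le> (\<Sum>k\<le>m. 2 * (real m + 1) * (\<bar>s\<bar> * \<bar>a - b\<bar>))"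
    using * by (intro sum_mono) auto
  also have "\<dots> = 2 * (real m + 1)\<^sup>2 * (\<bar>s\<bar> * \<bar>a - b\<bar>)"
    by (simp add: power2_eq_square algebra_simps)
  finally show ?thesis .
qed

lemma ent_0 [simp]: "ent m 0 = 0"
  by (simp add: ent_def)

text \<open>The summand \<open>k = 0\<close> is \<open>x\<close> itself, and every other one is at
  most \<open>1 / k\<close>, however large \<open>x\<close> is. The bound \<open>2\<close> is the
  one available for the entries of the computed solution, see \<open>sol_le_2\<close>.\<close>

lemma ent_upper:
  assumes "x \<le> 2"
  shows "ent m x \<le> 2 + (\<Sum>k<m. 1 / real (Suc k))"
proof (cases "0 \<le> x")
  case False
  then have "ent m x \<le> 0" using ent_diff_lower(1)[of x 0 m] by simp
  moreover have "0 \<le> (\<Sum>k<m. 1 / real (Suc k))" by (intro sum_nonneg) auto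
  ultimately show ?thesis by linarith
next
  case True
  have "{..m} = insert 0 (Suc ` {..<m})" by (simp add: lessThan_Suc_atMost[symmetric] lessThan_Suc_eq_insert_0)
  then have "ent m x = x + (\<Sum>k<m. x / (1 + real (Suc k) * max x 0))"
    by (simp add: ent_def sum.reindex del: of_nat_Suc)
  also have "\<dots> \<le> 2 + (\<Sum>k<m. 1 / real (Suc k))"
  proof (intro add_mono sum_mono assms)
    fix k
    have "0 < 1 + real (Suc k) * x" using True by (auto intro!: add_pos_nonneg)
    then show "x / (1 + real (Suc k) * max x 0) \<le> 1 / real (Suc k)"
      using True by (simp add: field_simps del: of_nat_Suc)
  qed
  finally show ?thesis .
qed

lemma ent_mult_self_ge: "x\<^sup>2 \<le> ent m x * x"
  using ent_strongly_monotone[of x 0 m] by simp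

section \<open>The operator\<close>

lemma finite_edges [simp]: "finite (edges n m)"
  by (simp add: edges_def)

lemma sum_edges: "(\<Sum>e\<in>edges n m. f e) = (\<Sum>u<n. \<Sum>v<m. f (u, v))"
  by (simp add: edges_def sum.cartesian_product)

lemma sum_edges_swap: "(\<Sum>e\<in>edges n m. f e) = (\<Sum>v<m. \<Sum>u<n. f (u, v))"
  unfolding sum_edges by (rule sum.swap)

text \<open>
  All polynomial factors are absorbed into powers of \<open>X\<close>; the exponents are generous, since they
  only enter the running time.
\<close>

locale size_params =
  fixes n m E :: nat
  assumes E_ge: "5 \<le> E"
begin

definition X :: real where "X = real E * real (n + m + 2)"
definition H :: real where "H = 2 + (\<Sum>k<m. 1 / real (Suc k))"
text \<open>A matching has at most \<open>n\<close> edges and each contributes at most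
  \<open>H\<close> to the entropy term, so the loss due to regularization is at most
  \<open>1 / E\<close>; \<open>n + 1\<close> avoids a zero denominator.\<close>

definition lam :: real where "lam = 1 / (real E * real (n + 1) * H)"
text \<open>Calibrated so that violating a constraint by more than \<open>1 / X\<close> would exceed
  the total penalty \<open>2\<close> allowed by \<open>penalty_le\<close>; the third power stems
  from \<open>theta_negative_part\<close>.\<close>

definition Lam :: real where "Lam = 4 * X ^ 3"
text \<open>The operator has the Lipschitz constant \<open>X ^ 6\<close>, and
  \<open>eta * X ^ 12 = 1 / X ^ 2 \<le> lam\<close> is the condition under which a gradient step
  contracts.\<close>

definition eta :: real where "eta = 1 / X ^ 14"

definition ip :: "(edge \<Rightarrow> real) \<Rightarrow> (edge \<Rightarrow> real) \<Rightarrow> real" where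
  "ip x y = (\<Sum>e\<in>edges n m. x e * y e)"

definition nrm :: "(edge \<Rightarrow> real) \<Rightarrow> real" where
  "nrm x = L2_set x (edges n m)"

definition row :: "(edge \<Rightarrow> real) \<Rightarrow> nat \<Rightarrow> real" where
  "row x u = (\<Sum>v<m. x (u, v))"

definition col :: "(edge \<Rightarrow> real) \<Rightarrow> nat \<Rightarrow> real" where
  "col x v = (\<Sum>u<n. x (u, v))"

text \<open>For \<open>ip a x \<ge> 0\<close> this is the gradient of a convex function whose last
  summand is \<open>- ln (1 + ip a x)\<close>. The term for nonnegativity has the opposite sign
  because it penalizes \<open>- x e\<close>.\<close>

definition grad :: "(edge \<Rightarrow> real) \<Rightarrow> (edge \<Rightarrow> real) \<Rightarrow> edge \<Rightarrow> real" where
  "grad a x e = lam * ent m (x e)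
     + Lam * (theta (row x (fst e) - 1) + theta (col x (snd e) - 1) - theta (- x e))
     - a e * (1 - phi (ip a x))"

definition unit_weights :: "(edge \<Rightarrow> real) \<Rightarrow> bool" where
  "unit_weights a \<longleftrightarrow> (\<forall>e. 0 \<le> a e \<and> a e \<le> 1)"

lemma X_ge: "10 \<le> X" "real n + real m + 2 \<le> X" "real E \<le> X" "5 * (real n + real m + 2) \<le> X"
proof -
  show 5: "5 * (real n + real m + 2) \<le> X"
    unfolding X_def using E_ge by (intro mult_mono) auto
  then show "10 \<le> X" "real n + real m + 2 \<le> X" by simp_all
  have "real E * 1 \<le> X" unfolding X_def by (intro mult_left_mono) auto
  then show "real E \<le> X" by simp
qed

lemma X_power_mono: "i \<le> j \<Longrightarrow> X ^ i \<le> X ^ j"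
  using X_ge(1) by (intro power_increasing) auto

lemma X_absorb: "c \<le> 10 \<Longrightarrow> c * X ^ i \<le> X ^ Suc i"
  using X_ge(1) mult_right_mono[of c X "X ^ i"] by simp

lemma X_pos [simp]: "0 < X" "0 \<le> X" "X \<noteq> 0"
  using X_ge(1) by linarith+

lemma X_ge_1: "1 \<le> X" "1 \<le> X ^ i"
  using X_ge(1) by (auto intro: one_le_power)

lemma H_bounds: "2 \<le> H" "H \<le> real m + 2"
proof -
  have "0 \<le> (\<Sum>k<m. 1 / real (Suc k))" by (intro sum_nonneg) auto
  then show "2 \<le> H" by (simp add: H_def)
  have "(\<Sum>k<m. 1 / real (Suc k)) \<le> (\<Sum>k<m. 1)" by (intro sum_mono) auto
  then show "H \<le> real m + 2" by (simp add: H_def)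
qed

lemma lam_bounds: "0 < lam" "lam \<le> 1" "1 \<le> lam * X\<^sup>2"
proof -
  have pos: "0 < real E * real (n + 1) * H" using E_ge H_bounds(1) by (intro mult_pos_pos) auto
  then show "0 < lam" by (simp add: lam_def)
  have "1 * 1 * 1 \<le> real E * real (n + 1) * H"
    using E_ge H_bounds(1) by (intro mult_mono mult_nonneg_nonneg) auto
  then show "lam \<le> 1" using pos by (simp add: lam_def divide_le_eq)
  have "real E * real (n + 1) * H \<le> X * real (n + m + 2)"
    unfolding X_def mult.assoc
    using H_bounds by (intro mult_left_mono mult_mono) auto
  also have "\<dots> \<le> X * X" using X_ge by (intro mult_left_mono) auto
  finally show "1 \<le> lam * X\<^sup>2" using pos by (simp add: lam_def le_divide_eq power2_eq_square)
qed

lemma eta_bounds: "0 < eta" "eta \<le> 1"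
  using X_ge_1(2) by (auto simp: eta_def divide_le_eq)

lemma Lam_pos: "0 < Lam"
  by (simp add: Lam_def)

section \<open>Inner product, norm, row and column sums\<close>

lemma ip_diff_right: "ip x (\<lambda>e. y e - z e) = ip x y - ip x z"
  by (simp add: ip_def right_diff_distrib sum_subtractf)

lemma ip_diff_left: "ip (\<lambda>e. y e - z e) x = ip y x - ip z x"
  by (simp add: ip_def left_diff_distrib sum_subtractf)

lemma nrm_nonneg [simp]: "0 \<le> nrm x"
  by (simp add: nrm_def)

lemma nrm_square: "(nrm x)\<^sup>2 = ip x x"
  by (simp add: nrm_def L2_set_def ip_def sum_nonneg power2_eq_square)

lemma ip_le_nrm: "\<bar>ip x y\<bar> \<le> nrm x * nrm y"
proof -
  have "\<bar>ip x y\<bar> \<le> (\<Sum>e\<in>edges n m. \<bar>x e\<bar> * \<bar>y e\<bar>)"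
    unfolding ip_def abs_mult[symmetric] by (rule sum_abs)
  also have "\<dots> \<le> nrm x * nrm y" unfolding nrm_def by (rule L2_set_mult_ineq)
  finally show ?thesis .
qed

lemma nrm_add: "nrm (\<lambda>e. x e + y e) \<le> nrm x + nrm y"
  unfolding nrm_def by (rule L2_set_triangle_ineq)

lemma nrm_scale: "nrm (\<lambda>e. c * x e) = \<bar>c\<bar> * nrm x"
proof -
  have "L2_set (\<lambda>e. c * x e) (edges n m) = sqrt (c\<^sup>2 * (\<Sum>e\<in>edges n m. (x e)\<^sup>2))"
    by (simp add: L2_set_def power_mult_distrib sum_distrib_left)
  then show ?thesis by (simp add: nrm_def L2_set_def real_sqrt_mult)
qed

lemma nrm_uminus: "nrm (\<lambda>e. - x e) = nrm x"
  using nrm_scale[of "-1" x] by simp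

lemma nrm_diff: "nrm (\<lambda>e. x e - y e) \<le> nrm x + nrm y"
  using nrm_add[of x "\<lambda>e. - y e"] by (simp add: nrm_uminus)

lemma nrm_minus_commute: "nrm (\<lambda>e. x e - y e) = nrm (\<lambda>e. y e - x e)"
  using nrm_uminus[of "\<lambda>e. x e - y e"] by simp

lemma component_le_nrm: "e \<in> edges n m \<Longrightarrow> \<bar>x e\<bar> \<le> nrm x"
  using member_le_L2_set[of "edges n m" e "\<lambda>e. \<bar>x e\<bar>"]
  by (simp add: nrm_def L2_set_def)

lemma nrm_le:
  assumes "\<And>e. e \<in> edges n m \<Longrightarrow> \<bar>x e\<bar> \<le> B" "0 \<le> B"
  shows "nrm x \<le> X * B"
proof -
  have "(nrm x)\<^sup>2 \<le> (\<Sum>e\<in>edges n m. B\<^sup>2)"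
    unfolding nrm_square ip_def
    using assms by (intro sum_mono) (simp add: power2_eq_square[symmetric] abs_le_square_iff[symmetric])
  also have "\<dots> = real n * real m * B\<^sup>2" by (simp add: edges_def)
  also have "\<dots> \<le> X * X * B\<^sup>2"
    using X_ge by (intro mult_right_mono mult_mono) auto
  finally have "(nrm x)\<^sup>2 \<le> (X * B)\<^sup>2" by (simp add: power2_eq_square algebra_simps)
  then show ?thesis using assms(2) by (simp add: power2_le_iff_abs_le)
qed

lemma row_le_nrm: "u < n \<Longrightarrow> \<bar>row x u\<bar> \<le> real m * nrm x"
proof -
  assume u: "u < n"
  have "\<bar>row x u\<bar> \<le> (\<Sum>v<m. \<bar>x (u, v)\<bar>)" unfolding row_def by (rule sum_abs)
  also have "\<dots> \<le> (\<Sum>v<m. nrm x)"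
    using u by (intro sum_mono component_le_nrm) (auto simp: edges_def)
  finally show ?thesis by simp
qed

lemma col_le_nrm: "v < m \<Longrightarrow> \<bar>col x v\<bar> \<le> real n * nrm x"
proof -
  assume v: "v < m"
  have "\<bar>col x v\<bar> \<le> (\<Sum>u<n. \<bar>x (u, v)\<bar>)" unfolding col_def by (rule sum_abs)
  also have "\<dots> \<le> (\<Sum>u<n. nrm x)"
    using v by (intro sum_mono component_le_nrm) (auto simp: edges_def)
  finally show ?thesis by simp
qed

lemma row_diff: "row (\<lambda>e. x e - y e) u = row x u - row y u"
  by (simp add: row_def sum_subtractf)

lemma col_diff: "col (\<lambda>e. x e - y e) v = col x v - col y v"
  by (simp add: col_def sum_subtractf)

lemma ip_le_sup:
  assumes "\<And>e. e \<in> edges n m \<Longrightarrow> \<bar>a e\<bar> \<le> B"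
  shows "\<bar>ip a x\<bar> \<le> X\<^sup>2 * (B * nrm x)"
proof (cases "edges n m = {}")
  case True
  have "\<bar>ip a x\<bar> = 0" by (simp add: ip_def True)
  moreover have "nrm x = 0" by (simp add: nrm_def True)
  ultimately show ?thesis by simp
next
  case False
  then obtain e0 where "e0 \<in> edges n m" by auto
  then have B: "0 \<le> B" using assms[of e0] by linarith
  have "\<bar>ip a x\<bar> \<le> (\<Sum>e\<in>edges n m. \<bar>a e * x e\<bar>)" unfolding ip_def by (rule sum_abs)
  also have "\<dots> \<le> (\<Sum>e\<in>edges n m. B * nrm x)"
    unfolding abs_mult using assms B component_le_nrm by (intro sum_mono mult_mono) auto
  also have "\<dots> = (real n * real m) * (B * nrm x)" by (simp add: edges_def)
  also have "\<dots> \<le> (X * X) * (B * nrm x)"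
    using X_ge B by (intro mult_right_mono mult_mono mult_nonneg_nonneg) auto
  finally show ?thesis by (simp add: power2_eq_square)
qed

lemma unit_weights_abs: "unit_weights a \<Longrightarrow> \<bar>a e\<bar> \<le> 1"
  unfolding unit_weights_def by (drule spec[of _ e]) simp

lemma ip_unit_le: "unit_weights a \<Longrightarrow> \<bar>ip a x\<bar> \<le> X\<^sup>2 * nrm x"
  using ip_le_sup[of a 1 x] by (simp add: unit_weights_abs)

section \<open>Monotonicity and smoothness of the operator\<close>

text \<open>The penalties are monotone and are dropped. The contribution of the logarithm is
  monotone as well but is kept: in \<open>sol_l1_lipschitz\<close> it pays for the change of the
  normalizer.\<close>

lemma grad_monotone_gap:
  "lam * (\<Sum>e\<in>edges n m. (ent m (x e) - ent m (y e)) * (x e - y e))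
     + (phi (ip a x) - phi (ip a y)) * (ip a x - ip a y)
   \<le> ip (\<lambda>e. grad a x e - grad a y e) (\<lambda>e. x e - y e)"
proof -
  let ?R = "\<lambda>u. theta (row x u - 1) - theta (row y u - 1)"
  let ?C = "\<lambda>v. theta (col x v - 1) - theta (col y v - 1)"
  let ?T = "\<lambda>e. theta (- x e) - theta (- y e)"
  have mono: "0 \<le> (theta p - theta r) * (p - r)" for p r :: real
    using theta_mono[of p r] theta_mono[of r p]
    by (cases "p \<le> r") (auto intro: mult_nonneg_nonneg mult_nonpos_nonpos)
  have "ip (\<lambda>e. grad a x e - grad a y e) (\<lambda>e. x e - y e)
      = (\<Sum>e\<in>edges n m. lam * ((ent m (x e) - ent m (y e)) * (x e - y e))
          + Lam * (?R (fst e) * (x e - y e)) + Lam * (?C (snd e) * (x e - y e))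
          + Lam * (?T e * ((- x e) - (- y e)))
          + (phi (ip a x) - phi (ip a y)) * (a e * (x e - y e)))"
    unfolding ip_def[of "\<lambda>e. grad a x e - grad a y e"]
    by (intro sum.cong refl) (simp add: grad_def algebra_simps)
  also have "\<dots> = lam * (\<Sum>e\<in>edges n m. (ent m (x e) - ent m (y e)) * (x e - y e))
      + Lam * (\<Sum>e\<in>edges n m. ?R (fst e) * (x e - y e))
      + Lam * (\<Sum>e\<in>edges n m. ?C (snd e) * (x e - y e))
      + Lam * (\<Sum>e\<in>edges n m. ?T e * ((- x e) - (- y e)))
      + (phi (ip a x) - phi (ip a y)) * ip a (\<lambda>e. x e - y e)"
    unfolding sum.distrib sum_distrib_left[symmetric] by (simp add: ip_def)
  also have "(\<Sum>e\<in>edges n m. ?R (fst e) * (x e - y e)) = (\<Sum>u<n. ?R u * ((row x u - 1) - (row y u - 1)))"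
    by (simp add: sum_edges row_def sum_subtractf sum_distrib_left[symmetric])
  also have "(\<Sum>e\<in>edges n m. ?C (snd e) * (x e - y e)) = (\<Sum>v<m. ?C v * ((col x v - 1) - (col y v - 1)))"
    by (simp add: sum_edges_swap col_def sum_subtractf sum_distrib_left[symmetric])
  finally have eq: "ip (\<lambda>e. grad a x e - grad a y e) (\<lambda>e. x e - y e)
    = lam * (\<Sum>e\<in>edges n m. (ent m (x e) - ent m (y e)) * (x e - y e))
      + Lam * (\<Sum>u<n. ?R u * ((row x u - 1) - (row y u - 1)))
      + Lam * (\<Sum>v<m. ?C v * ((col x v - 1) - (col y v - 1)))
      + Lam * (\<Sum>e\<in>edges n m. ?T e * ((- x e) - (- y e)))
      + (phi (ip a x) - phi (ip a y)) * (ip a x - ip a y)" by (simp add: ip_diff_right)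
  have "0 \<le> Lam * (\<Sum>u<n. ?R u * ((row x u - 1) - (row y u - 1)))"
    "0 \<le> Lam * (\<Sum>v<m. ?C v * ((col x v - 1) - (col y v - 1)))"
    "0 \<le> Lam * (\<Sum>e\<in>edges n m. ?T e * ((- x e) - (- y e)))"
    using Lam_pos by (intro mult_nonneg_nonneg sum_nonneg mono; simp)+
  then show ?thesis unfolding eq by linarith
qed

lemma grad_strongly_monotone:
  "lam * (nrm (\<lambda>e. x e - y e))\<^sup>2 \<le> ip (\<lambda>e. grad a x e - grad a y e) (\<lambda>e. x e - y e)"
proof -
  have "(nrm (\<lambda>e. x e - y e))\<^sup>2 \<le> (\<Sum>e\<in>edges n m. (ent m (x e) - ent m (y e)) * (x e - y e))"
    unfolding nrm_square ip_def
    by (intro sum_mono) (use ent_strongly_monotone in \<open>simp add: power2_eq_square\<close>)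
  then have "lam * (nrm (\<lambda>e. x e - y e))\<^sup>2
      \<le> lam * (\<Sum>e\<in>edges n m. (ent m (x e) - ent m (y e)) * (x e - y e))"
    using lam_bounds by (intro mult_left_mono) auto
  moreover have "0 \<le> (phi p - phi r) * (p - r)" for p r
    using phi_mono[of p r] phi_mono[of r p]
    by (cases "p \<le> r") (auto intro: mult_nonneg_nonneg mult_nonpos_nonpos)
  ultimately show ?thesis using grad_monotone_gap[of x y a] by (smt (verit))
qed

lemma grad_lipschitz:
  assumes "unit_weights a"
  shows "nrm (\<lambda>e. grad a x e - grad a y e) \<le> X ^ 6 * nrm (\<lambda>e. x e - y e)"
proof -
  define d where "d = nrm (\<lambda>e. x e - y e)"
  have d: "0 \<le> d" by (simp add: d_def)
  have "\<bar>grad a x e - grad a y e\<bar> \<le> X ^ 5 * d" if e: "e \<in> edges n m" for e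
  proof -
    obtain u v where uv: "e = (u, v)" "u < n" "v < m" using e by (auto simp: edges_def)
    have xe: "\<bar>x e - y e\<bar> \<le> d" using component_le_nrm[OF e, of "\<lambda>e. x e - y e"] by (simp add: d_def)
    have "\<bar>ent m (x e) - ent m (y e)\<bar> \<le> (real m + 1) * \<bar>x e - y e\<bar>" by (rule ent_lipschitz)
    also have "\<dots> \<le> X * d" using xe X_ge by (intro mult_mono) auto
    finally have 1: "\<bar>lam * (ent m (x e) - ent m (y e))\<bar> \<le> X * d"
      using lam_bounds mult_mono[of lam 1 "\<bar>ent m (x e) - ent m (y e)\<bar>" "X * d"] d
      by (simp add: abs_mult)
    have r: "\<bar>theta (row x u - 1) - theta (row y u - 1)\<bar> \<le> real m * d"
      using theta_lipschitz[of "row x u - 1" "row y u - 1"]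
        row_le_nrm[OF uv(2), of "\<lambda>e. x e - y e"] by (simp add: row_diff d_def)
    have c: "\<bar>theta (col x v - 1) - theta (col y v - 1)\<bar> \<le> real n * d"
      using theta_lipschitz[of "col x v - 1" "col y v - 1"]
        col_le_nrm[OF uv(3), of "\<lambda>e. x e - y e"] by (simp add: col_diff d_def)
    have t: "\<bar>theta (- x e) - theta (- y e)\<bar> \<le> d"
      using theta_lipschitz[of "- x e" "- y e"] xe by linarith
    let ?P = "theta (row x u - 1) - theta (row y u - 1) + (theta (col x v - 1) - theta (col y v - 1))
      - (theta (- x e) - theta (- y e))"
    have "\<bar>?P\<bar> \<le> (real n + real m + 1) * d" using r c t by (simp add: algebra_simps)
    also have "\<dots> \<le> X * d" using X_ge d by (intro mult_right_mono) auto
    finally have "\<bar>Lam * ?P\<bar> \<le> Lam * (X * d)"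
      unfolding abs_mult using Lam_pos by (intro mult_mono) auto
    also have "\<dots> = 4 * X ^ 4 * d" by (simp add: Lam_def power_numeral_reduce)
    finally have 2: "\<bar>Lam * ?P\<bar> \<le> 4 * X ^ 4 * d" .
    have "\<bar>phi (ip a x) - phi (ip a y)\<bar> \<le> \<bar>ip a (\<lambda>e. x e - y e)\<bar>"
      using phi_lipschitz[of "ip a x" "ip a y"] by (simp add: ip_diff_right)
    also have "\<dots> \<le> X\<^sup>2 * d" using ip_unit_le[OF assms] by (simp add: d_def)
    finally have 3: "\<bar>a e * (phi (ip a x) - phi (ip a y))\<bar> \<le> X\<^sup>2 * d"
      using mult_mono[OF unit_weights_abs[OF assms, of e], of "\<bar>phi (ip a x) - phi (ip a y)\<bar>" "X\<^sup>2 * d"]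
      by (simp add: abs_mult)
    have "grad a x e - grad a y e = lam * (ent m (x e) - ent m (y e)) + Lam * ?P
        + a e * (phi (ip a x) - phi (ip a y))"
      by (simp add: grad_def uv algebra_simps)
    then have "\<bar>grad a x e - grad a y e\<bar> \<le> X * d + 4 * X ^ 4 * d + X\<^sup>2 * d" using 1 2 3 by linarith
    also have "\<dots> \<le> X ^ 4 * d + 4 * X ^ 4 * d + X ^ 4 * d"
      using X_power_mono[of 1 4] X_power_mono[of 2 4] d by (intro add_mono mult_right_mono) auto
    also have "\<dots> = (6 * X ^ 4) * d" by simp
    also have "\<dots> \<le> X ^ 5 * d" using X_absorb[of 6 4] d by (intro mult_right_mono) auto
    finally show ?thesis .
  qed
  then have "nrm (\<lambda>e. grad a x e - grad a y e) \<le> X * (X ^ 5 * d)"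
    using d by (intro nrm_le) auto
  then show ?thesis by (simp add: d_def power_numeral_reduce mult.assoc)
qed

text \<open>Increments along the same step \<open>h\<close> are compared at two base points. In the
  iteration \<open>h\<close> is \<open>eta\<close> times a residual, so the bound inherits the decay
  of the residual.\<close>

lemma grad_second_difference:
  assumes "unit_weights a"
  shows "nrm (\<lambda>e. (grad a x e - grad a (\<lambda>e. x e - h e) e) - (grad a y e - grad a (\<lambda>e. y e - h e) e))
    \<le> X ^ 8 * (nrm h * nrm (\<lambda>e. x e - y e))"
proof -
  define d where "d = nrm h * nrm (\<lambda>e. x e - y e)"
  have d: "0 \<le> d" by (simp add: d_def)
  have "\<bar>(grad a x e - grad a (\<lambda>e. x e - h e) e) - (grad a y e - grad a (\<lambda>e. y e - h e) e)\<bar> \<le> X ^ 7 * d"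
    if e: "e \<in> edges n m" for e
  proof -
    obtain u v where uv: "e = (u, v)" "u < n" "v < m" using e by (auto simp: edges_def)
    have hx: "\<bar>h e\<bar> * \<bar>x e - y e\<bar> \<le> d"
      using component_le_nrm[OF e, of h] component_le_nrm[OF e, of "\<lambda>e. x e - y e"]
      unfolding d_def by (intro mult_mono) auto
    let ?A = "(ent m (x e) - ent m (x e - h e)) - (ent m (y e) - ent m (y e - h e))"
    have "\<bar>?A\<bar> \<le> 2 * (real m + 1)\<^sup>2 * (\<bar>h e\<bar> * \<bar>x e - y e\<bar>)" by (rule ent_second_difference)
    also have "\<dots> \<le> 2 * X\<^sup>2 * d"
      using hx X_ge by (intro mult_mono power_mono) auto
    finally have 1: "\<bar>lam * ?A\<bar> \<le> 2 * X\<^sup>2 * d"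
      using lam_bounds mult_mono[of lam 1 "\<bar>?A\<bar>" "2 * X\<^sup>2 * d"] d by (simp add: abs_mult)
    let ?R = "(theta (row x u - 1) - theta (row x u - 1 - row h u))
      - (theta (row y u - 1) - theta (row y u - 1 - row h u))"
    have "\<bar>?R\<bar> \<le> 2 * \<bar>row h u\<bar> * \<bar>row (\<lambda>e. x e - y e) u\<bar>"
      using theta_second_difference[of "row x u - 1" "row h u" "row y u - 1"] by (simp add: row_diff)
    also have "\<dots> \<le> 2 * (real m * nrm h) * (real m * nrm (\<lambda>e. x e - y e))"
      using row_le_nrm[OF uv(2)] by (intro mult_mono) auto
    also have "\<dots> = 2 * (real m)\<^sup>2 * d" by (simp add: d_def power2_eq_square)
    also have "\<dots> \<le> 2 * X\<^sup>2 * d" using X_ge d by (intro mult_mono power_mono) auto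
    finally have R: "\<bar>?R\<bar> \<le> 2 * X\<^sup>2 * d" .
    let ?C = "(theta (col x v - 1) - theta (col x v - 1 - col h v))
      - (theta (col y v - 1) - theta (col y v - 1 - col h v))"
    have "\<bar>?C\<bar> \<le> 2 * \<bar>col h v\<bar> * \<bar>col (\<lambda>e. x e - y e) v\<bar>"
      using theta_second_difference[of "col x v - 1" "col h v" "col y v - 1"] by (simp add: col_diff)
    also have "\<dots> \<le> 2 * (real n * nrm h) * (real n * nrm (\<lambda>e. x e - y e))"
      using col_le_nrm[OF uv(3)] by (intro mult_mono) auto
    also have "\<dots> = 2 * (real n)\<^sup>2 * d" by (simp add: d_def power2_eq_square)
    also have "\<dots> \<le> 2 * X\<^sup>2 * d" using X_ge d by (intro mult_mono power_mono) auto
    finally have C: "\<bar>?C\<bar> \<le> 2 * X\<^sup>2 * d" .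
    let ?T = "(theta (- x e) - theta (- x e - (- h e))) - (theta (- y e) - theta (- y e - (- h e)))"
    have "\<bar>?T\<bar> \<le> 2 * \<bar>- h e\<bar> * \<bar>- x e - (- y e)\<bar>" by (rule theta_second_difference)
    also have "\<dots> \<le> 2 * d" using hx by (simp add: abs_minus_commute)
    also have "\<dots> \<le> 2 * X\<^sup>2 * d" using X_ge_1(2)[of 2] d mult_right_mono[of 1 "X\<^sup>2" d] by simp
    finally have T: "\<bar>?T\<bar> \<le> 2 * X\<^sup>2 * d" .
    have "\<bar>?R + ?C - ?T\<bar> \<le> 6 * X\<^sup>2 * d" using R C T by linarith
    then have "\<bar>Lam * (?R + ?C - ?T)\<bar> \<le> Lam * (6 * X\<^sup>2 * d)"
      unfolding abs_mult using Lam_pos by (intro mult_mono) auto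
    also have "\<dots> = 24 * X ^ 5 * d" by (simp add: Lam_def power_numeral_reduce)
    finally have 2: "\<bar>Lam * (?R + ?C - ?T)\<bar> \<le> 24 * X ^ 5 * d" .
    let ?F = "(phi (ip a x) - phi (ip a x - ip a h)) - (phi (ip a y) - phi (ip a y - ip a h))"
    have "\<bar>?F\<bar> \<le> 2 * \<bar>ip a h\<bar> * \<bar>ip a (\<lambda>e. x e - y e)\<bar>"
      unfolding ip_diff_right by (rule phi_second_difference)
    also have "\<dots> \<le> 2 * (X\<^sup>2 * nrm h) * (X\<^sup>2 * nrm (\<lambda>e. x e - y e))"
      using ip_unit_le[OF assms] by (intro mult_mono) auto
    also have "\<dots> = 2 * X ^ 4 * d" by (simp add: d_def power_numeral_reduce)
    finally have 3: "\<bar>a e * ?F\<bar> \<le> 2 * X ^ 4 * d"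
      using mult_mono[OF unit_weights_abs[OF assms, of e], of "\<bar>?F\<bar>" "2 * X ^ 4 * d"]
      by (simp add: abs_mult)
    have "(grad a x e - grad a (\<lambda>e. x e - h e) e) - (grad a y e - grad a (\<lambda>e. y e - h e) e)
        = lam * ?A + Lam * (?R + ?C - ?T) + a e * ?F"
      by (simp add: grad_def uv row_diff col_diff ip_diff_right algebra_simps)
    then have "\<bar>(grad a x e - grad a (\<lambda>e. x e - h e) e) - (grad a y e - grad a (\<lambda>e. y e - h e) e)\<bar>
        \<le> 2 * X\<^sup>2 * d + 24 * X ^ 5 * d + 2 * X ^ 4 * d" using 1 2 3 by linarith
    also have "\<dots> \<le> 2 * X ^ 5 * d + 24 * X ^ 5 * d + 2 * X ^ 5 * d"
      using X_power_mono[of 2 5] X_power_mono[of 4 5] d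
      by (intro add_mono mult_right_mono mult_left_mono) auto
    also have "\<dots> = (28 * X ^ 5) * d" by simp
    also have "\<dots> \<le> X ^ 7 * d"
    proof (rule mult_right_mono[OF _ d])
      have "28 * X ^ 5 \<le> (10 * 10) * X ^ 5" by (intro mult_right_mono) auto
      also have "\<dots> \<le> (X * X) * X ^ 5" using X_ge(1) by (intro mult_right_mono mult_mono) auto
      finally show "28 * X ^ 5 \<le> X ^ 7" by (simp add: power_numeral_reduce)
    qed
    finally show ?thesis .
  qed
  then have "nrm (\<lambda>e. (grad a x e - grad a (\<lambda>e. x e - h e) e) - (grad a y e - grad a (\<lambda>e. y e - h e) e))
      \<le> X * (X ^ 7 * d)"
    using d by (intro nrm_le) auto
  then show ?thesis by (simp add: d_def power_numeral_reduce mult.assoc)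
qed

lemma grad_weight_lipschitz:
  assumes "unit_weights a" "unit_weights b"
    and "\<And>e. e \<in> edges n m \<Longrightarrow> \<bar>a e - b e\<bar> \<le> \<delta>" and "0 \<le> \<delta>"
    and "nrm x \<le> X ^ 4"
  shows "nrm (\<lambda>e. grad a x e - grad b x e) \<le> X ^ 8 * \<delta>"
proof -
  have t: "\<bar>ip a x\<bar> \<le> X ^ 6"
  proof -
    have "\<bar>ip a x\<bar> \<le> X\<^sup>2 * nrm x" by (rule ip_unit_le[OF assms(1)])
    also have "\<dots> \<le> X\<^sup>2 * X ^ 4" using assms(5) by (intro mult_left_mono) auto
    finally show ?thesis by (simp flip: power_add)
  qed
  have dt: "\<bar>ip a x - ip b x\<bar> \<le> X ^ 6 * \<delta>"
  proof -
    have "\<bar>ip a x - ip b x\<bar> \<le> X\<^sup>2 * (\<delta> * nrm x)"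
      using ip_le_sup[of "\<lambda>e. a e - b e" \<delta> x] assms(3) by (simp add: ip_diff_left)
    also have "\<dots> \<le> X\<^sup>2 * (\<delta> * X ^ 4)" using assms(4,5) by (intro mult_left_mono) auto
    finally show ?thesis by (simp add: power_numeral_reduce algebra_simps)
  qed
  have "\<bar>grad a x e - grad b x e\<bar> \<le> X ^ 7 * \<delta>" if e: "e \<in> edges n m" for e
  proof -
    have "\<bar>phi (ip a x)\<bar> \<le> X ^ 6" using phi_lipschitz[of "ip a x" 0] t by simp
    then have "\<bar>1 - phi (ip a x)\<bar> \<le> 2 * X ^ 6" using X_ge_1(2)[of 6] by linarith
    then have 1: "\<bar>(a e - b e) * (1 - phi (ip a x))\<bar> \<le> \<delta> * (2 * X ^ 6)"
      unfolding abs_mult using assms(3)[OF e] assms(4) by (intro mult_mono) auto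
    have "\<bar>phi (ip a x) - phi (ip b x)\<bar> \<le> X ^ 6 * \<delta>"
      using phi_lipschitz[of "ip a x" "ip b x"] dt by linarith
    then have 2: "\<bar>b e * (phi (ip a x) - phi (ip b x))\<bar> \<le> 1 * (X ^ 6 * \<delta>)"
      unfolding abs_mult using unit_weights_abs[OF assms(2)] by (intro mult_mono) auto
    have "grad a x e - grad b x e = - ((a e - b e) * (1 - phi (ip a x)))
        + b e * (phi (ip a x) - phi (ip b x))"
      by (simp add: grad_def algebra_simps)
    then have "\<bar>grad a x e - grad b x e\<bar> \<le> (3 * X ^ 6) * \<delta>" using 1 2 by (simp add: algebra_simps)
    also have "\<dots> \<le> X ^ 7 * \<delta>" using X_absorb[of 3 6] assms(4) by (intro mult_right_mono) auto
    finally show ?thesis .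
  qed
  then have "nrm (\<lambda>e. grad a x e - grad b x e) \<le> X * (X ^ 7 * \<delta>)"
    using assms(4) by (intro nrm_le) auto
  then show ?thesis by (simp add: power_numeral_reduce mult.assoc)
qed

text \<open>Only the logarithmic term depends on the weights, so the entropy and the penalties
  cancel. The bound on \<open>nrm x\<close> is the one valid for all iterates; it controls the
  distance of \<open>ip a x\<close> and \<open>ip b x\<close>.\<close>

lemma grad_mixed_difference:
  assumes "unit_weights a" "unit_weights b"
    and "\<And>e. e \<in> edges n m \<Longrightarrow> \<bar>a e - b e\<bar> \<le> \<delta>" and "0 \<le> \<delta>"
    and "nrm x \<le> X ^ 4"
  shows "nrm (\<lambda>e. (grad a x e - grad a (\<lambda>e. x e - h e) e) - (grad b x e - grad b (\<lambda>e. x e - h e) e))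
    \<le> X ^ 10 * (\<delta> * nrm h)"
proof -
  define d where "d = \<delta> * nrm h"
  have d: "0 \<le> d" using assms(4) by (simp add: d_def)
  have dt: "\<bar>ip a x - ip b x\<bar> \<le> X ^ 6 * \<delta>"
  proof -
    have "\<bar>ip a x - ip b x\<bar> \<le> X\<^sup>2 * (\<delta> * nrm x)"
      using ip_le_sup[of "\<lambda>e. a e - b e" \<delta> x] assms(3) by (simp add: ip_diff_left)
    also have "\<dots> \<le> X\<^sup>2 * (\<delta> * X ^ 4)" using assms(4,5) by (intro mult_left_mono) auto
    finally show ?thesis by (simp add: power_numeral_reduce algebra_simps)
  qed
  have ds: "\<bar>ip a h - ip b h\<bar> \<le> X\<^sup>2 * d"
    using ip_le_sup[of "\<lambda>e. a e - b e" \<delta> h] assms(3) by (simp add: ip_diff_left d_def)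
  have "\<bar>(grad a x e - grad a (\<lambda>e. x e - h e) e) - (grad b x e - grad b (\<lambda>e. x e - h e) e)\<bar> \<le> X ^ 9 * d"
    if e: "e \<in> edges n m" for e
  proof -
    let ?A = "phi (ip a x) - phi (ip a x - ip a h)"
    let ?B = "phi (ip b x) - phi (ip b x - ip b h)"
    \<comment> \<open>\<open>?M\<close> has the base point of \<open>?B\<close> and the increment of
      \<open>?A\<close>: one comparison is a second difference, the other needs only that
      \<open>phi\<close> is Lipschitz.\<close>
    let ?M = "phi (ip b x) - phi (ip b x - ip a h)"
    have "\<bar>?A\<bar> \<le> X\<^sup>2 * nrm h"
      using phi_lipschitz[of "ip a x" "ip a x - ip a h"] ip_unit_le[OF assms(1), of h] by simp
    then have 1: "\<bar>(a e - b e) * ?A\<bar> \<le> \<delta> * (X\<^sup>2 * nrm h)"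
      unfolding abs_mult using assms(3)[OF e] assms(4) by (intro mult_mono) auto
    have "\<bar>?A - ?M\<bar> \<le> 2 * \<bar>ip a h\<bar> * \<bar>ip a x - ip b x\<bar>" by (rule phi_second_difference)
    also have "\<dots> \<le> 2 * (X\<^sup>2 * nrm h) * (X ^ 6 * \<delta>)"
      using ip_unit_le[OF assms(1), of h] dt by (intro mult_mono) auto
    also have "\<dots> = 2 * X ^ 8 * d" by (simp add: d_def power_numeral_reduce algebra_simps)
    finally have AM: "\<bar>?A - ?M\<bar> \<le> 2 * X ^ 8 * d" .
    have "\<bar>?M - ?B\<bar> \<le> X\<^sup>2 * d"
      using phi_lipschitz[of "ip b x - ip a h" "ip b x - ip b h"] ds by simp
    then have "\<bar>?A - ?B\<bar> \<le> 2 * X ^ 8 * d + X\<^sup>2 * d" using AM by linarith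
    then have 2: "\<bar>b e * (?A - ?B)\<bar> \<le> 1 * (2 * X ^ 8 * d + X\<^sup>2 * d)"
      unfolding abs_mult using unit_weights_abs[OF assms(2)] by (intro mult_mono) auto
    have eq: "(grad a x e - grad a (\<lambda>e. x e - h e) e) - (grad b x e - grad b (\<lambda>e. x e - h e) e)
        = (a e - b e) * ?A + b e * (?A - ?B)"
      by (simp add: grad_def ip_diff_right algebra_simps)
    have "\<bar>(grad a x e - grad a (\<lambda>e. x e - h e) e) - (grad b x e - grad b (\<lambda>e. x e - h e) e)\<bar>
        \<le> \<delta> * (X\<^sup>2 * nrm h) + (2 * X ^ 8 * d + X\<^sup>2 * d)"
      unfolding eq by (rule order_trans[OF abs_triangle_ineq add_mono[OF 1 2[unfolded mult_1]]])
    also have "\<dots> = X\<^sup>2 * d + 2 * X ^ 8 * d + X\<^sup>2 * d" by (simp add: d_def)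
    also have "\<dots> \<le> X ^ 8 * d + 2 * X ^ 8 * d + X ^ 8 * d"
      using X_power_mono[of 2 8] d by (intro add_mono mult_right_mono) auto
    also have "\<dots> = (4 * X ^ 8) * d" by simp
    also have "\<dots> \<le> X ^ 9 * d" using X_absorb[of 4 8] d by (intro mult_right_mono) auto
    finally show ?thesis .
  qed
  then have "nrm (\<lambda>e. (grad a x e - grad a (\<lambda>e. x e - h e) e) - (grad b x e - grad b (\<lambda>e. x e - h e) e))
      \<le> X * (X ^ 9 * d)"
    using d by (intro nrm_le) auto
  then show ?thesis by (simp add: d_def power_numeral_reduce mult.assoc)
qed

end

section \<open>Gradient iteration\<close>

context size_params
begin

primrec iter :: "(edge \<Rightarrow> real) \<Rightarrow> nat \<Rightarrow> edge \<Rightarrow> real" where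
  "iter a 0 = (\<lambda>e. 0)"
| "iter a (Suc k) = (\<lambda>e. iter a k e - eta * grad a (iter a k) e)"

definition rate :: real where "rate = 1 - eta * lam / 2"

text \<open>Equal to \<open>X ^ 60\<close>. A step multiplies the error by \<open>1 - y\<close> with
  \<open>y \<ge> 1 / X ^ 17\<close>, so the exponent leaves ample room.\<close>

definition num_iter :: nat where "num_iter = (E * (n + m + 2)) ^ 60"

definition sol :: "(edge \<Rightarrow> real) \<Rightarrow> edge \<Rightarrow> real" where "sol a = iter a num_iter"

lemma eta_le: "eta \<le> 1 / 10"
proof -
  have "10 \<le> X ^ 14" using X_ge(1) X_power_mono[of 1 14] by simp
  then show ?thesis unfolding eta_def by (intro divide_left_mono) auto
qed

lemma rate_bounds: "1 / 2 \<le> rate" "rate < 1" "2 * eta \<le> rate"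
proof -
  have "eta * lam \<le> (1 / 10) * 1" using eta_le lam_bounds eta_bounds by (intro mult_mono) auto
  then show "1 / 2 \<le> rate" "2 * eta \<le> rate" using eta_le by (auto simp: rate_def)
  show "rate < 1" using eta_bounds lam_bounds by (simp add: rate_def)
qed

text \<open>In the expanded square, strong monotonicity contributes \<open>- 2 * eta * lam\<close>
  and the Lipschitz bound at most \<open>eta * lam\<close>; what remains,
  \<open>1 - eta * lam\<close>, is at most the square of \<open>rate\<close>.\<close>

lemma gradient_step_contraction:
  assumes "unit_weights a"
  shows "nrm (\<lambda>e. (x e - y e) - eta * (grad a x e - grad a y e)) \<le> rate * nrm (\<lambda>e. x e - y e)"
proof -
  let ?d = "\<lambda>e. x e - y e" and ?f = "\<lambda>e. grad a x e - grad a y e"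
  have "nrm ?f \<le> X ^ 6 * nrm ?d" by (rule grad_lipschitz[OF assms])
  then have "(nrm ?f)\<^sup>2 \<le> (X ^ 6 * nrm ?d)\<^sup>2" by (intro power_mono) auto
  then have f: "(nrm ?f)\<^sup>2 \<le> X ^ 12 * (nrm ?d)\<^sup>2" by (simp add: power_mult_distrib flip: power_mult)
  have eX: "eta * X ^ 12 \<le> lam"
  proof -
    have "eta * X ^ 12 = 1 / X\<^sup>2" by (simp add: eta_def field_simps flip: power_add)
    also have "\<dots> \<le> lam" using lam_bounds(3) by (simp add: divide_le_eq)
    finally show ?thesis .
  qed
  have "ip (\<lambda>e. ?d e - eta * ?f e) (\<lambda>e. ?d e - eta * ?f e)
      = ip ?d ?d - 2 * eta * ip ?f ?d + eta\<^sup>2 * ip ?f ?f"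
    by (simp add: ip_def sum_distrib_left sum_subtractf[symmetric] sum.distrib[symmetric]
        power2_eq_square algebra_simps)
  then have "(nrm (\<lambda>e. ?d e - eta * ?f e))\<^sup>2
      = (nrm ?d)\<^sup>2 - 2 * eta * ip ?f ?d + eta\<^sup>2 * (nrm ?f)\<^sup>2"
    by (simp add: nrm_square)
  also have "\<dots> \<le> (nrm ?d)\<^sup>2 - 2 * eta * (lam * (nrm ?d)\<^sup>2) + eta * (lam * (nrm ?d)\<^sup>2)"
  proof (intro add_mono diff_mono mult_left_mono grad_strongly_monotone order_refl)
    have "eta\<^sup>2 * (nrm ?f)\<^sup>2 \<le> eta\<^sup>2 * (X ^ 12 * (nrm ?d)\<^sup>2)" using f by (intro mult_left_mono) auto
    also have "\<dots> = eta * ((eta * X ^ 12) * (nrm ?d)\<^sup>2)" by (simp add: power2_eq_square)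
    also have "\<dots> \<le> eta * (lam * (nrm ?d)\<^sup>2)"
      using eX eta_bounds by (intro mult_left_mono mult_right_mono) auto
    finally show "eta\<^sup>2 * (nrm ?f)\<^sup>2 \<le> eta * (lam * (nrm ?d)\<^sup>2)" .
  qed (use eta_bounds in auto)
  also have "\<dots> = (1 - eta * lam) * (nrm ?d)\<^sup>2" by (simp add: algebra_simps)
  also have "\<dots> \<le> rate\<^sup>2 * (nrm ?d)\<^sup>2"
    using eta_bounds lam_bounds
    by (intro mult_right_mono) (auto simp: rate_def power2_eq_square algebra_simps)
  also have "\<dots> = (rate * nrm ?d)\<^sup>2" by (simp add: power_mult_distrib)
  finally show ?thesis using rate_bounds by (simp add: power2_le_iff_abs_le)
qed

text \<open>The contraction passes from points to residuals because \<open>x - eta * s\<close> and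
  \<open>x - eta * r\<close> differ by \<open>eta * (r - s)\<close>. For \<open>r = grad a x\<close>
  and \<open>s = 0\<close> the left-hand side is the residual after the step; general
  \<open>s\<close> serves the comparison of two weight functions.\<close>

lemma residual_step_contraction:
  assumes "unit_weights a"
  shows "nrm (\<lambda>e. (r e - s e) - (grad a (\<lambda>e. x e - eta * s e) e - grad a (\<lambda>e. x e - eta * r e) e))
    \<le> rate * nrm (\<lambda>e. r e - s e)"
proof -
  let ?p = "\<lambda>e. x e - eta * s e" and ?r = "\<lambda>e. x e - eta * r e"
  have "eta * nrm (\<lambda>e. (r e - s e) - (grad a ?p e - grad a ?r e))
      = nrm (\<lambda>e. (?p e - ?r e) - eta * (grad a ?p e - grad a ?r e))"
    using nrm_scale[of eta "\<lambda>e. (r e - s e) - (grad a ?p e - grad a ?r e)"] eta_bounds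
    by (simp add: algebra_simps)
  also have "\<dots> \<le> rate * nrm (\<lambda>e. ?p e - ?r e)" by (rule gradient_step_contraction[OF assms])
  also have "nrm (\<lambda>e. ?p e - ?r e) = eta * nrm (\<lambda>e. r e - s e)"
    using nrm_scale[of eta "\<lambda>e. r e - s e"] eta_bounds by (simp add: algebra_simps)
  finally have "eta * nrm (\<lambda>e. (r e - s e) - (grad a ?p e - grad a ?r e))
      \<le> eta * (rate * nrm (\<lambda>e. r e - s e))" by (simp add: mult.left_commute)
  then show ?thesis using eta_bounds by simp
qed

lemma grad_0: "grad a (\<lambda>e. 0) = (\<lambda>e. - a e)"
  by (simp add: fun_eq_iff grad_def row_def col_def ip_def)

lemma nrm_unit_le: "unit_weights a \<Longrightarrow> nrm a \<le> X"
  using nrm_le[of a 1] by (simp add: unit_weights_abs)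

lemma residual_decay:
  assumes "unit_weights a"
  shows "nrm (grad a (iter a k)) \<le> rate ^ k * X"
proof (induction k)
  case 0
  then show ?case using nrm_unit_le[OF assms] by (simp add: grad_0 nrm_uminus)
next
  case (Suc k)
  let ?r = "grad a (iter a k)"
  have "nrm (grad a (iter a (Suc k))) \<le> rate * nrm ?r"
    using residual_step_contraction[OF assms, of ?r "\<lambda>e. 0" "iter a k"] by simp
  also have "\<dots> \<le> rate * (rate ^ k * X)" using Suc rate_bounds by (intro mult_left_mono) auto
  finally show ?case by simp
qed

text \<open>The recursion \<open>B = rate * B + eta * X\<close> has the fixed point
  \<open>2 * X / lam\<close>, which is at most \<open>2 * X ^ 3\<close>.\<close>

lemma iter_bounded:
  assumes "unit_weights a"
  shows "nrm (iter a k) \<le> X ^ 4"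
proof (induction k)
  case 0
  then show ?case by (simp add: nrm_def L2_set_def)
next
  case (Suc k)
  let ?x = "iter a k"
  have "iter a (Suc k) = (\<lambda>e. ((?x e - 0) - eta * (grad a ?x e - grad a (\<lambda>e. 0) e)) + eta * a e)"
    by (simp add: fun_eq_iff grad_0 algebra_simps)
  then have "nrm (iter a (Suc k))
      \<le> nrm (\<lambda>e. (?x e - 0) - eta * (grad a ?x e - grad a (\<lambda>e. 0) e)) + nrm (\<lambda>e. eta * a e)"
    using nrm_add[of "\<lambda>e. (?x e - 0) - eta * (grad a ?x e - grad a (\<lambda>e. 0) e)" "\<lambda>e. eta * a e"]
    by simp
  also have "\<dots> \<le> rate * nrm ?x + eta * X"
    using gradient_step_contraction[OF assms, of ?x "\<lambda>e. 0"] nrm_unit_le[OF assms] eta_bounds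
    by (intro add_mono) (auto simp: nrm_scale)
  also have "\<dots> \<le> rate * X ^ 4 + eta * X"
    using Suc rate_bounds by (intro add_right_mono mult_left_mono) auto
  also have "\<dots> \<le> X ^ 4"
  proof -
    have "2 * X \<le> X\<^sup>2" using X_ge(1) by (simp add: power2_eq_square)
    also have "\<dots> \<le> (lam * X\<^sup>2) * X\<^sup>2" using lam_bounds(3) mult_right_mono[of 1 "lam * X\<^sup>2" "X\<^sup>2"] by simp
    finally have "eta * (2 * X) \<le> eta * (lam * X ^ 4)"
      using eta_bounds by (intro mult_left_mono) (auto simp: mult.assoc simp flip: power_add)
    then show ?thesis by (simp add: rate_def algebra_simps)
  qed
  finally show ?case .
qed

section \<open>Two weight functions along the iteration\<close>

context
  fixes a b :: "edge \<Rightarrow> real" and \<delta> :: real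
  assumes ab: "unit_weights a" "unit_weights b"
    and close: "\<And>e. e \<in> edges n m \<Longrightarrow> \<bar>a e - b e\<bar> \<le> \<delta>" and \<delta>: "0 \<le> \<delta>"
begin

text \<open>Here the fixed point of the recursion is \<open>2 * X ^ 8 * \<delta> / lam\<close>, at
  most \<open>2 * X ^ 10 * \<delta>\<close>.\<close>

lemma iter_weight_lipschitz: "nrm (\<lambda>e. iter a k e - iter b k e) \<le> X ^ 11 * \<delta>"
proof (induction k)
  case 0
  then show ?case using \<delta> by (simp add: nrm_def L2_set_def)
next
  case (Suc k)
  let ?x = "iter a k" and ?y = "iter b k"
  have "(\<lambda>e. iter a (Suc k) e - iter b (Suc k) e)
      = (\<lambda>e. ((?x e - ?y e) - eta * (grad a ?x e - grad a ?y e)) + eta * (grad b ?y e - grad a ?y e))"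
    by (simp add: fun_eq_iff algebra_simps)
  then have "nrm (\<lambda>e. iter a (Suc k) e - iter b (Suc k) e)
      \<le> nrm (\<lambda>e. (?x e - ?y e) - eta * (grad a ?x e - grad a ?y e)) + nrm (\<lambda>e. eta * (grad b ?y e - grad a ?y e))"
    using nrm_add[of "\<lambda>e. (?x e - ?y e) - eta * (grad a ?x e - grad a ?y e)"
        "\<lambda>e. eta * (grad b ?y e - grad a ?y e)"] by simp
  also have "\<dots> \<le> rate * nrm (\<lambda>e. ?x e - ?y e) + eta * (X ^ 8 * \<delta>)"
    using gradient_step_contraction[OF ab(1), of ?x ?y] eta_bounds
      grad_weight_lipschitz[OF ab close \<delta> iter_bounded[OF ab(2)], of k]
    by (intro add_mono) (auto simp: nrm_scale nrm_minus_commute[of "grad b (iter b k)"])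
  also have "\<dots> \<le> rate * (X ^ 11 * \<delta>) + eta * (X ^ 8 * \<delta>)"
    using Suc rate_bounds by (intro add_right_mono mult_left_mono) auto
  also have "\<dots> \<le> X ^ 11 * \<delta>"
  proof -
    have "2 * X ^ 8 \<le> X ^ 9" using X_absorb[of 2 8] by simp
    also have "\<dots> \<le> (lam * X\<^sup>2) * X ^ 9"
      using lam_bounds(3) mult_right_mono[of 1 "lam * X\<^sup>2" "X ^ 9"] by simp
    finally have "2 * X ^ 8 \<le> lam * X ^ 11" by (simp add: mult.assoc flip: power_add)
    then have "(eta * \<delta>) * (2 * X ^ 8) \<le> (eta * \<delta>) * (lam * X ^ 11)"
      using eta_bounds \<delta> by (intro mult_left_mono) auto
    then show ?thesis by (simp add: rate_def algebra_simps)
  qed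
  finally show ?case .
qed

text \<open>
  The error made in one step is a second difference, hence proportional to the residual itself, which
  decays at the same rate.
\<close>

lemma residual_weight_lipschitz:
  "nrm (\<lambda>e. grad a (iter a k) e - grad b (iter b k) e) \<le> rate ^ k * (X + real k * X ^ 20) * \<delta>"
proof (induction k)
  case 0
  have "nrm (\<lambda>e. a e - b e) \<le> X * \<delta>" using close \<delta> by (intro nrm_le) auto
  then show ?case by (simp add: grad_0 nrm_minus_commute[of b a])
next
  case (Suc k)
  let ?x = "iter a k" and ?y = "iter b k"
  let ?r = "grad a ?x" and ?s = "grad b ?y"
  \<comment> \<open>The difference of the new residuals is \<open>?A - ?B - ?C\<close>.
    \<open>?A\<close> is contracted; \<open>?B\<close> exchanges the point and \<open>?C\<close> the
    weights, both along the same step \<open>eta * ?s\<close>.\<close>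
  let ?A = "\<lambda>e. (?r e - ?s e) - (grad a (\<lambda>e. ?x e - eta * ?s e) e - grad a (\<lambda>e. ?x e - eta * ?r e) e)"
  let ?B = "\<lambda>e. (grad a ?x e - grad a (\<lambda>e. ?x e - eta * ?s e) e) - (grad a ?y e - grad a (\<lambda>e. ?y e - eta * ?s e) e)"
  let ?C = "\<lambda>e. (grad a ?y e - grad a (\<lambda>e. ?y e - eta * ?s e) e) - (grad b ?y e - grad b (\<lambda>e. ?y e - eta * ?s e) e)"
  have s: "nrm (\<lambda>e. eta * ?s e) \<le> eta * (rate ^ k * X)"
    using residual_decay[OF ab(2), of k] eta_bounds by (simp add: nrm_scale)
  have "(\<lambda>e. grad a (iter a (Suc k)) e - grad b (iter b (Suc k)) e) = (\<lambda>e. (?A e - ?B e) - ?C e)"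
    by (simp add: fun_eq_iff algebra_simps)
  then have "nrm (\<lambda>e. grad a (iter a (Suc k)) e - grad b (iter b (Suc k)) e) \<le> nrm (\<lambda>e. ?A e - ?B e) + nrm ?C"
    using nrm_diff[of "\<lambda>e. ?A e - ?B e" ?C] by simp
  also have "\<dots> \<le> nrm ?A + nrm ?B + nrm ?C"
    using nrm_diff[of ?A ?B] by simp
  also have "\<dots> \<le> rate * (rate ^ k * (X + real k * X ^ 20) * \<delta>)
      + X ^ 8 * (eta * (rate ^ k * X) * (X ^ 11 * \<delta>))
      + X ^ 10 * (\<delta> * (eta * (rate ^ k * X)))"
  proof (intro add_mono)
    have "nrm ?A \<le> rate * nrm (\<lambda>e. ?r e - ?s e)" by (rule residual_step_contraction[OF ab(1)])
    also have "\<dots> \<le> rate * (rate ^ k * (X + real k * X ^ 20) * \<delta>)"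
      using Suc rate_bounds by (intro mult_left_mono) auto
    finally show "nrm ?A \<le> rate * (rate ^ k * (X + real k * X ^ 20) * \<delta>)" .
    have "nrm ?B \<le> X ^ 8 * (nrm (\<lambda>e. eta * ?s e) * nrm (\<lambda>e. ?x e - ?y e))"
      by (rule grad_second_difference[OF ab(1)])
    also have "\<dots> \<le> X ^ 8 * (eta * (rate ^ k * X) * (X ^ 11 * \<delta>))"
      using s iter_weight_lipschitz[of k] eta_bounds rate_bounds
      by (intro mult_left_mono mult_mono) auto
    finally show "nrm ?B \<le> X ^ 8 * (eta * (rate ^ k * X) * (X ^ 11 * \<delta>))" .
    have "nrm ?C \<le> X ^ 10 * (\<delta> * nrm (\<lambda>e. eta * ?s e))"
      by (rule grad_mixed_difference[OF ab close \<delta> iter_bounded[OF ab(2)]])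
    also have "\<dots> \<le> X ^ 10 * (\<delta> * (eta * (rate ^ k * X)))"
      using s \<delta> by (intro mult_left_mono) auto
    finally show "nrm ?C \<le> X ^ 10 * (\<delta> * (eta * (rate ^ k * X)))" .
  qed
  also have "\<dots> \<le> rate ^ Suc k * (X + real (Suc k) * X ^ 20) * \<delta>"
  proof -
    have "X ^ 8 * (eta * (rate ^ k * X) * (X ^ 11 * \<delta>)) + X ^ 10 * (\<delta> * (eta * (rate ^ k * X)))
        = (eta * rate ^ k * \<delta>) * (X ^ 20 + X ^ 11)"
      by (simp add: power_numeral_reduce algebra_simps)
    also have "\<dots> \<le> (eta * rate ^ k * \<delta>) * (2 * X ^ 20)"
      using X_power_mono[of 11 20] eta_bounds rate_bounds \<delta> by (intro mult_left_mono) auto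
    \<comment> \<open>The new error has a factor \<open>eta\<close> where the claim has one more
      factor \<open>rate\<close>; \<open>2 * eta \<le> rate\<close> makes up for it.\<close>
    also have "\<dots> = (2 * eta) * (rate ^ k * \<delta> * X ^ 20)" by simp
    also have "\<dots> \<le> rate * (rate ^ k * \<delta> * X ^ 20)"
      using rate_bounds \<delta> by (intro mult_right_mono) auto
    finally show ?thesis by (simp add: algebra_simps)
  qed
  finally show ?case .
qed

end

section \<open>Precision after the last step\<close>

lemma real_num_iter: "real num_iter = X ^ 60"
  unfolding num_iter_def X_def by (simp only: of_nat_power of_nat_mult)

text \<open>The extra factor \<open>num_iter\<close> covers the linear growth in
  \<open>residual_weight_lipschitz\<close>. In \<open>rate ^ num_iter \<le> exp (- z)\<close> the
  exponent satisfies \<open>z \<ge> X ^ 43\<close>, so the crude estimate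
  \<open>exp (- z) \<le> 2 / z ^ 2\<close> suffices.\<close>

lemma rate_power_num_iter: "real num_iter * rate ^ num_iter \<le> 1 / X ^ 25"
proof -
  define y where "y = eta * lam / 2"
  define z where "z = real num_iter * y"
  have "1 / X ^ 17 \<le> y"
  proof -
    have "1 / X ^ 17 = (1 / X ^ 14) * ((1 / X\<^sup>2) / X)" by (simp flip: power_add) (simp add: power_numeral_reduce)
    also have "\<dots> \<le> eta * (lam / 2)"
    proof (intro mult_mono frac_le)
      show "1 / X\<^sup>2 \<le> lam" using lam_bounds(3) by (simp add: divide_le_eq)
    qed (use X_ge eta_bounds lam_bounds in \<open>auto simp: eta_def\<close>)
    finally show ?thesis by (simp add: y_def)
  qed
  then have "X ^ 60 * (1 / X ^ 17) \<le> z" unfolding z_def real_num_iter by (intro mult_left_mono) auto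
  also have "X ^ 60 * (1 / X ^ 17) = X ^ 43" by (simp add: field_simps flip: power_add)
  finally have z: "X ^ 43 \<le> z" .
  have zpos: "0 < z" using z X_ge_1(2)[of 43] by linarith
  have "rate ^ num_iter \<le> exp (- y) ^ num_iter"
    using rate_bounds exp_ge_add_one_self[of "- y"] by (intro power_mono) (auto simp: rate_def y_def)
  also have "\<dots> = exp (- z)" by (simp add: z_def exp_of_nat_mult[symmetric])
  also have "\<dots> \<le> 2 / z\<^sup>2"
  proof -
    have "z\<^sup>2 / 2 \<le> exp z" using exp_lower_Taylor_quadratic[of z] zpos by simp
    then show ?thesis using zpos by (simp add: exp_minus field_simps)
  qed
  also have "\<dots> \<le> 2 / (X ^ 43)\<^sup>2"
    using z zpos by (intro divide_left_mono power_mono mult_pos_pos) auto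
  finally have "real num_iter * rate ^ num_iter \<le> X ^ 60 * (2 / (X ^ 43)\<^sup>2)"
    unfolding real_num_iter by (intro mult_left_mono) auto
  also have "\<dots> = 2 / X ^ 26" by (simp add: field_simps flip: power_add power_mult)
  also have "\<dots> \<le> 1 / X ^ 25" using X_absorb[of 2 25] by (simp add: field_simps)
  finally show ?thesis .
qed

lemma num_iter_ge_1: "1 \<le> real num_iter"
  unfolding real_num_iter by (rule X_ge_1)

lemma sol_residual:
  assumes "unit_weights a"
  shows "nrm (grad a (sol a)) \<le> 1 / X ^ 24"
proof -
  have "nrm (grad a (sol a)) \<le> rate ^ num_iter * X"
    unfolding sol_def by (rule residual_decay[OF assms])
  also have "\<dots> \<le> (real num_iter * rate ^ num_iter) * X"
    using num_iter_ge_1 rate_bounds mult_right_mono[of 1 "real num_iter" "rate ^ num_iter"]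
    by (intro mult_right_mono) auto
  also have "\<dots> \<le> 1 / X ^ 25 * X" using rate_power_num_iter by (intro mult_right_mono) auto
  also have "\<dots> = 1 / X ^ 24" by (simp add: power_numeral_reduce)
  finally show ?thesis .
qed

lemma sol_residual_lipschitz:
  assumes "unit_weights a" "unit_weights b"
    and "\<And>e. e \<in> edges n m \<Longrightarrow> \<bar>a e - b e\<bar> \<le> \<delta>" "0 \<le> \<delta>"
  shows "nrm (\<lambda>e. grad a (sol a) e - grad b (sol b) e) \<le> \<delta> / X ^ 4"
proof -
  let ?K = num_iter
  have "nrm (\<lambda>e. grad a (sol a) e - grad b (sol b) e) \<le> rate ^ ?K * (X + real ?K * X ^ 20) * \<delta>"
    unfolding sol_def by (rule residual_weight_lipschitz[OF assms])
  also have "\<dots> \<le> rate ^ ?K * (real ?K * (2 * X ^ 20)) * \<delta>"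
  proof (intro mult_right_mono mult_left_mono)
    have "X \<le> X ^ 20" using X_power_mono[of 1 20] by simp
    also have "\<dots> \<le> real ?K * X ^ 20"
      using num_iter_ge_1 mult_right_mono[of 1 "real ?K" "X ^ 20"] by simp
    finally show "X + real ?K * X ^ 20 \<le> real ?K * (2 * X ^ 20)" by simp
  qed (use rate_bounds assms(4) in auto)
  also have "\<dots> = (real ?K * rate ^ ?K) * (2 * X ^ 20 * \<delta>)" by simp
  also have "\<dots> \<le> (1 / X ^ 25) * (2 * X ^ 20 * \<delta>)"
    using rate_power_num_iter assms(4) by (intro mult_right_mono) auto
  also have "\<dots> = (2 / X ^ 5) * \<delta>" by (simp add: field_simps flip: power_add)
  also have "\<dots> \<le> (1 / X ^ 4) * \<delta>"
    using X_absorb[of 2 4] assms(4) by (intro mult_right_mono) (simp_all add: field_simps)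
  finally show ?thesis by simp
qed

lemma sol_weight_lipschitz:
  assumes "unit_weights a" "unit_weights b"
    and "\<And>e. e \<in> edges n m \<Longrightarrow> \<bar>a e - b e\<bar> \<le> \<delta>" "0 \<le> \<delta>"
  shows "nrm (\<lambda>e. sol a e - sol b e) \<le> X ^ 11 * \<delta>"
  unfolding sol_def by (rule iter_weight_lipschitz[OF assms])

end

section \<open>Feasibility and near-optimality\<close>

lemma finite_matchings: "finite (matchings n m)"
  by (rule finite_subset[of _ "Pow (edges n m)"]) (auto simp: matchings_def)

lemma matching_subset: "M \<in> matchings n m \<Longrightarrow> M \<subseteq> edges n m"
  by (simp add: matchings_def)

lemma matching_inj_fst: "M \<in> matchings n m \<Longrightarrow> inj_on fst M"
  unfolding matchings_def inj_on_def by blast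

lemma matching_card_le: "M \<in> matchings n m \<Longrightarrow> card M \<le> n"
  using card_inj_on_le[OF matching_inj_fst, of M n m "{..<n}"] matching_subset[of M n m]
  by (fastforce simp: edges_def)

lemma sum_indicator_le_1:
  assumes "finite A" "\<And>i j. i \<in> A \<Longrightarrow> j \<in> A \<Longrightarrow> P i \<Longrightarrow> P j \<Longrightarrow> i = j"
  shows "(\<Sum>i\<in>A. if P i then 1 else 0 :: real) \<le> 1"
proof -
  have "card {i \<in> A. P i} \<le> 1"
    using assms by (subst card_le_Suc0_iff_eq[unfolded One_nat_def[symmetric]]) auto
  moreover have "(\<Sum>i\<in>A. if P i then 1 else 0 :: real) = real (card {i \<in> A. P i})"
    using assms(1) by (subst sum.inter_filter[symmetric]) auto
  ultimately show ?thesis by simp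
qed

context size_params
begin

definition ind :: "edge set \<Rightarrow> edge \<Rightarrow> real" where "ind M e = (if e \<in> M then 1 else 0)"

lemma ip_ind: "M \<in> matchings n m \<Longrightarrow> ip a (ind M) = (\<Sum>e\<in>M. a e)"
proof -
  assume "M \<in> matchings n m"
  then have "edges n m \<inter> M = M" using matching_subset by auto
  moreover have "ip a (ind M) = (\<Sum>e\<in>edges n m \<inter> M. a e)"
    unfolding ip_def ind_def by (subst sum.inter_restrict) (auto intro!: sum.cong)
  ultimately show ?thesis by simp
qed

lemma row_ind_le: "M \<in> matchings n m \<Longrightarrow> row (ind M) u \<le> 1"
  unfolding row_def ind_def by (rule sum_indicator_le_1) (force simp: matchings_def)+

lemma col_ind_le: "M \<in> matchings n m \<Longrightarrow> col (ind M) v \<le> 1"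
  unfolding col_def ind_def by (rule sum_indicator_le_1) (force simp: matchings_def)+

text \<open>The operator in variational form, with the penalties collected per row and column. The
  choice \<open>y = 0\<close> yields approximate feasibility, the indicator of a matching yields
  near-optimality.\<close>

lemma grad_test:
  "ip (grad a x) (\<lambda>e. x e - y e) = lam * (\<Sum>e\<in>edges n m. ent m (x e) * (x e - y e))
     + Lam * ((\<Sum>u<n. theta (row x u - 1) * (row x u - row y u))
       + (\<Sum>v<m. theta (col x v - 1) * (col x v - col y v))
       + (\<Sum>e\<in>edges n m. theta (- x e) * (y e - x e)))
     - (1 - phi (ip a x)) * (ip a x - ip a y)"
proof -
  have R: "(\<Sum>e\<in>edges n m. theta (row x (fst e) - 1) * (x e - y e))
      = (\<Sum>u<n. theta (row x u - 1) * (row x u - row y u))"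
    by (simp add: sum_edges row_def sum_subtractf[symmetric] sum_distrib_left[symmetric])
  have C: "(\<Sum>e\<in>edges n m. theta (col x (snd e) - 1) * (x e - y e))
      = (\<Sum>v<m. theta (col x v - 1) * (col x v - col y v))"
    by (simp add: sum_edges_swap col_def sum_subtractf[symmetric] sum_distrib_left[symmetric])
  have "ip (grad a x) (\<lambda>e. x e - y e)
      = (\<Sum>e\<in>edges n m. lam * (ent m (x e) * (x e - y e))
          + Lam * (theta (row x (fst e) - 1) * (x e - y e) + theta (col x (snd e) - 1) * (x e - y e)
            + theta (- x e) * (y e - x e))
          - (1 - phi (ip a x)) * (a e * (x e - y e)))"
    unfolding ip_def[of "grad a x"] by (intro sum.cong refl) (simp add: grad_def algebra_simps)
  also have "\<dots> = lam * (\<Sum>e\<in>edges n m. ent m (x e) * (x e - y e))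
      + Lam * ((\<Sum>e\<in>edges n m. theta (row x (fst e) - 1) * (x e - y e))
        + (\<Sum>e\<in>edges n m. theta (col x (snd e) - 1) * (x e - y e))
        + (\<Sum>e\<in>edges n m. theta (- x e) * (y e - x e)))
      - (1 - phi (ip a x)) * ip a (\<lambda>e. x e - y e)"
    unfolding sum_subtractf sum.distrib sum_distrib_left[symmetric] by (simp add: ip_def)
  finally show ?thesis unfolding R C ip_diff_right .
qed

lemma one_minus_phi: "0 \<le> t \<Longrightarrow> 1 - phi t = 1 / (1 + t)"
  by (simp add: phi_def field_simps)

lemma theta_mult_nonneg: "0 \<le> theta (r - 1) * r" "0 \<le> theta r * r"
proof -
  show "0 \<le> theta (r - 1) * r"
    by (cases "r \<le> 1") (auto intro: theta_nonneg mult_nonneg_nonneg)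
  show "0 \<le> theta r * r"
    by (cases "r \<le> 0") (auto intro: theta_nonneg mult_nonneg_nonneg)
qed

lemma theta_sum_nonneg:
  "0 \<le> (\<Sum>u<n. theta (row x u - 1) * row x u)"
  "0 \<le> (\<Sum>v<m. theta (col x v - 1) * col x v)"
  "0 \<le> (\<Sum>e\<in>edges n m. theta (- x e) * (- x e))"
  by (intro sum_nonneg theta_mult_nonneg)+

lemma sol_bounded: "unit_weights a \<Longrightarrow> nrm (sol a) \<le> X ^ 4"
  unfolding sol_def by (rule iter_bounded)

text \<open>Testing with \<open>0\<close>: the residual contributes at most \<open>1\<close>, the
  entropy is nonnegative, and the gain of the logarithm is at most \<open>1\<close>, being
  \<open>t / (1 + t)\<close> for \<open>t \<ge> 0\<close>.\<close>

lemma penalty_le: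
  assumes "unit_weights a"
  shows "Lam * ((\<Sum>u<n. theta (row (sol a) u - 1) * row (sol a) u)
       + (\<Sum>v<m. theta (col (sol a) v - 1) * col (sol a) v)
       + (\<Sum>e\<in>edges n m. theta (- sol a e) * (- sol a e))) \<le> 2"
proof -
  let ?x = "sol a"
  have "\<bar>ip (grad a ?x) ?x\<bar> \<le> nrm (grad a ?x) * nrm ?x" by (rule ip_le_nrm)
  also have "\<dots> \<le> (1 / X ^ 24) * X ^ 4"
    using sol_residual[OF assms] sol_bounded[OF assms] by (intro mult_mono) auto
  also have "\<dots> \<le> 1" using X_power_mono[of 4 24] by (simp add: divide_le_eq)
  finally have 1: "ip (grad a ?x) ?x \<le> 1" by linarith
  have 2: "(1 - phi t) * t \<le> 1" for t
  proof (cases "0 \<le> t")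
    case True
    then show ?thesis by (simp add: one_minus_phi divide_le_eq)
  next
    case False
    then have "(1 - phi t) * t \<le> 0" by (intro mult_nonneg_nonpos) (auto simp: phi_def)
    then show ?thesis by simp
  qed
  have "0 \<le> (\<Sum>e\<in>edges n m. ent m (?x e) * ?x e)"
    using ent_mult_self_ge by (intro sum_nonneg) (meson order_trans zero_le_power2)
  then have 3: "0 \<le> lam * (\<Sum>e\<in>edges n m. ent m (?x e) * ?x e)" using lam_bounds by simp
  have z: "row (\<lambda>e. 0) u = 0" "col (\<lambda>e. 0) v = 0" "ip a (\<lambda>e. 0) = 0" for u v
    by (simp_all add: row_def col_def ip_def)
  have "ip (grad a ?x) ?x = lam * (\<Sum>e\<in>edges n m. ent m (?x e) * ?x e)
     + Lam * ((\<Sum>u<n. theta (row ?x u - 1) * row ?x u)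
       + (\<Sum>v<m. theta (col ?x v - 1) * col ?x v)
       + (\<Sum>e\<in>edges n m. theta (- ?x e) * (- ?x e)))
     - (1 - phi (ip a ?x)) * ip a ?x"
    using grad_test[of a ?x "\<lambda>e. 0"] by (simp only: z diff_0_right diff_0)
  then show ?thesis using 1 2[of "ip a ?x"] 3 by linarith
qed

text \<open>For \<open>r > 1\<close> the product \<open>theta (r - 1) * r\<close> is exactly the
  square of \<open>r - 1\<close>, and \<open>Lam / X ^ 2 = 4 * X\<close> exceeds
  \<open>2\<close>.\<close>

lemma theta_excess:
  assumes "Lam * (theta (r - 1) * r) \<le> 2"
  shows "r \<le> 1 + 1 / X"
proof (rule ccontr)
  assume "\<not> r \<le> 1 + 1 / X"
  then have r: "1 / X < r - 1" "0 < 1 / X" by auto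
  then have "0 < r - 1" by linarith
  then have "theta (r - 1) * r = (r - 1)\<^sup>2" by (simp add: theta_def)
  then have "Lam * (r - 1)\<^sup>2 \<le> 2" using assms by simp
  moreover have "(1 / X)\<^sup>2 < (r - 1)\<^sup>2" using r by (intro power_strict_mono) auto
  then have "Lam * (1 / X)\<^sup>2 < Lam * (r - 1)\<^sup>2" using Lam_pos by (intro mult_strict_left_mono)
  moreover have "Lam * (1 / X)\<^sup>2 = 4 * X" by (simp add: Lam_def power_numeral_reduce)
  ultimately show False using X_ge(1) by linarith
qed

text \<open>Near \<open>0\<close> the product is only cubic in \<open>s\<close>, which is why
  \<open>Lam\<close> has order \<open>X ^ 3\<close>; for \<open>s > 1\<close> it is at least
  \<open>1 / 2\<close>.\<close>

lemma theta_negative_part: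
  assumes "Lam * (theta s * s) \<le> 2"
  shows "s \<le> 1 / X"
proof (rule ccontr)
  assume "\<not> s \<le> 1 / X"
  then have s: "1 / X < s" "0 < 1 / X" by auto
  then have "0 < s" by linarith
  then have th: "theta s * s = s ^ 3 / (1 + s)" by (simp add: theta_def power_numeral_reduce)
  have "2 < Lam * (theta s * s)"
  proof (cases "s \<le> 1")
    case True
    have "(1 / X) ^ 3 / 2 < s ^ 3 / (1 + s)"
      using s True \<open>0 < s\<close> by (intro frac_less power_strict_mono) auto
    then have "Lam * ((1 / X) ^ 3 / 2) < Lam * (s ^ 3 / (1 + s))"
      using Lam_pos by (intro mult_strict_left_mono)
    moreover have "Lam * ((1 / X) ^ 3 / 2) = 2" by (simp add: Lam_def power_numeral_reduce)
    ultimately show ?thesis unfolding th by linarith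
  next
    case False
    then have "s \<le> s ^ 3" using power_increasing[of 1 3 s] by simp
    then have "1 / 2 \<le> s ^ 3 / (1 + s)" using False by (simp add: field_simps)
    then have "Lam * (1 / 2) \<le> Lam * (theta s * s)" unfolding th
      using Lam_pos by (intro mult_left_mono) auto
    moreover have "10 \<le> Lam" using X_power_mono[of 1 3] X_ge(1) unfolding Lam_def by simp
    ultimately show ?thesis by linarith
  qed
  then show False using assms by linarith
qed

lemma sol_row_le:
  assumes "unit_weights a" "u < n"
  shows "row (sol a) u \<le> 1 + 1 / X"
proof (rule theta_excess)
  have "theta (row (sol a) u - 1) * row (sol a) u \<le> (\<Sum>u<n. theta (row (sol a) u - 1) * row (sol a) u)"
    using assms(2) theta_mult_nonneg(1) by (intro member_le_sum[where f = "\<lambda>u. theta (row (sol a) u - 1) * row (sol a) u"]) auto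
  then show "Lam * (theta (row (sol a) u - 1) * row (sol a) u) \<le> 2"
    using penalty_le[OF assms(1)] theta_sum_nonneg[of "sol a"] Lam_pos
    by (smt (verit) mult_left_mono)
qed

lemma sol_col_le:
  assumes "unit_weights a" "v < m"
  shows "col (sol a) v \<le> 1 + 1 / X"
proof (rule theta_excess)
  have "theta (col (sol a) v - 1) * col (sol a) v \<le> (\<Sum>v<m. theta (col (sol a) v - 1) * col (sol a) v)"
    using assms(2) theta_mult_nonneg(1) by (intro member_le_sum[where f = "\<lambda>v. theta (col (sol a) v - 1) * col (sol a) v"]) auto
  then show "Lam * (theta (col (sol a) v - 1) * col (sol a) v) \<le> 2"
    using penalty_le[OF assms(1)] theta_sum_nonneg[of "sol a"] Lam_pos
    by (smt (verit) mult_left_mono)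
qed

lemma sol_ge:
  assumes "unit_weights a" "e \<in> edges n m"
  shows "- (1 / X) \<le> sol a e"
proof -
  have "theta (- sol a e) * (- sol a e) \<le> (\<Sum>e\<in>edges n m. theta (- sol a e) * (- sol a e))"
    by (rule member_le_sum[where f = "\<lambda>e. theta (- sol a e) * (- sol a e)"])
      (use assms(2) theta_mult_nonneg(2)[of "- sol a _"] in \<open>auto simp del: mult_minus_right\<close>)
  then have "Lam * (theta (- sol a e) * (- sol a e)) \<le> 2"
    using penalty_le[OF assms(1)] theta_sum_nonneg[of "sol a"] Lam_pos
    by (smt (verit) mult_left_mono)
  from theta_negative_part[OF this] show ?thesis by linarith
qed

section \<open>The fractional matching and its value\<close>

text \<open>\<open>sol\<close> exceeds each row or column constraint by at most
  \<open>1 / X\<close>, and cutting off negative entries adds at most \<open>1 / X\<close> per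
  entry. As \<open>X = E * (n + m + 2)\<close>, the sums stay below \<open>1 + 1 / E\<close>, and
  the division makes the solution exactly feasible.\<close>

definition frac :: "(edge \<Rightarrow> real) \<Rightarrow> edge \<Rightarrow> real" where
  "frac a e = max (sol a e) 0 / (1 + 1 / real E)"

lemma frac_nonneg: "0 \<le> frac a e"
  by (simp add: frac_def)

lemma E_pos [simp]: "0 < real E" "0 < E"
  using E_ge by auto

lemma max_sol_le:
  assumes "unit_weights a" "e \<in> edges n m"
  shows "max (sol a e) 0 \<le> sol a e + 1 / X"
  using sol_ge[OF assms] by auto

lemma inverse_E: "1 / X + real k / X \<le> 1 / real E" if "k \<le> n + m"
proof -
  have "(1 + real k) / X \<le> real (n + m + 2) / X" using that by (intro divide_right_mono) auto
  also have "\<dots> = 1 / real E" by (simp add: X_def del: of_nat_add)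
  finally show ?thesis by (simp add: add_divide_distrib)
qed

lemma row_max_sol_le:
  assumes "unit_weights a" "u < n"
  shows "(\<Sum>v<m. max (sol a (u, v)) 0) \<le> 1 + 1 / real E"
proof -
  have "(\<Sum>v<m. max (sol a (u, v)) 0) \<le> (\<Sum>v<m. sol a (u, v) + 1 / X)"
    using assms by (intro sum_mono max_sol_le) (auto simp: edges_def)
  also have "\<dots> = row (sol a) u + real m / X" by (simp add: row_def sum.distrib)
  finally show ?thesis using sol_row_le[OF assms] inverse_E[of m] by simp
qed

lemma col_max_sol_le:
  assumes "unit_weights a" "v < m"
  shows "(\<Sum>u<n. max (sol a (u, v)) 0) \<le> 1 + 1 / real E"
proof -
  have "(\<Sum>u<n. max (sol a (u, v)) 0) \<le> (\<Sum>u<n. sol a (u, v) + 1 / X)"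
    using assms by (intro sum_mono max_sol_le) (auto simp: edges_def)
  also have "\<dots> = col (sol a) v + real n / X" by (simp add: col_def sum.distrib)
  finally show ?thesis using sol_col_le[OF assms] inverse_E[of n] by simp
qed

lemma frac_row_le: "unit_weights a \<Longrightarrow> u < n \<Longrightarrow> (\<Sum>v<m. frac a (u, v)) \<le> 1"
  using row_max_sol_le[of a u] by (simp add: frac_def sum_divide_distrib[symmetric] divide_le_eq add_pos_pos)

lemma frac_col_le: "unit_weights a \<Longrightarrow> v < m \<Longrightarrow> (\<Sum>u<n. frac a (u, v)) \<le> 1"
  using col_max_sol_le[of a v] by (simp add: frac_def sum_divide_distrib[symmetric] divide_le_eq add_pos_pos)

lemma sol_le_2:
  assumes "unit_weights a" "e \<in> edges n m"
  shows "sol a e \<le> 2" "\<bar>sol a e\<bar> \<le> 2"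
proof -
  obtain u v where uv: "e = (u, v)" "u < n" "v < m" using assms(2) by (auto simp: edges_def)
  have "max (sol a (u, v)) 0 \<le> (\<Sum>v<m. max (sol a (u, v)) 0)"
    using uv by (intro member_le_sum[where f = "\<lambda>v. max (sol a (u, v)) 0"]) auto
  also have "\<dots> \<le> 1 + 1 / real E" by (rule row_max_sol_le[OF assms(1) uv(2)])
  also have "\<dots> \<le> 2" using E_ge by (simp add: divide_le_eq)
  finally show "sol a e \<le> 2" by (simp add: uv)
  moreover have "1 / X \<le> 2" using X_ge(1) by (simp add: divide_le_eq)
  ultimately show "\<bar>sol a e\<bar> \<le> 2" using sol_ge[OF assms] by linarith
qed

text \<open>A matching satisfies the constraints, so the penalty terms have the favourable sign. One
  share of \<open>1 / E\<close> comes from the entropy of the matching, by the choice of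
  \<open>lam\<close>, the other from the residual.\<close>

lemma sol_near_optimal:
  assumes a: "unit_weights a" and M: "M \<in> matchings n m"
  shows "(1 - phi (ip a (sol a))) * ((\<Sum>e\<in>M. a e) - ip a (sol a)) \<le> 2 / real E"
proof -
  let ?x = "sol a" and ?y = "ind M"
  have "nrm (\<lambda>e. ?x e - ?y e) \<le> X ^ 4 + X"
  proof -
    have "nrm ?y \<le> X * 1" by (intro nrm_le) (auto simp: ind_def)
    then show ?thesis using nrm_diff[of ?x ?y] sol_bounded[OF a] by linarith
  qed
  moreover have "X \<le> X ^ 4" using X_power_mono[of 1 4] by simp
  ultimately have "nrm (\<lambda>e. ?x e - ?y e) \<le> 2 * X ^ 4" by linarith
  then have "nrm (grad a ?x) * nrm (\<lambda>e. ?x e - ?y e) \<le> (1 / X ^ 24) * (2 * X ^ 4)"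
    using sol_residual[OF a] by (intro mult_mono) auto
  also have "\<dots> \<le> (1 / X ^ 24) * X ^ 23"
    using X_absorb[of 2 4] X_power_mono[of 5 23] by (intro mult_left_mono) auto
  also have "\<dots> = 1 / X" by (simp add: power_numeral_reduce)
  also have "\<dots> \<le> 1 / real E" using X_ge(3) by (simp add: frac_le)
  finally have 1: "ip (grad a ?x) (\<lambda>e. ?x e - ?y e) \<le> 1 / real E"
    using ip_le_nrm[of "grad a ?x" "\<lambda>e. ?x e - ?y e"] by linarith
  have "(\<Sum>e\<in>edges n m. ent m (?x e) * ?y e) = ip (\<lambda>e. ent m (?x e)) ?y" by (simp add: ip_def)
  also have "\<dots> = (\<Sum>e\<in>M. ent m (?x e))" by (rule ip_ind[OF M])
  also have "\<dots> \<le> (\<Sum>e\<in>M. H)"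
    unfolding H_def using sol_le_2[OF a] matching_subset[OF M] by (intro sum_mono ent_upper) auto
  also have "\<dots> \<le> real (n + 1) * H"
    using matching_card_le[OF M] H_bounds by (simp add: mult_right_mono)
  finally have ey: "(\<Sum>e\<in>edges n m. ent m (?x e) * ?y e) \<le> real (n + 1) * H" .
  have "0 \<le> (\<Sum>e\<in>edges n m. ent m (?x e) * ?x e)"
    using ent_mult_self_ge by (intro sum_nonneg) (meson order_trans zero_le_power2)
  then have "- (real (n + 1) * H) \<le> (\<Sum>e\<in>edges n m. ent m (?x e) * (?x e - ?y e))"
    using ey by (simp add: right_diff_distrib sum_subtractf)
  then have "lam * - (real (n + 1) * H) \<le> lam * (\<Sum>e\<in>edges n m. ent m (?x e) * (?x e - ?y e))"
    using lam_bounds by (intro mult_left_mono) auto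
  moreover have "lam * - (real (n + 1) * H) = - (1 / real E)"
    using H_bounds by (simp add: lam_def del: of_nat_add)
  ultimately have 2: "- (1 / real E) \<le> lam * (\<Sum>e\<in>edges n m. ent m (?x e) * (?x e - ?y e))" by simp
  have th: "0 \<le> theta (r - 1) * (r - s)" if "s \<le> 1" for r s :: real
    using that by (cases "r \<le> 1") (auto intro!: mult_nonneg_nonneg theta_nonneg)
  have th': "0 \<le> theta (- r) * (s - r)" if "0 \<le> s" for r s :: real
    using that by (cases "0 \<le> r") (auto intro!: mult_nonneg_nonneg theta_nonneg)
  have "0 \<le> Lam * ((\<Sum>u<n. theta (row ?x u - 1) * (row ?x u - row ?y u))
       + (\<Sum>v<m. theta (col ?x v - 1) * (col ?x v - col ?y v))
       + (\<Sum>e\<in>edges n m. theta (- ?x e) * (?y e - ?x e)))"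
    using Lam_pos row_ind_le[OF M] col_ind_le[OF M]
    by (intro mult_nonneg_nonneg add_nonneg_nonneg sum_nonneg th th') (auto simp: ind_def)
  then have "(1 - phi (ip a ?x)) * (ip a ?y - ip a ?x) \<le> 2 / real E"
    using grad_test[of a ?x ?y] 1 2 by (simp add: algebra_simps)
  then show ?thesis by (simp add: ip_ind[OF M])
qed

text \<open>The edge \<open>e\<close> alone is a matching of value \<open>1\<close>. If
  \<open>t = ip a (sol a)\<close> were negative, \<open>sol_near_optimal\<close> for it would give
  \<open>(1 - t) * (1 - t) \<le> 2 / E < 1\<close>. With \<open>t \<ge> 0\<close> known,
  \<open>1 - phi t\<close> is \<open>1 / (1 + t)\<close> and can be multiplied out.\<close>

lemma sol_value:
  assumes a: "unit_weights a" and e: "e \<in> edges n m" "a e = 1"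
  shows "0 \<le> ip a (sol a)"
    and "M \<in> matchings n m \<Longrightarrow> (\<Sum>e\<in>M. a e) - ip a (sol a) \<le> 2 / real E * (1 + ip a (sol a))"
proof -
  let ?t = "ip a (sol a)"
  have E: "2 / real E < 1" using E_ge by (simp add: divide_less_eq)
  show t: "0 \<le> ?t"
  proof (rule ccontr)
    assume "\<not> 0 \<le> ?t"
    then have t: "?t < 0" "1 - phi ?t = 1 - ?t" by (auto simp: phi_def)
    have "{e} \<in> matchings n m" using e by (simp add: matchings_def)
    from sol_near_optimal[OF a this] have "(1 - ?t) * (1 - ?t) \<le> 2 / real E" using t e by simp
    moreover have "1 * 1 \<le> (1 - ?t) * (1 - ?t)" using t by (intro mult_mono) auto
    ultimately show False using E by linarith
  qed
  assume "M \<in> matchings n m"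
  from sol_near_optimal[OF a this] show "(\<Sum>e\<in>M. a e) - ?t \<le> 2 / real E * (1 + ?t)"
    using t by (simp add: one_minus_phi pos_divide_le_eq mult.commute)
qed

end

section \<open>Dependence on the weights\<close>

definition wmax :: "nat \<Rightarrow> nat \<Rightarrow> (edge \<Rightarrow> real) \<Rightarrow> real" where
  "wmax n m w = Max (insert 0 (w ` edges n m))"

text \<open>If all weights vanish, then so do the scaled weights, because \<open>x / 0 = 0\<close>.\<close>

definition scaled :: "nat \<Rightarrow> nat \<Rightarrow> (edge \<Rightarrow> real) \<Rightarrow> edge \<Rightarrow> real" where
  "scaled n m w e = w e / wmax n m w"

lemma wmax_nonneg: "0 \<le> wmax n m w"
  by (simp add: wmax_def)

lemma weighting_outside: "w \<in> weightings n m \<Longrightarrow> e \<notin> edges n m \<Longrightarrow> w e = 0"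
  unfolding weightings_def by blast

lemma weighting_nonneg: "w \<in> weightings n m \<Longrightarrow> 0 \<le> w e"
  by (cases "e \<in> edges n m") (auto simp: weighting_outside, auto simp: weightings_def)

lemma le_wmax: "w \<in> weightings n m \<Longrightarrow> w e \<le> wmax n m w"
  by (cases "e \<in> edges n m") (auto simp: wmax_def weighting_outside)

lemma wmax_attained:
  assumes "0 < wmax n m w"
  shows "\<exists>e\<in>edges n m. w e = wmax n m w"
proof -
  have "wmax n m w \<in> insert 0 (w ` edges n m)" unfolding wmax_def by (rule Max_in) auto
  then show ?thesis using assms by force
qed

lemma component_le_l1_dist: "e \<in> edges n m \<Longrightarrow> \<bar>w e - w' e\<bar> \<le> l1_dist n m w w'"
  unfolding l1_dist_def by (rule member_le_sum[where f = "\<lambda>e. \<bar>w e - w' e\<bar>"]) auto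

lemma l1_dist_nonneg: "0 \<le> l1_dist n m w w'"
  by (simp add: l1_dist_def sum_nonneg)

lemma l1_dist_commute: "l1_dist n m w w' = l1_dist n m w' w"
  by (simp add: l1_dist_def abs_minus_commute)

lemma wmax_le_wmax_l1: "wmax n m w \<le> wmax n m w' + l1_dist n m w w'"
proof (cases "0 < wmax n m w")
  case True
  then obtain e where e: "e \<in> edges n m" "w e = wmax n m w" using wmax_attained by blast
  have "w' e \<le> wmax n m w'" using e(1) by (simp add: wmax_def)
  then show ?thesis using component_le_l1_dist[OF e(1), of w w'] e(2) by linarith
next
  case False
  then show ?thesis using wmax_nonneg[of n m w'] l1_dist_nonneg[of n m w w'] by linarith
qed

lemma wmax_lipschitz: "\<bar>wmax n m w - wmax n m w'\<bar> \<le> l1_dist n m w w'"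
  using wmax_le_wmax_l1[of n m w w'] wmax_le_wmax_l1[of n m w' w] by (simp add: l1_dist_commute)

lemma empty_matching: "{} \<in> matchings n m"
  by (simp add: matchings_def)

lemma opt_attained: "\<exists>M\<in>matchings n m. opt n m w = (\<Sum>e\<in>M. w e)"
proof -
  have "opt n m w \<in> (\<lambda>M. \<Sum>e\<in>M. w e) ` matchings n m"
    unfolding opt_def using finite_matchings[of n m] empty_matching[of n m] by (intro Max_in) auto
  then show ?thesis by auto
qed

lemma le_opt: "M \<in> matchings n m \<Longrightarrow> (\<Sum>e\<in>M. w e) \<le> opt n m w"
  unfolding opt_def using finite_matchings by (intro Max_ge) auto

lemma wmax_le_opt: "wmax n m w \<le> opt n m w"
proof (cases "0 < wmax n m w")
  case True
  then obtain e where e: "e \<in> edges n m" "w e = wmax n m w" using wmax_attained by blast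
  have "{e} \<in> matchings n m" using e(1) by (simp add: matchings_def)
  from le_opt[OF this, of w] show ?thesis using e by simp
next
  case False
  then show ?thesis using le_opt[OF empty_matching, of w n m] by simp
qed

lemma opt_le_wmax: "opt n m w \<le> real n * wmax n m w"
proof -
  obtain M where M: "M \<in> matchings n m" "opt n m w = (\<Sum>e\<in>M. w e)" using opt_attained by blast
  have "(\<Sum>e\<in>M. w e) \<le> (\<Sum>e\<in>M. wmax n m w)"
    using matching_subset[OF M(1)] by (intro sum_mono) (auto simp: wmax_def)
  also have "\<dots> \<le> real n * wmax n m w"
    using matching_card_le[OF M(1)] wmax_nonneg by (simp add: mult_right_mono)
  finally show ?thesis using M by simp
qed

lemma opt_le_opt_l1: "opt n m w \<le> opt n m w' + l1_dist n m w w'"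
proof -
  obtain M where M: "M \<in> matchings n m" "opt n m w = (\<Sum>e\<in>M. w e)" using opt_attained by blast
  have "(\<Sum>e\<in>M. w e) - (\<Sum>e\<in>M. w' e) \<le> (\<Sum>e\<in>M. \<bar>w e - w' e\<bar>)"
    unfolding sum_subtractf[symmetric] by (intro sum_mono) auto
  also have "\<dots> \<le> l1_dist n m w w'"
    unfolding l1_dist_def using matching_subset[OF M(1)] by (intro sum_mono2) auto
  finally show ?thesis using M le_opt[OF M(1), of w'] by linarith
qed

context size_params
begin

lemma unit_weights_scaled: "w \<in> weightings n m \<Longrightarrow> unit_weights (scaled n m w)"
  using le_wmax[of w n m] weighting_nonneg[of w n m] wmax_nonneg[of n m w]
  by (auto simp: unit_weights_def scaled_def divide_le_eq_1 intro!: divide_nonneg_nonneg)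

lemma ip_scaled: "0 < wmax n m w \<Longrightarrow> ip w x = wmax n m w * ip (scaled n m w) x"
  by (simp add: ip_def scaled_def sum_distrib_left)

lemma sol_weight:
  assumes w: "w \<in> weightings n m" and pos: "0 < wmax n m w"
  shows "opt n m w - ip w (sol (scaled n m w))
      \<le> 2 / real E * (wmax n m w + ip w (sol (scaled n m w)))"
    and "opt n m w / 3 \<le> ip w (sol (scaled n m w))"
    and "1 / 3 \<le> ip (scaled n m w) (sol (scaled n m w))"
proof -
  let ?W = "wmax n m w" and ?a = "scaled n m w"
  let ?t = "ip ?a (sol ?a)"
  obtain e where e: "e \<in> edges n m" "w e = ?W" using wmax_attained[OF pos] by blast
  then have ae: "?a e = 1" using pos by (simp add: scaled_def)
  obtain M where M: "M \<in> matchings n m" "opt n m w = (\<Sum>e\<in>M. w e)" using opt_attained by blast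
  have "(\<Sum>e\<in>M. ?a e) - ?t \<le> 2 / real E * (1 + ?t)"
    by (rule sol_value(2)[OF unit_weights_scaled[OF w] e(1) ae M(1)])
  then have "?W * ((\<Sum>e\<in>M. ?a e) - ?t) \<le> ?W * (2 / real E * (1 + ?t))"
    using pos by (intro mult_left_mono) auto
  moreover have "?W * (\<Sum>e\<in>M. ?a e) = opt n m w"
    using pos M by (simp add: scaled_def sum_distrib_left)
  ultimately show 1: "opt n m w - ip w (sol ?a) \<le> 2 / real E * (?W + ip w (sol ?a))"
    unfolding ip_scaled[OF pos] by (simp add: algebra_simps)
  have c: "2 / real E \<le> 2 / 5" using E_ge by (intro divide_left_mono) auto
  have nn: "0 \<le> ?t" by (rule sol_value(1)[OF unit_weights_scaled[OF w] e(1) ae])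
  then have "2 / real E * (?W + ip w (sol ?a)) \<le> 2 / 5 * (opt n m w + ip w (sol ?a))"
    using c wmax_le_opt[of n m w] pos unfolding ip_scaled[OF pos]
    by (intro mult_mono add_mono) auto
  with 1 have "opt n m w - ip w (sol ?a) \<le> 2 / 5 * (opt n m w + ip w (sol ?a))" by (rule order_trans)
  \<comment> \<open>The premise even gives \<open>s \<ge> 3 / 7 * r\<close>.\<close>
  moreover have "r / 3 \<le> s" if "r - s \<le> 2 / 5 * (r + s)" "0 < r" for r s :: real
    using that by argo
  ultimately show 2: "opt n m w / 3 \<le> ip w (sol ?a)" using wmax_le_opt[of n m w] pos by force
  then have "?W * (1 / 3) \<le> ?W * ?t"
    unfolding ip_scaled[OF pos] using wmax_le_opt[of n m w] by linarith
  then show "1 / 3 \<le> ?t" using pos by simp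
qed

text \<open>Numerator and denominator each contribute the distance divided by the new maximum, which
  is at least half of the old one.\<close>

lemma scaled_lipschitz:
  assumes w: "w \<in> weightings n m" and w': "w' \<in> weightings n m"
    and pos: "0 < wmax n m w" and small: "l1_dist n m w w' \<le> wmax n m w / 2"
    and e: "e \<in> edges n m"
  shows "\<bar>scaled n m w e - scaled n m w' e\<bar> \<le> 4 * l1_dist n m w w' / wmax n m w"
proof -
  let ?W = "wmax n m w" and ?W' = "wmax n m w'" and ?\<delta> = "l1_dist n m w w'"
  have W': "?W / 2 \<le> ?W'" using wmax_lipschitz[of n m w w'] small by linarith
  then have p': "0 < ?W'" using pos by linarith
  have "w e / ?W - w' e / ?W' = (w e - w' e) / ?W' + (w e / ?W) * ((?W' - ?W) / ?W')"
    using pos p' by (simp add: field_simps)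
  also have "\<bar>\<dots>\<bar> \<le> \<bar>w e - w' e\<bar> / ?W' + (w e / ?W) * (\<bar>?W' - ?W\<bar> / ?W')"
    using abs_triangle_ineq[of "(w e - w' e) / ?W'" "(w e / ?W) * ((?W' - ?W) / ?W')"]
      p' pos weighting_nonneg[OF w, of e] by (simp add: abs_mult abs_divide)
  also have "\<dots> \<le> ?\<delta> / ?W' + 1 * (?\<delta> / ?W')"
    using component_le_l1_dist[OF e, of w w'] wmax_lipschitz[of n m w w'] p' pos
      le_wmax[OF w, of e] weighting_nonneg[OF w, of e]
    by (intro add_mono mult_mono divide_right_mono) (auto simp: abs_minus_commute)
  also have "\<dots> = 2 * ?\<delta> / ?W'" by simp
  also have "\<dots> \<le> 2 * ?\<delta> / (?W / 2)"
    using W' pos p' l1_dist_nonneg[of n m w w'] by (intro divide_left_mono) auto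
  finally show ?thesis by (simp add: scaled_def)
qed

text \<open>If \<open>s\<close> were larger, then \<open>20 * g \<le> s\<close> because
  \<open>lam \<le> 1\<close>, so the right-hand side would be at most
  \<open>(7 + 8.1) * g * s\<close>, while \<open>lam * s ^ 2\<close> exceeds
  \<open>20 * g * s\<close>.\<close>

lemma quadratic_bound:
  assumes "lam * s\<^sup>2 \<le> 7 * g * s + 162 * g\<^sup>2" "0 \<le> s" "0 \<le> g"
  shows "s \<le> 20 * g / lam"
proof (rule ccontr)
  assume "\<not> s \<le> 20 * g / lam"
  then have ls: "20 * g < lam * s" using lam_bounds by (simp add: field_simps)
  moreover have "lam * s \<le> s" using lam_bounds assms(2) mult_right_mono[of lam 1 s] by simp
  ultimately have gs: "20 * g \<le> s" by linarith
  have sp: "0 < s" using ls assms lam_bounds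
    by (metis less_eq_real_def mult_zero_right not_less zero_le_mult_iff zero_le_numeral)
  have "20 * g * s < (lam * s) * s" using ls sp by (intro mult_strict_right_mono)
  moreover have "g * (20 * g) \<le> g * s" using gs assms(3) by (intro mult_left_mono)
  moreover have "0 \<le> g * s" using assms by simp
  ultimately show False using assms(1) by (simp add: power2_eq_square algebra_simps)
qed

text \<open>Cauchy-Schwarz with the weights of \<open>ent_local_monotone\<close>. Per left vertex
  they sum to two row sums plus \<open>m * (1 / m)\<close>, hence to at most \<open>4\<close>; the
  total \<open>4 * n\<close> is the source of \<open>sqrt n\<close>.\<close>

lemma sol_l1_le_energy:
  assumes a: "unit_weights a" and b: "unit_weights b" and m: "0 < m"
  shows "(\<Sum>e\<in>edges n m. \<bar>sol a e - sol b e\<bar>)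
    \<le> 2 * sqrt (real n) * sqrt (\<Sum>e\<in>edges n m. (ent m (sol a e) - ent m (sol b e)) * (sol a e - sol b e))"
proof -
  let ?x = "sol a" and ?z = "sol b"
  let ?c = "\<lambda>e. max (?x e) 0 + max (?z e) 0 + 1 / real m"
  let ?D = "\<lambda>e. (ent m (?x e) - ent m (?z e)) * (?x e - ?z e)"
  have c: "0 \<le> ?c e" for e by simp
  have D: "0 \<le> ?D e" for e using ent_strongly_monotone[of "?x e" "?z e" m] zero_le_power2 order_trans by blast
  have "(\<Sum>e\<in>edges n m. \<bar>?x e - ?z e\<bar>) \<le> (\<Sum>e\<in>edges n m. \<bar>sqrt (?c e)\<bar> * \<bar>sqrt (?D e)\<bar>)"
  proof (intro sum_mono)
    fix e
    have "sqrt ((?x e - ?z e)\<^sup>2) \<le> sqrt (?c e * ?D e)"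
      using ent_local_monotone[OF m, of "?x e" "?z e"] by (rule real_sqrt_le_mono)
    then show "\<bar>?x e - ?z e\<bar> \<le> \<bar>sqrt (?c e)\<bar> * \<bar>sqrt (?D e)\<bar>"
      unfolding real_sqrt_mult[of "?c e" "?D e"] using c[of e] D[of e]
      by (simp only: real_sqrt_abs abs_of_nonneg real_sqrt_ge_zero)
  qed
  also have "\<dots> \<le> L2_set (\<lambda>e. sqrt (?c e)) (edges n m) * L2_set (\<lambda>e. sqrt (?D e)) (edges n m)"
    by (rule L2_set_mult_ineq)
  also have "\<dots> = sqrt (\<Sum>e\<in>edges n m. ?c e) * sqrt (\<Sum>e\<in>edges n m. ?D e)"
    unfolding L2_set_def using c D by simp
  also have "\<dots> \<le> sqrt (4 * real n) * sqrt (\<Sum>e\<in>edges n m. ?D e)"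
  proof (intro mult_right_mono real_sqrt_le_mono)
    have "(\<Sum>e\<in>edges n m. ?c e)
        = (\<Sum>u<n. (\<Sum>v<m. max (?x (u, v)) 0) + (\<Sum>v<m. max (?z (u, v)) 0) + 1)"
      unfolding sum_edges sum.distrib using m by simp
    also have "\<dots> \<le> (\<Sum>u<n. 4)"
    proof (intro sum_mono)
      fix u assume "u \<in> {..<n}"
      then have "(\<Sum>v<m. max (?x (u, v)) 0) \<le> 1 + 1 / real E" "(\<Sum>v<m. max (?z (u, v)) 0) \<le> 1 + 1 / real E"
        using row_max_sol_le[OF a] row_max_sol_le[OF b] by auto
      moreover have "1 / real E \<le> 1 / 5" using E_ge by (intro divide_left_mono) auto
      ultimately show "(\<Sum>v<m. max (?x (u, v)) 0) + (\<Sum>v<m. max (?z (u, v)) 0) + 1 \<le> 4" by linarith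
    qed
    finally show "(\<Sum>e\<in>edges n m. ?c e) \<le> 4 * real n" by simp
  qed (use D in \<open>auto intro: sum_nonneg\<close>)
  finally show ?thesis by (simp add: real_sqrt_mult)
qed

text \<open>The operators for \<open>w\<close> and \<open>w'\<close> at their solutions are
  subtracted and tested with the difference \<open>d\<close> of the solutions. The outcome is a
  quadratic inequality for the square root of the entropy energy \<open>D\<close>, on the scale
  \<open>g\<close> of the distance divided by \<open>opt\<close>.\<close>

lemma sol_l1_lipschitz:
  assumes w: "w \<in> weightings n m" and w': "w' \<in> weightings n m"
    and pos: "0 < wmax n m w" and small: "l1_dist n m w w' \<le> wmax n m w / X ^ 20"
  shows "(\<Sum>e\<in>edges n m. \<bar>sol (scaled n m w) e - sol (scaled n m w') e\<bar>)
    \<le> 40 * sqrt (real n) * (l1_dist n m w w' / opt n m w) / lam"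
proof -
  define W where "W = wmax n m w"
  define W' where "W' = wmax n m w'"
  define \<delta> where "\<delta> = l1_dist n m w w'"
  define a where "a = scaled n m w"
  define b where "b = scaled n m w'"
  define x where "x = sol a"
  define z where "z = sol b"
  define d where "d = (\<lambda>e. x e - z e)"
  define g where "g = \<delta> / opt n m w"
  define D where "D = (\<Sum>e\<in>edges n m. (ent m (x e) - ent m (z e)) * (x e - z e))"
  have W: "0 < W" using pos by (simp add: W_def)
  have \<delta>: "0 \<le> \<delta>" by (simp add: \<delta>_def l1_dist_nonneg)
  have \<delta>X: "\<delta> \<le> W / X ^ 20" using small by (simp add: \<delta>_def W_def)
  have "W / X ^ 20 \<le> W / 10"
    using X_power_mono[of 1 20] X_ge(1) W by (intro divide_left_mono) auto
  then have \<delta>W: "\<delta> \<le> W / 10" using \<delta>X by linarith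
  have optW: "W \<le> opt n m w" "opt n m w \<le> real n * W"
    unfolding W_def by (rule wmax_le_opt opt_le_wmax)+
  have opt: "0 < opt n m w" using optW W by linarith
  have g: "0 \<le> g" using \<delta> opt by (simp add: g_def)
  have WW': "\<bar>W - W'\<bar> \<le> \<delta>" unfolding W_def W'_def \<delta>_def by (rule wmax_lipschitz)
  have W': "W / 2 \<le> W'" "0 < W'" using WW' \<delta>W W by linarith+
  have ua: "unit_weights a" and ub: "unit_weights b"
    unfolding a_def b_def using w w' by (auto intro: unit_weights_scaled)
  have close: "\<bar>a e - b e\<bar> \<le> 4 * \<delta> / W" if "e \<in> edges n m" for e
    unfolding a_def b_def \<delta>_def W_def
    by (rule scaled_lipschitz[OF w w' pos _ that]) (use \<delta>W W in \<open>simp add: \<delta>_def W_def\<close>)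
  have dW: "0 \<le> 4 * \<delta> / W" using \<delta> W by simp
  have nd: "nrm d \<le> X ^ 11 * (4 * \<delta> / W)"
    unfolding d_def x_def z_def by (rule sol_weight_lipschitz[OF ua ub close dW])
  have dsmall: "4 * \<delta> / W \<le> 1 / X ^ 19"
  proof -
    have "\<delta> / W \<le> 1 / X ^ 20" using \<delta>X W by (simp add: field_simps)
    then have "4 * \<delta> / W \<le> 4 / X ^ 20" by simp
    also have "\<dots> \<le> 1 / X ^ 19" using X_absorb[of 4 19] by (simp add: field_simps)
    finally show ?thesis .
  qed
  \<comment> \<open>The change of the computational error stays below \<open>g\<close> because
    \<open>opt n m w \<le> n * W \<le> X * W\<close>.\<close>
  have nres: "nrm (\<lambda>e. grad a x e - grad b z e) \<le> g"
  proof -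
    have "nrm (\<lambda>e. grad a x e - grad b z e) \<le> (4 * \<delta> / W) / X ^ 4"
      unfolding x_def z_def by (rule sol_residual_lipschitz[OF ua ub close dW])
    also have "\<dots> = \<delta> * (4 / X ^ 4) / W" by (simp add: mult.commute)
    also have "\<dots> \<le> \<delta> * (1 / X) / W"
    proof (intro divide_right_mono mult_left_mono)
      have "4 * X \<le> X\<^sup>2" using X_ge(1) by (simp add: power2_eq_square)
      also have "\<dots> \<le> X ^ 4" by (rule X_power_mono) simp
      finally show "4 / X ^ 4 \<le> 1 / X" by (simp add: field_simps)
    qed (use \<delta> W in auto)
    also have "\<dots> = \<delta> / (X * W)" by simp
    also have "\<dots> \<le> \<delta> / opt n m w"
    proof -
      have "real n * W \<le> X * W" using X_ge(2) W by (intro mult_right_mono) auto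
      then have "opt n m w \<le> X * W" using optW by linarith
      then show ?thesis using \<delta> opt W by (intro divide_left_mono) auto
    qed
    finally show ?thesis by (simp add: g_def)
  qed
  define t where "t = ip a x"
  \<comment> \<open>\<open>s\<close> mixes the weights of one problem with the solution of the
    other; it is positive because it is close to \<open>s' \<ge> 1 / 3\<close>.\<close>
  define s where "s = ip a z"
  define s' where "s' = ip b z"
  have pos': "0 < wmax n m w'" using W' by (simp add: W'_def)
  have t: "1 / 3 \<le> t" unfolding t_def x_def a_def by (rule sol_weight(3)[OF w pos])
  have s': "1 / 3 \<le> s'" unfolding s'_def z_def b_def by (rule sol_weight(3)[OF w' pos'])
  have "\<bar>s - s'\<bar> \<le> X\<^sup>2 * ((4 * \<delta> / W) * nrm z)"
    using ip_le_sup[of "\<lambda>e. a e - b e" "4 * \<delta> / W" z] close by (simp add: s_def s'_def ip_diff_left)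
  also have "\<dots> \<le> X\<^sup>2 * ((1 / X ^ 19) * X ^ 4)"
    using dsmall dW sol_bounded[OF ub] unfolding z_def by (intro mult_left_mono mult_mono) auto
  also have "\<dots> = 1 / X ^ 13" by (simp add: field_simps flip: power_add)
  also have "\<dots> \<le> 1 / 10" using X_power_mono[of 1 13] X_ge(1) by (intro divide_left_mono) auto
  finally have s: "0 < s" using s' by linarith
  have ts: "t - s = ip a d" by (simp add: t_def s_def d_def ip_diff_right)
  have "\<bar>t - s\<bar> \<le> X\<^sup>2 * nrm d" unfolding ts by (rule ip_unit_le[OF ua])
  also have "\<dots> \<le> X\<^sup>2 * (X ^ 11 * (1 / X ^ 19))"
    using nd dsmall by (intro mult_left_mono order_trans[OF nd]) auto
  also have "\<dots> = 1 / X ^ 6" by (simp add: field_simps flip: power_add)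
  also have "\<dots> \<le> 1" using X_ge_1(2)[of 6] by simp
  finally have ts1: "\<bar>t - s\<bar> \<le> 1" .
  \<comment> \<open>\<open>S\<close> and \<open>S'\<close> are the normalizers
    \<open>W + \<langle>w, z\<rangle>\<close> and \<open>W' + \<langle>w', z\<rangle>\<close>, taken
    at the same point \<open>z\<close>.\<close>
  define S where "S = W * (1 + s)"
  define S' where "S' = W' * (1 + s')"
  define A where "A = ip w d"
  have S: "0 < S" using W s by (simp add: S_def)
  have A: "A = W * (t - s)"
    unfolding A_def ts W_def a_def by (rule ip_scaled[OF pos])
  have S'opt: "opt n m w / 6 \<le> S'" "0 < S'"
  proof -
    have "opt n m w' / 3 \<le> ip w' z" unfolding z_def b_def by (rule sol_weight(2)[OF w' pos'])
    also have "\<dots> = W' * s'" unfolding s'_def W'_def b_def by (rule ip_scaled[OF pos'])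
    also have "\<dots> \<le> S'" using W' by (simp add: S'_def)
    finally have "opt n m w' / 3 \<le> S'" .
    moreover have "opt n m w \<le> opt n m w' + \<delta>" unfolding \<delta>_def by (rule opt_le_opt_l1)
    ultimately show "opt n m w / 6 \<le> S'" using \<delta>W optW(1) W by linarith
    then show "0 < S'" using opt by linarith
  qed
  \<comment> \<open>One \<delta> comes from the largest weights and two from the scalar product,
    since the entries of \<open>z\<close> are at most \<open>2\<close> in absolute value.\<close>
  have SS': "\<bar>S' - S\<bar> \<le> 3 * \<delta>"
  proof -
    have "S' = W' + ip w' z" "S = W + ip w z"
      using ip_scaled[OF pos', of z] ip_scaled[OF pos, of z]
      by (simp_all add: S_def S'_def s_def s'_def a_def b_def W_def W'_def algebra_simps)
    moreover have "\<bar>ip w' z - ip w z\<bar> \<le> 2 * \<delta>"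
    proof -
      have "\<bar>ip w' z - ip w z\<bar> \<le> (\<Sum>e\<in>edges n m. \<bar>(w' e - w e) * z e\<bar>)"
        unfolding ip_diff_left[symmetric] unfolding ip_def by (rule sum_abs)
      also have "\<dots> \<le> (\<Sum>e\<in>edges n m. \<bar>w e - w' e\<bar> * 2)"
        unfolding abs_mult using sol_le_2(2)[OF ub]
        by (intro sum_mono mult_mono) (auto simp: z_def abs_minus_commute)
      also have "\<dots> = 2 * \<delta>" by (simp add: \<delta>_def l1_dist_def sum_distrib_left mult.commute)
      finally show ?thesis .
    qed
    ultimately show ?thesis using WW' by linarith
  qed
  have "lam * D + (phi t - phi s) * (t - s) \<le> ip (\<lambda>e. grad a x e - grad a z e) d"
    unfolding D_def t_def s_def d_def by (rule grad_monotone_gap)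
  also have "\<dots> = ip (\<lambda>e. grad a x e - grad b z e) d + ip (\<lambda>e. grad b z e - grad a z e) d"
    by (simp add: ip_def sum.distrib[symmetric] algebra_simps)
  \<comment> \<open>At the same point only the logarithmic terms differ;
    \<open>w / S - w' / S'\<close> is split into the change of the weights and the change of the
    normalizer.\<close>
  also have "ip (\<lambda>e. grad b z e - grad a z e) d = (\<Sum>e\<in>edges n m. (w e - w' e) * d e) / S' + (1 / S - 1 / S') * A"
  proof -
    have *: "grad b z e - grad a z e = (w e - w' e) / S' + (1 / S - 1 / S') * w e" for e
    proof -
      have "grad b z e - grad a z e = a e * (1 - phi s) - b e * (1 - phi s')"
        by (simp add: grad_def s_def s'_def)
      also have "\<dots> = w e / S - w' e / S'"
        using s s' by (simp add: one_minus_phi a_def b_def scaled_def S_def S'_def W_def W'_def)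
      finally show ?thesis by (simp add: algebra_simps diff_divide_distrib)
    qed
    show ?thesis unfolding * A_def ip_def sum_divide_distrib sum_distrib_left sum.distrib[symmetric]
      by (intro sum.cong refl) (simp add: algebra_simps)
  qed
  finally have main: "lam * D + (phi t - phi s) * (t - s)
      \<le> ip (\<lambda>e. grad a x e - grad b z e) d + (\<Sum>e\<in>edges n m. (w e - w' e) * d e) / S' + (1 / S - 1 / S') * A"
    by simp
  have i1: "ip (\<lambda>e. grad a x e - grad b z e) d \<le> g * nrm d"
  proof -
    have "ip (\<lambda>e. grad a x e - grad b z e) d \<le> nrm (\<lambda>e. grad a x e - grad b z e) * nrm d"
      using ip_le_nrm[of "\<lambda>e. grad a x e - grad b z e" d] by linarith
    also have "\<dots> \<le> g * nrm d" using nres by (intro mult_right_mono) auto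
    finally show ?thesis .
  qed
  have inv: "1 / S' \<le> 6 / opt n m w" using S'opt opt by (simp add: field_simps)
  have i2: "(\<Sum>e\<in>edges n m. (w e - w' e) * d e) / S' \<le> 6 * g * nrm d"
  proof -
    have "(\<Sum>e\<in>edges n m. (w e - w' e) * d e) \<le> (\<Sum>e\<in>edges n m. \<bar>w e - w' e\<bar> * nrm d)"
    proof (intro sum_mono)
      fix e assume "e \<in> edges n m"
      have "(w e - w' e) * d e \<le> \<bar>w e - w' e\<bar> * \<bar>d e\<bar>" by (metis abs_ge_self abs_mult)
      also have "\<dots> \<le> \<bar>w e - w' e\<bar> * nrm d"
        using component_le_nrm[OF \<open>e \<in> edges n m\<close>, of d] by (intro mult_left_mono) auto
      finally show "(w e - w' e) * d e \<le> \<bar>w e - w' e\<bar> * nrm d" .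
    qed
    also have "\<dots> = \<delta> * nrm d" by (simp add: \<delta>_def l1_dist_def sum_distrib_right)
    finally have "(\<Sum>e\<in>edges n m. (w e - w' e) * d e) / S' \<le> \<delta> * nrm d * (1 / S')"
      using S'opt by (simp add: divide_right_mono)
    also have "\<dots> \<le> \<delta> * nrm d * (6 / opt n m w)" using inv \<delta> by (intro mult_left_mono) auto
    finally show ?thesis by (simp add: g_def mult_ac)
  qed
  \<comment> \<open>\<open>A / S\<close> need not be of order \<open>g\<close>. Its product with the
    relative change of the normalizer, at most \<open>18 * g\<close>, is split by the inequality
    between the means; the square of \<open>A / S\<close> is then absorbed by the logarithm in
    \<open>i4\<close>, and \<open>162 = 18 ^ 2 / 2\<close>.\<close>
  have i3: "(1 / S - 1 / S') * A \<le> (A / S)\<^sup>2 / 2 + 162 * g\<^sup>2"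
  proof -
    define q where "q = \<bar>S' - S\<bar> / S'"
    have "1 / S - 1 / S' = (S' - S) / (S * S')" using S S'opt by (simp add: field_simps)
    then have "\<bar>(1 / S - 1 / S') * A\<bar> = \<bar>A / S\<bar> * q"
      using S S'opt by (simp add: q_def abs_mult abs_divide)
    also have "\<dots> \<le> (A / S)\<^sup>2 / 2 + q\<^sup>2 / 2"
      using sum_squares_bound[of "\<bar>A / S\<bar>" q] unfolding power2_abs by linarith
    also have "q\<^sup>2 / 2 \<le> (18 * g)\<^sup>2 / 2"
    proof -
      have "q \<le> 3 * \<delta> * (1 / S')" unfolding q_def using SS' S'opt by (simp add: divide_right_mono)
      also have "\<dots> \<le> 3 * \<delta> * (6 / opt n m w)" using inv \<delta> by (intro mult_left_mono) auto
      finally have "q \<le> 18 * g" by (simp add: g_def)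
      moreover have "0 \<le> q" using S'opt by (simp add: q_def)
      ultimately show ?thesis by (intro divide_right_mono power_mono) auto
    qed
    finally show ?thesis by (simp add: power_mult_distrib)
  qed
  \<comment> \<open>From \<open>\<bar>t - s\<bar> \<le> 1\<close> and \<open>s > 0\<close> follows
    \<open>1 + t \<le> 2 * (1 + s)\<close>.\<close>
  have i4: "(A / S)\<^sup>2 / 2 \<le> (phi t - phi s) * (t - s)"
  proof -
    have "(phi t - phi s) * (t - s) = (t - s)\<^sup>2 / ((1 + t) * (1 + s))"
      using t s by (simp add: phi_def field_simps power2_eq_square)
    moreover have "(A / S)\<^sup>2 / 2 = (t - s)\<^sup>2 / (2 * (1 + s) * (1 + s))"
      using W s by (simp add: A S_def power2_eq_square)
    moreover have "(t - s)\<^sup>2 / (2 * (1 + s) * (1 + s)) \<le> (t - s)\<^sup>2 / ((1 + t) * (1 + s))"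
      using ts1 s t by (intro divide_left_mono mult_right_mono mult_pos_pos) auto
    ultimately show ?thesis by simp
  qed
  have lD: "lam * D \<le> 7 * g * nrm d + 162 * g\<^sup>2" using main i1 i2 i3 i4 by linarith
  have dD: "(nrm d)\<^sup>2 \<le> D"
    unfolding nrm_square ip_def D_def d_def
    by (intro sum_mono) (use ent_strongly_monotone in \<open>simp add: power2_eq_square\<close>)
  have D0: "0 \<le> D" using dD zero_le_power2[of "nrm d"] by linarith
  have nsD: "nrm d \<le> sqrt D" using dD by (simp add: real_le_rsqrt)
  have "lam * (sqrt D)\<^sup>2 \<le> 7 * g * sqrt D + 162 * g\<^sup>2"
    using lD D0 mult_left_mono[OF nsD, of "7 * g"] g by simp
  from quadratic_bound[OF this] have sD: "sqrt D \<le> 20 * g / lam" using g D0 by simp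
  have m: "0 < m"
    using wmax_attained[OF pos] by (auto simp: edges_def)
  have "(\<Sum>e\<in>edges n m. \<bar>x e - z e\<bar>) \<le> 2 * sqrt (real n) * sqrt D"
    unfolding D_def x_def z_def by (rule sol_l1_le_energy[OF ua ub m])
  also have "\<dots> \<le> 2 * sqrt (real n) * (20 * g / lam)" using sD by (intro mult_left_mono) auto
  finally show ?thesis by (simp add: x_def z_def a_def b_def g_def \<delta>_def)
qed

lemma frac_l1_lipschitz:
  assumes "w \<in> weightings n m" "w' \<in> weightings n m"
    and "0 < wmax n m w" "l1_dist n m w w' \<le> wmax n m w / X ^ 20"
  shows "(\<Sum>e\<in>edges n m. \<bar>frac (scaled n m w) e - frac (scaled n m w') e\<bar>)
    \<le> 40 * sqrt (real n) * (l1_dist n m w w' / opt n m w) / lam"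
proof (rule order_trans[OF sum_mono sol_l1_lipschitz[OF assms]])
  fix e
  let ?x = "sol (scaled n m w) e" and ?z = "sol (scaled n m w') e"
  have "\<bar>max ?x 0 - max ?z 0\<bar> \<le> \<bar>?x - ?z\<bar>" by linarith
  moreover have "\<bar>max ?x 0 - max ?z 0\<bar> / (1 + 1 / real E) \<le> \<bar>max ?x 0 - max ?z 0\<bar>"
    using mult_left_mono[of 1 "1 + 1 / real E" "\<bar>max ?x 0 - max ?z 0\<bar>"]
    by (simp add: divide_le_eq add_pos_pos)
  ultimately show "\<bar>frac (scaled n m w) e - frac (scaled n m w') e\<bar> \<le> \<bar>?x - ?z\<bar>"
    by (simp add: frac_def diff_divide_distrib[symmetric] abs_divide)
qed

text \<open>The factors are \<open>1 - 2 / E\<close> and \<open>1 + 2 / E\<close> from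
  near-optimality and \<open>1 + 1 / E\<close> from the scaling in \<open>frac\<close>; to first
  order the losses add up to \<open>5 / E\<close>. Cutting off negative entries only increases the
  weight.\<close>

lemma frac_weight:
  assumes w: "w \<in> weightings n m"
  shows "(1 - 5 / real E) * opt n m w \<le> (\<Sum>e\<in>edges n m. w e * frac (scaled n m w) e)"
proof (cases "0 < wmax n m w")
  case False
  then have W: "wmax n m w = 0" using wmax_nonneg[of n m w] by linarith
  then have "opt n m w = 0" using opt_le_wmax[of n m w] wmax_le_opt[of n m w] by simp
  then show ?thesis using weighting_nonneg[OF w] frac_nonneg by (auto intro!: sum_nonneg)
next
  case True
  let ?c = "1 / real E" and ?I = "ip w (sol (scaled n m w))" and ?O = "opt n m w"
  have c: "0 < ?c" "?c \<le> 1 / 5" using E_ge by (auto intro!: divide_left_mono)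
  have O: "0 \<le> ?O" using True wmax_le_opt[of n m w] by linarith
  have I0: "0 \<le> ?I" using sol_weight(2)[OF w True] O by linarith
  have "?O - ?I \<le> 2 * ?c * (?O + ?I)"
  proof -
    have "?O - ?I \<le> 2 * ?c * (wmax n m w + ?I)" using sol_weight(1)[OF w True] by simp
    also have "\<dots> \<le> 2 * ?c * (?O + ?I)" using wmax_le_opt[of n m w] by (intro mult_left_mono) auto
    finally show ?thesis .
  qed
  then have I: "(1 - 2 * ?c) * ?O \<le> (1 + 2 * ?c) * ?I" by (simp add: algebra_simps)
  have "(1 - 5 * r) * ((1 + r) * (1 + 2 * r)) \<le> 1 - 2 * r" if "0 < r" for r :: real
  proof -
    have "(1 - 5 * r) * ((1 + r) * (1 + 2 * r)) = 1 - 2 * r - 13 * r\<^sup>2 - 10 * (r * r\<^sup>2)"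
      by (simp add: algebra_simps power2_eq_square)
    moreover have "0 \<le> r\<^sup>2" "0 \<le> r * r\<^sup>2" using that by simp_all
    ultimately show ?thesis by linarith
  qed
  from this[OF c(1)] have key: "(1 - 5 * ?c) * ((1 + ?c) * (1 + 2 * ?c)) \<le> 1 - 2 * ?c" .
  have "((1 - 5 * ?c) * ?O * (1 + ?c)) * (1 + 2 * ?c) \<le> (1 - 2 * ?c) * ?O"
    using mult_right_mono[OF key O] by (simp only: mult_ac)
  also have "\<dots> \<le> ?I * (1 + 2 * ?c)" using I by (simp add: mult.commute)
  finally have "(1 - 5 * ?c) * ?O * (1 + ?c) \<le> ?I"
    by (rule mult_right_le_imp_le) (use c in linarith)
  then have "(1 - 5 * ?c) * ?O \<le> ?I / (1 + ?c)" by (subst pos_le_divide_eq) (use c in linarith)+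
  also have "\<dots> \<le> (\<Sum>e\<in>edges n m. w e * max (sol (scaled n m w) e) 0) / (1 + ?c)"
    unfolding ip_def using c weighting_nonneg[OF w]
    by (intro divide_right_mono sum_mono mult_left_mono) auto
  finally show ?thesis by (simp add: frac_def sum_divide_distrib)
qed

end

section \<open>Rounding\<close>

text \<open>The common part \<open>min p q\<close> is put on the diagonal, and the two excesses,
  each of mass \<open>1 - s\<close>, are coupled independently. The case \<open>s = 1\<close> is
  separate because the excesses are normalized by \<open>1 - s\<close>.\<close>

lemma exists_maximal_coupling:
  fixes p q :: "'a pmf"
  assumes S: "finite S" "set_pmf p \<subseteq> S" "set_pmf q \<subseteq> S"
  shows "\<exists>D\<in>couplings p q. measure_pmf.prob D {z. fst z \<noteq> snd z} \<le> (\<Sum>x\<in>S. \<bar>pmf p x - pmf q x\<bar>) / 2"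
proof -
  define r where "r x = min (pmf p x) (pmf q x)" for x
  define s where "s = (\<Sum>x\<in>S. r x)"
  have sp: "(\<Sum>x\<in>S. pmf p x) = 1" and sq: "(\<Sum>x\<in>S. pmf q x) = 1"
    using S by (auto intro: sum_pmf_eq_1)
  have half: "1 - s = (\<Sum>x\<in>S. \<bar>pmf p x - pmf q x\<bar>) / 2"
  proof -
    have "(\<Sum>x\<in>S. \<bar>pmf p x - pmf q x\<bar>) = (\<Sum>x\<in>S. pmf p x + pmf q x - 2 * r x)"
      by (intro sum.cong) (auto simp: r_def)
    also have "\<dots> = 2 - 2 * s"
      by (simp add: sum_subtractf sum.distrib sp sq s_def sum_distrib_left)
    finally show ?thesis by simp
  qed
  have out: "pmf p x = 0" "pmf q x = 0" if "x \<notin> S" for x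
    using that S by (auto simp: set_pmf_iff)
  have "0 \<le> (\<Sum>x\<in>S. \<bar>pmf p x - pmf q x\<bar>)" by (intro sum_nonneg) auto
  then have s1: "s \<le> 1" using half by linarith
  show ?thesis
  proof (cases "s = 1")
    case True
    have "pmf p x = pmf q x" for x
    proof (cases "x \<in> S")
      case True
      have "(\<Sum>x\<in>S. \<bar>pmf p x - pmf q x\<bar>) = 0" using half \<open>s = 1\<close> by simp
      then show ?thesis using True S(1) by (subst (asm) sum_nonneg_eq_0_iff) auto
    qed (simp add: out)
    then have "p = q" by (rule pmf_eqI)
    have "map_pmf (\<lambda>x. (x, x)) p \<in> couplings p q"
      by (simp add: couplings_def pmf.map_comp o_def \<open>p = q\<close>)
    moreover have "measure_pmf.prob (map_pmf (\<lambda>x. (x, x)) p) {z. fst z \<noteq> snd z} = 0"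
      by simp
    ultimately show ?thesis by (intro bexI) (auto simp: sum_nonneg)
  next
    case False
    then have s: "0 < 1 - s" using s1 by simp
    define d where "d z = (if fst z = snd z then r (fst z) else 0)
      + (pmf p (fst z) - r (fst z)) * (pmf q (snd z) - r (snd z)) / (1 - s)" for z
    have d0: "0 \<le> d z" for z
      unfolding d_def using s by (intro add_nonneg_nonneg divide_nonneg_pos mult_nonneg_nonneg) (auto simp: r_def)
    have dout: "d z = 0" if "z \<notin> S \<times> S" for z
      using that by (cases z) (auto simp: d_def r_def out)
    have d1: "(\<Sum>y\<in>S. d (x, y)) = pmf p x" for x
    proof (cases "x \<in> S")
      case True
      have "(\<Sum>y\<in>S. d (x, y)) = r x + (\<Sum>y\<in>S. (pmf p x - r x) * (pmf q y - r y) / (1 - s))"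
        using True S(1) by (simp add: d_def sum.distrib)
      also have "(\<Sum>y\<in>S. (pmf p x - r x) * (pmf q y - r y) / (1 - s))
          = (pmf p x - r x) * (\<Sum>y\<in>S. pmf q y - r y) / (1 - s)"
        by (simp add: sum_divide_distrib sum_distrib_left)
      also have "(\<Sum>y\<in>S. pmf q y - r y) = 1 - s" by (simp add: sum_subtractf sq s_def)
      finally show ?thesis using s by simp
    next
      case False
      then show ?thesis using dout by (simp add: out)
    qed
    have d2: "(\<Sum>x\<in>S. d (x, y)) = pmf q y" for y
    proof (cases "y \<in> S")
      case True
      have "(\<Sum>x\<in>S. d (x, y)) = r y + (\<Sum>x\<in>S. (pmf p x - r x) * (pmf q y - r y) / (1 - s))"
        using True S(1) by (simp add: d_def sum.distrib)
      also have "(\<Sum>x\<in>S. (pmf p x - r x) * (pmf q y - r y) / (1 - s))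
          = (\<Sum>x\<in>S. pmf p x - r x) * (pmf q y - r y) / (1 - s)"
        by (simp add: sum_divide_distrib sum_distrib_right)
      also have "(\<Sum>x\<in>S. pmf p x - r x) = 1 - s" by (simp add: sum_subtractf sp s_def)
      finally show ?thesis using s by simp
    next
      case False
      then show ?thesis using dout by (simp add: out)
    qed
    define D where "D = embed_pmf d"
    have "(\<integral>\<^sup>+ z. ennreal (d z) \<partial>count_space UNIV) = (\<Sum>z\<in>S \<times> S. ennreal (d z))"
      using S(1) dout by (intro nn_integral_count_space') auto
    also have "\<dots> = ennreal (\<Sum>x\<in>S. \<Sum>y\<in>S. d (x, y))"
      using d0 by (simp add: sum_ennreal sum.cartesian_product)
    also have "\<dots> = 1" by (simp add: d1 sp)
    finally have D: "pmf D z = d z" for z unfolding D_def using d0 by (intro pmf_embed_pmf) auto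
    have prob: "measure_pmf.prob D A = (\<Sum>z\<in>A \<inter> S \<times> S. d z)" for A
    proof -
      have "measure_pmf.prob D A = measure_pmf.prob D (A \<inter> S \<times> S)"
        using dout by (intro measure_prob_cong_0) (auto simp: D)
      then show ?thesis using S(1) by (simp add: measure_measure_pmf_finite D)
    qed
    have "map_pmf fst D = p"
    proof (rule pmf_eqI)
      fix x
      have "pmf (map_pmf fst D) x = (\<Sum>z\<in>(fst -` {x}) \<inter> S \<times> S. d z)" by (simp add: pmf_map prob)
      also have "\<dots> = pmf p x"
      proof (cases "x \<in> S")
        case True
        then have "(fst -` {x}) \<inter> S \<times> S = Pair x ` S" by auto
        then show ?thesis by (simp add: sum.reindex inj_on_def d1)
      next
        case False
        then have "(fst -` {x}) \<inter> S \<times> S = {}" by auto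
        then show ?thesis using False by (simp add: out)
      qed
      finally show "pmf (map_pmf fst D) x = pmf p x" .
    qed
    moreover have "map_pmf snd D = q"
    proof (rule pmf_eqI)
      fix y
      have "pmf (map_pmf snd D) y = (\<Sum>z\<in>(snd -` {y}) \<inter> S \<times> S. d z)" by (simp add: pmf_map prob)
      also have "\<dots> = pmf q y"
      proof (cases "y \<in> S")
        case True
        then have "(snd -` {y}) \<inter> S \<times> S = (\<lambda>x. (x, y)) ` S" by auto
        then show ?thesis by (simp add: sum.reindex inj_on_def d2)
      next
        case False
        then have "(snd -` {y}) \<inter> S \<times> S = {}" by auto
        then show ?thesis using False by (simp add: out)
      qed
      finally show "pmf (map_pmf snd D) y = pmf q y" .
    qed
    ultimately have "D \<in> couplings p q" by (simp add: couplings_def)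
    moreover have "measure_pmf.prob D {z. fst z \<noteq> snd z} \<le> 1 - s"
    proof -
      have "s \<le> (\<Sum>x\<in>S. d (x, x))"
        unfolding s_def
      proof (rule sum_mono)
        fix x
        have "0 \<le> (pmf p x - r x) * (pmf q x - r x) / (1 - s)"
          using s by (intro divide_nonneg_pos mult_nonneg_nonneg) (auto simp: r_def)
        then show "r x \<le> d (x, x)" by (simp add: d_def)
      qed
      also have "\<dots> = (\<Sum>z\<in>{z. fst z = snd z} \<inter> S \<times> S. d z)"
      proof -
        have "{z. fst z = snd z} \<inter> S \<times> S = (\<lambda>x. (x, x)) ` S" by auto
        then show ?thesis by (simp add: sum.reindex inj_on_def)
      qed
      also have "\<dots> = measure_pmf.prob D {z. fst z = snd z}" by (simp add: prob)
      also have "\<dots> = 1 - measure_pmf.prob D {z. fst z \<noteq> snd z}"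
        using measure_pmf.prob_compl[of "{z. fst z \<noteq> snd z}" D] by (simp add: Diff_eq Compl_eq)
      finally show ?thesis by simp
    qed
    ultimately show ?thesis using half by auto
  qed
qed

section \<open>First-come assignment\<close>

definition first_wins :: "nat \<Rightarrow> nat \<Rightarrow> (nat \<Rightarrow> nat) \<Rightarrow> edge set" where
  "first_wins n m f = {(u, v) \<in> edges n m. f u = v \<and> (\<forall>u'<u. f u' \<noteq> v)}"

lemma first_wins_matching: "first_wins n m f \<in> matchings n m"
  unfolding matchings_def
proof (intro CollectI conjI ballI impI)
  show "first_wins n m f \<subseteq> edges n m" by (auto simp: first_wins_def)
  fix e e' assume e: "e \<in> first_wins n m f" "e' \<in> first_wins n m f" "e \<noteq> e'"
  obtain u v u' v' where uv: "e = (u, v)" "e' = (u', v')" by (cases e, cases e')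
  have f: "f u = v" "f u' = v'" "\<forall>i<u. f i \<noteq> v" "\<forall>i<u'. f i \<noteq> v'"
    using e(1,2) by (auto simp: uv first_wins_def)
  show "fst e \<noteq> fst e'" using f e(3) by (auto simp: uv)
  show "snd e \<noteq> snd e'" using f e(3) by (cases u u' rule: linorder_cases) (auto simp: uv)
qed

text \<open>Lost edges are counted by their right endpoints. If \<open>(u, v)\<close> is lost, then
  either \<open>u\<close> no longer picks \<open>v\<close>, or an earlier vertex picks
  \<open>v\<close> under \<open>g\<close> but not under \<open>f\<close>; either way
  \<open>v\<close> is the old or the new pick of a vertex whose pick changed.\<close>

lemma card_first_wins_diff:
  "card (first_wins n m f - first_wins n m g) \<le> 2 * card {u \<in> {..<n}. f u \<noteq> g u}"
proof -
  let ?S = "{u \<in> {..<n}. f u \<noteq> g u}"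
  have "snd ` (first_wins n m f - first_wins n m g) \<subseteq> f ` ?S \<union> g ` ?S"
  proof
    fix v assume "v \<in> snd ` (first_wins n m f - first_wins n m g)"
    then obtain u where u: "(u, v) \<in> first_wins n m f" "(u, v) \<notin> first_wins n m g" by auto
    then have e: "u < n" "f u = v" "\<forall>u'<u. f u' \<noteq> v" and e': "g u \<noteq> v \<or> (\<exists>u'<u. g u' = v)"
      by (auto simp: first_wins_def edges_def)
    show "v \<in> f ` ?S \<union> g ` ?S"
    proof (cases "g u = v")
      case True
      then obtain u' where "u' < u" "g u' = v" using e' by blast
      moreover have "f u' \<noteq> v" using e(3) \<open>u' < u\<close> by blast
      ultimately have "u' \<in> ?S" "v = g u'" using e(1) by auto
      then show ?thesis by blast
    next
      case False
      then have "u \<in> ?S" "v = f u" using e by auto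
      then show ?thesis by blast
    qed
  qed
  then have "card (snd ` (first_wins n m f - first_wins n m g)) \<le> card (f ` ?S \<union> g ` ?S)"
    by (intro card_mono) auto
  also have "\<dots> \<le> card (f ` ?S) + card (g ` ?S)" by (rule card_Un_le)
  also have "\<dots> \<le> card ?S + card ?S" by (intro add_mono card_image_le) auto
  finally have "card (snd ` (first_wins n m f - first_wins n m g)) \<le> 2 * card ?S" by simp
  moreover have "inj_on snd (first_wins n m f - first_wins n m g)"
    using first_wins_matching[of n m f] unfolding matchings_def inj_on_def by blast
  ultimately show ?thesis by (simp add: card_image)
qed

lemma card_first_wins_sym_diff:
  "card (sym_diff (first_wins n m f) (first_wins n m g)) \<le> (\<Sum>u<n. if f u \<noteq> g u then 4 else 0)"
proof -
  have "card (sym_diff (first_wins n m f) (first_wins n m g))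
      \<le> card (first_wins n m f - first_wins n m g) + card (first_wins n m g - first_wins n m f)"
    by (rule card_Un_le)
  also have "\<dots> \<le> 2 * card {u \<in> {..<n}. f u \<noteq> g u} + 2 * card {u \<in> {..<n}. g u \<noteq> f u}"
    by (intro add_mono card_first_wins_diff)
  also have "\<dots> = 4 * card {u \<in> {..<n}. f u \<noteq> g u}" by (simp add: eq_commute)
  also have "\<dots> = (\<Sum>u<n. if f u \<noteq> g u then 4 else 0)"
    by (subst sum.inter_filter[symmetric]) auto
  finally show ?thesis .
qed

text \<open>The left vertices are coupled independently of each other, each by a maximal coupling. A
  differing pick costs \<open>4\<close> and has probability at most half the l1 distance, hence the
  factor \<open>2\<close>.\<close>

lemma EM_u_first_wins_le:
  assumes "\<And>u. u < n \<Longrightarrow> set_pmf (p u) \<subseteq> {..m}" "\<And>u. u < n \<Longrightarrow> set_pmf (q u) \<subseteq> {..m}"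
  shows "EM_u (map_pmf (first_wins n m) (Pi_pmf {..<n} m p)) (map_pmf (first_wins n m) (Pi_pmf {..<n} m q))
    \<le> ennreal (2 * (\<Sum>u<n. \<Sum>v\<le>m. \<bar>pmf (p u) v - pmf (q u) v\<bar>))"
proof -
  have "\<forall>u. \<exists>D. u < n \<longrightarrow> D \<in> couplings (p u) (q u) \<and>
      measure_pmf.prob D {z. fst z \<noteq> snd z} \<le> (\<Sum>v\<le>m. \<bar>pmf (p u) v - pmf (q u) v\<bar>) / 2"
    using exists_maximal_coupling[OF finite_atMost assms] by blast
  from choice[OF this] obtain D where "\<forall>u. u < n \<longrightarrow> D u \<in> couplings (p u) (q u) \<and>
      measure_pmf.prob (D u) {z. fst z \<noteq> snd z} \<le> (\<Sum>v\<le>m. \<bar>pmf (p u) v - pmf (q u) v\<bar>) / 2"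
    by blast
  then have D: "\<And>u. u < n \<Longrightarrow> D u \<in> couplings (p u) (q u)"
    "\<And>u. u < n \<Longrightarrow> measure_pmf.prob (D u) {z. fst z \<noteq> snd z} \<le> (\<Sum>v\<le>m. \<bar>pmf (p u) v - pmf (q u) v\<bar>) / 2"
    by auto
  \<comment> \<open>The default \<open>(m, m)\<close> projects to the default \<open>m\<close> of
    both products.\<close>
  define P where "P = Pi_pmf {..<n} (m, m) D"
  let ?F = "\<lambda>g. (first_wins n m (fst \<circ> g), first_wins n m (snd \<circ> g))"
  have 1: "map_pmf (\<lambda>g. fst \<circ> g) P = Pi_pmf {..<n} m p"
    unfolding P_def by (subst Pi_pmf_map[symmetric]) (use D(1) in \<open>auto simp: couplings_def intro!: Pi_pmf_cong\<close>)
  have 2: "map_pmf (\<lambda>g. snd \<circ> g) P = Pi_pmf {..<n} m q"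
    unfolding P_def by (subst Pi_pmf_map[symmetric]) (use D(1) in \<open>auto simp: couplings_def intro!: Pi_pmf_cong\<close>)
  have mem: "map_pmf ?F P \<in> couplings (map_pmf (first_wins n m) (Pi_pmf {..<n} m p))
      (map_pmf (first_wins n m) (Pi_pmf {..<n} m q))"
    unfolding couplings_def 1[symmetric] 2[symmetric] by (simp add: pmf.map_comp o_def)
  have "EM_u (map_pmf (first_wins n m) (Pi_pmf {..<n} m p)) (map_pmf (first_wins n m) (Pi_pmf {..<n} m q))
      \<le> (\<integral>\<^sup>+ (F, F'). of_nat (card (sym_diff F F')) \<partial>measure_pmf (map_pmf ?F P))"
    unfolding EM_u_def by (rule INF_lower[OF mem])
  also have "\<dots> = (\<integral>\<^sup>+ g. of_nat (card (sym_diff (first_wins n m (fst \<circ> g)) (first_wins n m (snd \<circ> g)))) \<partial>measure_pmf P)"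
    by simp
  also have "\<dots> \<le> (\<integral>\<^sup>+ g. (\<Sum>u<n. 4 * indicator {z. fst z \<noteq> snd z} (g u)) \<partial>measure_pmf P)"
  proof (rule nn_integral_mono)
    fix g
    have "(of_nat (card (sym_diff (first_wins n m (fst \<circ> g)) (first_wins n m (snd \<circ> g)))) :: ennreal)
        \<le> of_nat (\<Sum>u<n. if (fst \<circ> g) u \<noteq> (snd \<circ> g) u then 4 else 0)"
      by (intro of_nat_mono card_first_wins_sym_diff)
    also have "\<dots> = (\<Sum>u<n. 4 * indicator {z. fst z \<noteq> snd z} (g u))"
      unfolding of_nat_sum by (intro sum.cong) (auto simp: indicator_def)
    finally show "of_nat (card (sym_diff (first_wins n m (fst \<circ> g)) (first_wins n m (snd \<circ> g))))
        \<le> (\<Sum>u<n. 4 * indicator {z. fst z \<noteq> snd z} (g u) :: ennreal)" .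
  qed
  also have "\<dots> = (\<Sum>u<n. 4 * (\<integral>\<^sup>+ g. indicator {z. fst z \<noteq> snd z} (g u) \<partial>measure_pmf P))"
    by (subst nn_integral_sum) (auto intro!: sum.cong nn_integral_cmult)
  also have "\<dots> \<le> (\<Sum>u<n. ennreal (2 * (\<Sum>v\<le>m. \<bar>pmf (p u) v - pmf (q u) v\<bar>)))"
  proof (intro sum_mono)
    fix u assume u: "u \<in> {..<n}"
    have "(\<integral>\<^sup>+ g. indicator {z. fst z \<noteq> snd z} (g u) \<partial>measure_pmf P)
        = (\<integral>\<^sup>+ z. indicator {z. fst z \<noteq> snd z} z \<partial>measure_pmf (map_pmf (\<lambda>g. g u) P))"
      by simp
    also have "map_pmf (\<lambda>g. g u) P = D u"
      unfolding P_def using u by (subst Pi_pmf_component) auto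
    also have "(\<integral>\<^sup>+ z. indicator {z. fst z \<noteq> snd z} z \<partial>measure_pmf (D u))
        = ennreal (measure_pmf.prob (D u) {z. fst z \<noteq> snd z})"
      by (simp add: measure_pmf.emeasure_eq_measure)
    also have "\<dots> \<le> ennreal ((\<Sum>v\<le>m. \<bar>pmf (p u) v - pmf (q u) v\<bar>) / 2)"
      using D(2) u by (intro ennreal_leI) auto
    finally have "4 * (\<integral>\<^sup>+ g. indicator {z. fst z \<noteq> snd z} (g u) \<partial>measure_pmf P)
        \<le> ennreal 4 * ennreal ((\<Sum>v\<le>m. \<bar>pmf (p u) v - pmf (q u) v\<bar>) / 2)"
      by (simp add: mult_left_mono)
    also have "\<dots> = ennreal (2 * (\<Sum>v\<le>m. \<bar>pmf (p u) v - pmf (q u) v\<bar>))"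
      by (subst ennreal_mult[symmetric]) (auto simp: sum_nonneg)
    finally show "4 * (\<integral>\<^sup>+ g. indicator {z. fst z \<noteq> snd z} (g u) \<partial>measure_pmf P)
        \<le> ennreal (2 * (\<Sum>v\<le>m. \<bar>pmf (p u) v - pmf (q u) v\<bar>))" .
  qed
  also have "\<dots> = ennreal (2 * (\<Sum>u<n. \<Sum>v\<le>m. \<bar>pmf (p u) v - pmf (q u) v\<bar>))"
    by (simp add: sum_ennreal sum_nonneg sum_distrib_left)
  finally show ?thesis .
qed

text \<open>The value \<open>m\<close> stands for picking no right vertex.\<close>

definition pick :: "nat \<Rightarrow> (nat \<Rightarrow> real) \<Rightarrow> nat pmf" where
  "pick m q = embed_pmf (\<lambda>v. if v < m then q v else if v = m then 1 - (\<Sum>v<m. q v) else 0)"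

lemma pmf_pick:
  assumes "\<And>v. v < m \<Longrightarrow> 0 \<le> q v" "(\<Sum>v<m. q v) \<le> 1"
  shows "pmf (pick m q) v = (if v < m then q v else if v = m then 1 - (\<Sum>v<m. q v) else 0)"
  unfolding pick_def
proof (rule pmf_embed_pmf)
  let ?f = "\<lambda>v. if v < m then q v else if v = m then 1 - (\<Sum>v<m. q v) else 0"
  show nn: "0 \<le> ?f v" for v using assms by auto
  have "(\<integral>\<^sup>+ v. ennreal (?f v) \<partial>count_space UNIV) = (\<Sum>v\<le>m. ennreal (?f v))"
    by (intro nn_integral_count_space') auto
  also have "\<dots> = ennreal (\<Sum>v\<le>m. ?f v)" using nn by (intro sum_ennreal)
  also have "(\<Sum>v\<le>m. ?f v) = 1" by (simp add: lessThan_Suc_atMost[symmetric])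
  finally show "(\<integral>\<^sup>+ v. ennreal (?f v) \<partial>count_space UNIV) = 1" by simp
qed

lemma set_pick_subset:
  assumes "\<And>v. v < m \<Longrightarrow> 0 \<le> q v" "(\<Sum>v<m. q v) \<le> 1"
  shows "set_pmf (pick m q) \<subseteq> {..m}"
  using assms by (auto simp: set_pmf_iff pmf_pick split: if_splits)

section \<open>Acceptance probabilities\<close>

text \<open>The constant \<open>2\<close> keeps the denominator between \<open>1\<close> and
  \<open>2\<close>, so that the quotient is at most \<open>y (u, v)\<close> and Lipschitz in
  \<open>y\<close>; the price is the factor \<open>1 / 2\<close> in the matching
  probability.\<close>

definition accept :: "(edge \<Rightarrow> real) \<Rightarrow> nat \<Rightarrow> nat \<Rightarrow> real" where
  "accept y u v = y (u, v) / (2 - (\<Sum>u'<u. y (u', v)))"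

definition rounding :: "nat \<Rightarrow> nat \<Rightarrow> (edge \<Rightarrow> real) \<Rightarrow> edge set pmf" where
  "rounding n m y = map_pmf (first_wins n m) (Pi_pmf {..<n} m (\<lambda>u. pick m (accept y u)))"

definition fractional :: "nat \<Rightarrow> nat \<Rightarrow> (edge \<Rightarrow> real) \<Rightarrow> bool" where
  "fractional n m y \<longleftrightarrow> (\<forall>e\<in>edges n m. 0 \<le> y e)
     \<and> (\<forall>u<n. (\<Sum>v<m. y (u, v)) \<le> 1) \<and> (\<forall>v<m. (\<Sum>u<n. y (u, v)) \<le> 1)"

context
  fixes n m :: nat and y :: "edge \<Rightarrow> real"
  assumes y: "fractional n m y"
begin

lemma fractional_nonneg: "u < n \<Longrightarrow> v < m \<Longrightarrow> 0 \<le> y (u, v)"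
  using y by (auto simp: fractional_def edges_def)

lemma prefix_col_le:
  assumes "u \<le> n" "v < m"
  shows "(\<Sum>u'<u. y (u', v)) \<le> 1" "0 \<le> (\<Sum>u'<u. y (u', v))"
proof -
  have "(\<Sum>u'<u. y (u', v)) \<le> (\<Sum>u'<n. y (u', v))"
    using assms fractional_nonneg by (intro sum_mono2) auto
  also have "\<dots> \<le> 1" using y assms by (auto simp: fractional_def)
  finally show "(\<Sum>u'<u. y (u', v)) \<le> 1" .
  show "0 \<le> (\<Sum>u'<u. y (u', v))" using assms fractional_nonneg by (intro sum_nonneg) auto
qed

lemma accept_bounds:
  assumes "u < n" "v < m"
  shows "0 \<le> accept y u v" "accept y u v \<le> y (u, v)"
proof -
  have c: "(\<Sum>u'<u. y (u', v)) \<le> 1" using prefix_col_le assms by simp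
  show "0 \<le> accept y u v" unfolding accept_def using c fractional_nonneg[OF assms] by simp
  have "y (u, v) / (2 - (\<Sum>u'<u. y (u', v))) \<le> y (u, v) / 1"
    using c fractional_nonneg[OF assms] by (intro divide_left_mono) auto
  then show "accept y u v \<le> y (u, v)" by (simp add: accept_def)
qed

lemma sum_accept_le: "u < n \<Longrightarrow> (\<Sum>v<m. accept y u v) \<le> 1"
proof -
  assume u: "u < n"
  have "(\<Sum>v<m. accept y u v) \<le> (\<Sum>v<m. y (u, v))" using u accept_bounds by (intro sum_mono) auto
  also have "\<dots> \<le> 1" using y u by (auto simp: fractional_def)
  finally show ?thesis .
qed

lemma pmf_pick_accept:
  "u < n \<Longrightarrow> v < m \<Longrightarrow> pmf (pick m (accept y u)) v = accept y u v"
  "u < n \<Longrightarrow> pmf (pick m (accept y u)) m = 1 - (\<Sum>v<m. accept y u v)"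
  using accept_bounds sum_accept_le by (simp_all add: pmf_pick)

text \<open>This is the probability that no vertex below \<open>u\<close> picks \<open>v\<close>. It
  telescopes: \<open>1 - accept y u v\<close> is the quotient of the denominators belonging to
  \<open>Suc u\<close> and to \<open>u\<close>.\<close>

lemma prod_reject:
  assumes "v < m" "u \<le> n"
  shows "(\<Prod>u'<u. 1 - accept y u' v) = (2 - (\<Sum>u'<u. y (u', v))) / 2"
  using assms(2)
proof (induction u)
  case (Suc u)
  have "(\<Sum>u'<u. y (u', v)) \<le> 1" using prefix_col_le(1)[of u v] Suc assms by simp
  then have "(2 - (\<Sum>u'<u. y (u', v))) / 2 * (1 - accept y u v) = (2 - (\<Sum>u'<Suc u. y (u', v))) / 2"
    by (simp add: accept_def field_simps)
  then show ?case using Suc.IH Suc.prems by (simp only: prod.lessThan_Suc Suc_leD)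
qed simp

lemma prob_rounding_edge:
  assumes "u < n" "v < m"
  shows "measure_pmf.prob (rounding n m y) {M. (u, v) \<in> M} = y (u, v) / 2"
proof -
  let ?p = "\<lambda>u. pick m (accept y u)"
  \<comment> \<open>\<open>(u, v)\<close> is matched iff \<open>u\<close> picks \<open>v\<close> and
    no smaller vertex does, which is a product event.\<close>
  define B where "B u' = (if u' = u then {v} else if u' < u then - {v} else UNIV)" for u'
  have "measure_pmf.prob (rounding n m y) {M. (u, v) \<in> M}
      = measure_pmf.prob (Pi_pmf {..<n} m ?p) {f. (u, v) \<in> first_wins n m f}"
    by (simp add: rounding_def vimage_def)
  also have "{f. (u, v) \<in> first_wins n m f} = Pi {..<n} B"
    using assms by (auto simp: first_wins_def edges_def B_def Pi_def split: if_splits)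
  also have "measure_pmf.prob (Pi_pmf {..<n} m ?p) (Pi {..<n} B)
      = (\<Prod>u'<n. measure_pmf.prob (?p u') (B u'))"
    by (rule measure_Pi_pmf_Pi) auto
  also have "\<dots> = (\<Prod>u'\<in>{..u}. measure_pmf.prob (?p u') (B u'))"
    using assms by (intro prod.mono_neutral_right) (auto simp: B_def)
  also have "\<dots> = (\<Prod>u'<u. measure_pmf.prob (?p u') (B u')) * measure_pmf.prob (?p u) (B u)"
    by (simp add: lessThan_Suc_atMost[symmetric])
  also have "(\<Prod>u'<u. measure_pmf.prob (?p u') (B u')) = (\<Prod>u'<u. 1 - accept y u' v)"
  proof (intro prod.cong refl)
    fix u' assume u': "u' \<in> {..<u}"
    then have "measure_pmf.prob (?p u') (B u') = 1 - measure_pmf.prob (?p u') {v}"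
      using measure_pmf.prob_compl[of "{v}" "?p u'"] by (simp add: B_def Compl_eq_Diff_UNIV)
    then show "measure_pmf.prob (?p u') (B u') = 1 - accept y u' v"
      using u' assms by (simp add: measure_pmf_single pmf_pick_accept)
  qed
  also have "\<dots> = (2 - (\<Sum>u'<u. y (u', v))) / 2" using assms by (intro prod_reject) auto
  also have "measure_pmf.prob (?p u) (B u) = accept y u v"
    using assms by (simp add: B_def measure_pmf_single pmf_pick_accept)
  also have "(2 - (\<Sum>u'<u. y (u', v))) / 2 * accept y u v = y (u, v) / 2"
  proof -
    have "2 - (\<Sum>u'<u. y (u', v)) \<noteq> 0" using prefix_col_le(1)[of u v] assms by simp
    moreover have "k / 2 * (c / k) = c / 2" if "k \<noteq> 0" for k c :: real using that by simp
    ultimately show ?thesis unfolding accept_def by blast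
  qed
  finally show ?thesis .
qed

lemma expectation_rounding:
  "measure_pmf.expectation (rounding n m y) (\<lambda>M. \<Sum>e\<in>M. w e) = (\<Sum>e\<in>edges n m. w e * y e) / 2"
proof -
  have sub: "M \<in> set_pmf (rounding n m y) \<Longrightarrow> M \<in> matchings n m" for M
    by (auto simp: rounding_def first_wins_matching)
  have "measure_pmf.expectation (rounding n m y) (\<lambda>M. \<Sum>e\<in>M. w e)
      = measure_pmf.expectation (rounding n m y) (\<lambda>M. \<Sum>e\<in>edges n m. w e * indicator {M. e \<in> M} M)"
  proof (rule integral_cong_AE)
    show "AE M in measure_pmf (rounding n m y). (\<Sum>e\<in>M. w e) = (\<Sum>e\<in>edges n m. w e * indicator {M. e \<in> M} M)"
    proof (rule AE_pmfI)
      fix M assume "M \<in> set_pmf (rounding n m y)"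
      then have "edges n m \<inter> M = M" using matching_subset[OF sub] by auto
      moreover have "(\<Sum>e\<in>edges n m. w e * indicator {M. e \<in> M} M) = (\<Sum>e\<in>edges n m \<inter> M. w e)"
        unfolding sum.inter_restrict[OF finite_edges]
        by (intro sum.cong) (auto simp: indicator_def)
      ultimately show "(\<Sum>e\<in>M. w e) = (\<Sum>e\<in>edges n m. w e * indicator {M. e \<in> M} M)" by simp
    qed
  qed auto
  also have "\<dots> = (\<Sum>e\<in>edges n m. w e * measure_pmf.prob (rounding n m y) {M. e \<in> M})"
    by (subst Bochner_Integration.integral_sum) (auto simp: measure_pmf.emeasure_eq_measure)
  also have "\<dots> = (\<Sum>e\<in>edges n m. w e * (y e / 2))"
    by (intro sum.cong refl) (auto simp: edges_def prob_rounding_edge)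
  finally show ?thesis by (simp add: sum_divide_distrib)
qed

lemma set_rounding_subset: "set_pmf (rounding n m y) \<subseteq> matchings n m"
  by (auto simp: rounding_def first_wins_matching)

end

lemma divide_difference:
  fixes a b c c' :: real
  assumes "c \<le> 1" "c' \<le> 1"
  shows "a / (2 - c) - b / (2 - c') = (a - b) / (2 - c) + b * ((c - c') / ((2 - c) * (2 - c')))"
proof -
  have "2 - c \<noteq> 0" "2 - c' \<noteq> 0" using assms by auto
  then have "b / (2 - c) - b / (2 - c') = b * ((c - c') / ((2 - c) * (2 - c')))"
    by (simp add: divide_simps) (simp add: algebra_simps)
  then show ?thesis by (simp add: diff_divide_distrib)
qed

text \<open>A change of \<open>y (u, v)\<close> acts directly and through the denominators of later
  vertices. The second effect is weighted by entries of \<open>z\<close> in the same column, which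
  sum to at most \<open>1\<close>, so the distance at most doubles.\<close>

lemma accept_l1_lipschitz:
  assumes y: "fractional n m y" and z: "fractional n m z"
  shows "(\<Sum>u<n. \<Sum>v<m. \<bar>accept y u v - accept z u v\<bar>) \<le> 2 * (\<Sum>e\<in>edges n m. \<bar>y e - z e\<bar>)"
proof -
  let ?d = "\<lambda>u v. \<bar>y (u, v) - z (u, v)\<bar>"
  have "\<bar>accept y u v - accept z u v\<bar> \<le> ?d u v + z (u, v) * (\<Sum>u'<n. ?d u' v)" if "u < n" "v < m" for u v
  proof -
    let ?C = "\<Sum>u'<u. y (u', v)" and ?C' = "\<Sum>u'<u. z (u', v)"
    have C: "?C \<le> 1" "?C' \<le> 1" using prefix_col_le(1)[OF y] prefix_col_le(1)[OF z] that by auto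
    have zz: "0 \<le> z (u, v)" using fractional_nonneg[OF z] that by simp
    have "accept y u v - accept z u v
        = (y (u, v) - z (u, v)) / (2 - ?C) + z (u, v) * ((?C - ?C') / ((2 - ?C) * (2 - ?C')))"
      unfolding accept_def by (rule divide_difference[OF C])
    then have "\<bar>accept y u v - accept z u v\<bar>
        \<le> \<bar>(y (u, v) - z (u, v)) / (2 - ?C)\<bar> + \<bar>z (u, v) * ((?C - ?C') / ((2 - ?C) * (2 - ?C')))\<bar>"
      by (simp only: abs_triangle_ineq)
    also have "\<dots> = ?d u v / (2 - ?C) + z (u, v) * (\<bar>?C - ?C'\<bar> / ((2 - ?C) * (2 - ?C')))"
      using C zz by (simp add: abs_mult abs_divide)
    also have "\<dots> \<le> ?d u v / 1 + z (u, v) * (\<bar>?C - ?C'\<bar> / 1)"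
      using C zz mult_mono[of 1 "2 - ?C" 1 "2 - ?C'"]
      by (intro add_mono mult_left_mono divide_left_mono) auto
    also have "\<bar>?C - ?C'\<bar> / 1 \<le> (\<Sum>u'<n. ?d u' v)"
    proof -
      have "\<bar>?C - ?C'\<bar> \<le> (\<Sum>u'<u. ?d u' v)" unfolding sum_subtractf[symmetric] by (rule sum_abs)
      also have "\<dots> \<le> (\<Sum>u'<n. ?d u' v)" using that by (intro sum_mono2) auto
      finally show ?thesis by simp
    qed
    finally show ?thesis using zz by (simp add: mult_left_mono)
  qed
  then have "(\<Sum>u<n. \<Sum>v<m. \<bar>accept y u v - accept z u v\<bar>)
      \<le> (\<Sum>u<n. \<Sum>v<m. ?d u v + z (u, v) * (\<Sum>u'<n. ?d u' v))"
    by (intro sum_mono) auto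
  also have "\<dots> = (\<Sum>u<n. \<Sum>v<m. ?d u v) + (\<Sum>v<m. \<Sum>u<n. z (u, v) * (\<Sum>u'<n. ?d u' v))"
    by (simp only: sum.distrib) (subst sum.swap[of _ "{..<m}"], simp)
  also have "(\<Sum>v<m. \<Sum>u<n. z (u, v) * (\<Sum>u'<n. ?d u' v)) \<le> (\<Sum>v<m. \<Sum>u'<n. ?d u' v)"
  proof (rule sum_mono)
    fix v assume "v \<in> {..<m}"
    then have "(\<Sum>u<n. z (u, v)) * (\<Sum>u'<n. ?d u' v) \<le> 1 * (\<Sum>u'<n. ?d u' v)"
      using z by (intro mult_right_mono sum_nonneg) (auto simp: fractional_def)
    then show "(\<Sum>u<n. z (u, v) * (\<Sum>u'<n. ?d u' v)) \<le> (\<Sum>u'<n. ?d u' v)"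
      by (simp add: sum_distrib_right)
  qed
  finally show ?thesis
    using sum_edges[of "\<lambda>e. \<bar>y e - z e\<bar>" n m] sum_edges_swap[of "\<lambda>e. \<bar>y e - z e\<bar>" n m] by simp
qed

text \<open>The factor \<open>8\<close> is \<open>2 * 2 * 2\<close>: from
  \<open>EM_u_first_wins_le\<close>, from the compensating change in the probability of picking
  nothing, and from \<open>accept_l1_lipschitz\<close>.\<close>

lemma EM_u_rounding_le:
  assumes y: "fractional n m y" and z: "fractional n m z"
  shows "EM_u (rounding n m y) (rounding n m z) \<le> ennreal (8 * (\<Sum>e\<in>edges n m. \<bar>y e - z e\<bar>))"
proof -
  let ?p = "\<lambda>y u. pick m (accept y u)"
  have "EM_u (rounding n m y) (rounding n m z)
      \<le> ennreal (2 * (\<Sum>u<n. \<Sum>v\<le>m. \<bar>pmf (?p y u) v - pmf (?p z u) v\<bar>))"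
    unfolding rounding_def
    using accept_bounds(1)[OF y] sum_accept_le[OF y] accept_bounds(1)[OF z] sum_accept_le[OF z]
    by (intro EM_u_first_wins_le set_pick_subset) auto
  also have "\<dots> \<le> ennreal (8 * (\<Sum>e\<in>edges n m. \<bar>y e - z e\<bar>))"
  proof (rule ennreal_leI)
    have "(\<Sum>v\<le>m. \<bar>pmf (?p y u) v - pmf (?p z u) v\<bar>) \<le> 2 * (\<Sum>v<m. \<bar>accept y u v - accept z u v\<bar>)"
      if u: "u < n" for u
    proof -
      have "(\<Sum>v\<le>m. \<bar>pmf (?p y u) v - pmf (?p z u) v\<bar>)
          = (\<Sum>v<m. \<bar>accept y u v - accept z u v\<bar>) + \<bar>(\<Sum>v<m. accept z u v) - (\<Sum>v<m. accept y u v)\<bar>"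
        using u by (simp add: lessThan_Suc_atMost[symmetric] pmf_pick_accept[OF y] pmf_pick_accept[OF z])
      also have "\<bar>(\<Sum>v<m. accept z u v) - (\<Sum>v<m. accept y u v)\<bar> \<le> (\<Sum>v<m. \<bar>accept y u v - accept z u v\<bar>)"
        unfolding sum_subtractf[symmetric] abs_minus_commute[of "accept y u _"] by (rule sum_abs)
      finally show ?thesis by simp
    qed
    then have "(\<Sum>u<n. \<Sum>v\<le>m. \<bar>pmf (?p y u) v - pmf (?p z u) v\<bar>)
        \<le> 2 * (\<Sum>u<n. \<Sum>v<m. \<bar>accept y u v - accept z u v\<bar>)"
      unfolding sum_distrib_left by (intro sum_mono) auto
    then show "2 * (\<Sum>u<n. \<Sum>v\<le>m. \<bar>pmf (?p y u) v - pmf (?p z u) v\<bar>) \<le> 8 * (\<Sum>e\<in>edges n m. \<bar>y e - z e\<bar>)"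
      using accept_l1_lipschitz[OF y z] by linarith
  qed
  finally show ?thesis .
qed

section \<open>Timed program verification\<close>

lemma upd_apply: "upd f a i j v b k l = (if a = b \<and> i = k \<and> j = l then v else f b k l)"
  by (simp add: upd_def)

lemma upd_other [simp]: "a \<noteq> b \<Longrightarrow> upd f a i j v b = f b"
  by (simp add: upd_def)

text \<open>Total correctness with a time bound, for a fixed tape. As \<open>Skip\<close> is a fixed
  point of \<open>step\<close>, overestimating the time is harmless.\<close>

definition hoare :: "(nat \<Rightarrow> real) \<Rightarrow> (state \<Rightarrow> bool) \<Rightarrow> com \<Rightarrow> nat \<Rightarrow> (state \<Rightarrow> bool) \<Rightarrow> bool" where
  "hoare \<omega> P c T Q \<longleftrightarrow> (\<forall>s. P s \<longrightarrow> (\<exists>t\<le>T. \<exists>s'. (step \<omega> ^^ t) (c, s) = (Skip, s') \<and> Q s'))"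

lemma steps_Skip: "(step \<omega> ^^ t) (Skip, s) = (Skip, s)"
  by (induction t) auto

lemma steps_Skip_mono:
  assumes "(step \<omega> ^^ t) (c, s) = (Skip, s')" "t \<le> t'"
  shows "(step \<omega> ^^ t') (c, s) = (Skip, s')"
proof -
  have "(step \<omega> ^^ t') (c, s) = (step \<omega> ^^ (t' - t)) ((step \<omega> ^^ t) (c, s))"
    using assms(2) by (simp add: funpow_add[symmetric, THEN fun_cong, unfolded o_apply])
  then show ?thesis by (simp add: assms(1) steps_Skip)
qed

lemma steps_Seq_before:
  assumes "\<And>k. k < t \<Longrightarrow> fst ((step \<omega> ^^ k) (c, s)) \<noteq> Skip"
  shows "(step \<omega> ^^ t) (Seq c d, s) = (Seq (fst ((step \<omega> ^^ t) (c, s))) d, snd ((step \<omega> ^^ t) (c, s)))"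
  using assms
proof (induction t)
  case (Suc t)
  obtain c' s' where cs: "(step \<omega> ^^ t) (c, s) = (c', s')" by fastforce
  then have "c' \<noteq> Skip" using Suc.prems[of t] by simp
  moreover have "(step \<omega> ^^ t) (Seq c d, s) = (Seq c' d, s')" using Suc cs by simp
  ultimately show ?case using cs by (simp split: prod.split)
qed simp

text \<open>A sequence leaves its first component as soon as that is \<open>Skip\<close>, possibly
  before step \<open>t\<close>. Hence the least halting time, and one extra step to discard
  \<open>Skip\<close>.\<close>

lemma steps_Seq:
  assumes "(step \<omega> ^^ t) (c, s) = (Skip, s')"
  shows "\<exists>t'\<le>Suc t. (step \<omega> ^^ t') (Seq c d, s) = (d, s')"
proof -
  define t0 where "t0 = (LEAST k. fst ((step \<omega> ^^ k) (c, s)) = Skip)"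
  have ex: "fst ((step \<omega> ^^ t) (c, s)) = Skip" using assms by simp
  have t0: "fst ((step \<omega> ^^ t0) (c, s)) = Skip" "t0 \<le> t"
    unfolding t0_def using ex by (auto intro: LeastI Least_le)
  have before: "\<And>k. k < t0 \<Longrightarrow> fst ((step \<omega> ^^ k) (c, s)) \<noteq> Skip"
    unfolding t0_def by (rule not_less_Least)
  obtain s0 where s0: "(step \<omega> ^^ t0) (c, s) = (Skip, s0)" using t0 by (metis prod.collapse)
  then have "s0 = s'" using steps_Skip_mono[OF s0 t0(2)] assms by simp
  have "(step \<omega> ^^ Suc t0) (Seq c d, s) = (d, s')"
    using steps_Seq_before[OF before, where d = d] s0 \<open>s0 = s'\<close> by simp
  then show ?thesis using t0 by (intro exI[of _ "Suc t0"]) auto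
qed

lemma hoare_weaken:
  assumes "hoare \<omega> P c T Q" "\<And>s. P' s \<Longrightarrow> P s" "\<And>s. Q s \<Longrightarrow> Q' s" "T \<le> T'"
  shows "hoare \<omega> P' c T' Q'"
  using assms unfolding hoare_def by (meson order_trans)

lemma hoare_Seq:
  assumes "hoare \<omega> P c T R" "hoare \<omega> R d T' Q"
  shows "hoare \<omega> P (Seq c d) (T + T' + 1) Q"
  unfolding hoare_def
proof (intro allI impI)
  fix s assume "P s"
  then obtain t s' where t: "t \<le> T" "(step \<omega> ^^ t) (c, s) = (Skip, s')" "R s'"
    using assms(1) unfolding hoare_def by blast
  obtain t1 where t1: "t1 \<le> Suc t" "(step \<omega> ^^ t1) (Seq c d, s) = (d, s')"
    using steps_Seq[OF t(2)] by blast
  obtain t2 s'' where t2: "t2 \<le> T'" "(step \<omega> ^^ t2) (d, s') = (Skip, s'')" "Q s''"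
    using assms(2) t(3) unfolding hoare_def by blast
  have "(step \<omega> ^^ (t2 + t1)) (Seq c d, s) = (Skip, s'')"
    unfolding funpow_add o_apply t1(2) by (rule t2(2))
  then show "\<exists>t\<le>T + T' + 1. \<exists>s'. (step \<omega> ^^ t) (Seq c d, s) = (Skip, s') \<and> Q s'"
    using t(1) t1(1) t2(1,3) by (intro exI[of _ "t2 + t1"]) auto
qed

text \<open>Besides the body, a round takes one step to unfold the loop and one to discard
  \<open>Skip\<close>; the final \<open>1\<close> is the failing test.\<close>

lemma hoare_While:
  assumes body: "\<And>k. k < N \<Longrightarrow> hoare \<omega> (I k) c T (I (Suc k))"
    and continue: "\<And>k s. k < N \<Longrightarrow> I k s \<Longrightarrow> bval b s" and stop: "\<And>s. I N s \<Longrightarrow> \<not> bval b s"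
  shows "hoare \<omega> (I 0) (While b c) (N * (T + 2) + 1) (I N)"
proof -
  have "\<exists>t\<le>(N - k) * (T + 2) + 1. \<exists>s'. (step \<omega> ^^ t) (While b c, s) = (Skip, s') \<and> I N s'"
    if "k \<le> N" "I k s" for k s
    using that
  proof (induction "N - k" arbitrary: k s)
    case 0
    then have "k = N" by simp
    then have "(step \<omega> ^^ 1) (While b c, s) = (Skip, s) \<and> I N s" using 0 stop by simp
    then show ?case by (intro exI[of _ 1]) auto
  next
    case (Suc j)
    then have k: "k < N" by simp
    obtain t s' where t: "t \<le> T" "(step \<omega> ^^ t) (c, s) = (Skip, s')" "I (Suc k) s'"
      using body[OF k] Suc.prems unfolding hoare_def by blast
    obtain t1 where t1: "t1 \<le> Suc t" "(step \<omega> ^^ t1) (Seq c (While b c), s) = (While b c, s')"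
      using steps_Seq[OF t(2)] by blast
    obtain t2 s'' where t2: "t2 \<le> (N - Suc k) * (T + 2) + 1"
      "(step \<omega> ^^ t2) (While b c, s') = (Skip, s'')" "I N s''"
      using Suc.hyps(1)[of "Suc k" s', OF _ _ t(3)] Suc.hyps(2) k by (metis Suc_diff_Suc Suc_inject Suc_leI)
    have "step \<omega> (While b c, s) = (Seq c (While b c), s)" using continue[OF k] Suc.prems by simp
    then have "(step \<omega> ^^ (t2 + (t1 + 1))) (While b c, s) = (Skip, s'')"
      unfolding funpow_add o_apply by (simp add: t1(2) t2(2))
    moreover have "t2 + (t1 + 1) \<le> (N - k) * (T + 2) + 1"
    proof -
      have "N - k = Suc (N - Suc k)" using k by simp
      then show ?thesis using t(1) t1(1) t2(1) by simp
    qed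
    ultimately show ?case using t2(3) by blast
  qed
  from this[of 0] show ?thesis unfolding hoare_def by simp
qed

section \<open>Loop-free commands and counting loops\<close>

fun straight :: "com \<Rightarrow> bool" where
  "straight (Seq c d) \<longleftrightarrow> straight c \<and> straight d"
| "straight (Cond b c d) \<longleftrightarrow> straight c \<and> straight d"
| "straight (While b c) \<longleftrightarrow> False"
| "straight _ \<longleftrightarrow> True"

text \<open>Loop-free code is evaluated in one go, so that its correctness becomes a matter of
  simplification.\<close>

fun exec :: "(nat \<Rightarrow> real) \<Rightarrow> com \<Rightarrow> state \<Rightarrow> state" where
  "exec \<omega> (Seq c d) s = exec \<omega> d (exec \<omega> c s)"
| "exec \<omega> (Cond b c d) s = (if bval b s then exec \<omega> c s else exec \<omega> d s)"
| "exec \<omega> c s = snd (step \<omega> (c, s))"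

fun cost :: "com \<Rightarrow> nat" where
  "cost (Seq c d) = cost c + cost d + 1"
| "cost (Cond b c d) = max (cost c) (cost d) + 1"
| "cost _ = 1"

lemma steps_straight: "straight c \<Longrightarrow> \<exists>t\<le>cost c. (step \<omega> ^^ t) (c, s) = (Skip, exec \<omega> c s)"
proof (induction c arbitrary: s)
  case (Seq c d)
  obtain t where t: "t \<le> cost c" "(step \<omega> ^^ t) (c, s) = (Skip, exec \<omega> c s)" using Seq by fastforce
  obtain t1 where t1: "t1 \<le> Suc t" "(step \<omega> ^^ t1) (Seq c d, s) = (d, exec \<omega> c s)"
    using steps_Seq[OF t(2)] by blast
  obtain t2 where t2: "t2 \<le> cost d" "(step \<omega> ^^ t2) (d, exec \<omega> c s) = (Skip, exec \<omega> d (exec \<omega> c s))"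
    using Seq by fastforce
  have "(step \<omega> ^^ (t2 + t1)) (Seq c d, s) = (Skip, exec \<omega> (Seq c d) s)"
    unfolding funpow_add o_apply t1(2) by (simp add: t2(2))
  then show ?case using t t1 t2 by (intro exI[of _ "t2 + t1"]) auto
next
  case (Cond b c d)
  obtain t1 where t1: "t1 \<le> cost c" "(step \<omega> ^^ t1) (c, s) = (Skip, exec \<omega> c s)"
    using Cond.IH(1)[of s] Cond.prems by auto
  obtain t2 where t2: "t2 \<le> cost d" "(step \<omega> ^^ t2) (d, s) = (Skip, exec \<omega> d s)"
    using Cond.IH(2)[of s] Cond.prems by auto
  let ?t = "if bval b s then t1 else t2"
  have "(step \<omega> ^^ Suc ?t) (Cond b c d, s) = (Skip, exec \<omega> (Cond b c d) s)"
    using t1 t2 by (auto simp: funpow_Suc_right simp del: funpow.simps)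
  then show ?case using t1 t2 by (intro exI[of _ "Suc ?t"]) auto
qed (auto intro!: exI[of _ 1])

lemma hoare_straight:
  assumes "straight c" "\<And>s. P s \<Longrightarrow> Q (exec \<omega> c s)" "cost c \<le> T"
  shows "hoare \<omega> P c T Q"
  unfolding hoare_def using steps_straight[OF assms(1), of \<omega>] assms(2,3)
  by (blast intro: order_trans)

abbreviation NVar :: "nat \<Rightarrow> nexp" where "NVar a \<equiv> NArr a (NConst 0) (NConst 0)"
abbreviation RVar :: "nat \<Rightarrow> rexp" where "RVar a \<equiv> RArr a (NConst 0) (NConst 0)"
abbreviation NSet :: "nat \<Rightarrow> nexp \<Rightarrow> com" where "NSet a x \<equiv> NAssign a (NConst 0) (NConst 0) x"
abbreviation RSet :: "nat \<Rightarrow> rexp \<Rightarrow> com" where "RSet a x \<equiv> RAssign a (NConst 0) (NConst 0) x"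

definition For :: "nat \<Rightarrow> nexp \<Rightarrow> com \<Rightarrow> com" where
  "For a b c = Seq (NSet a (NConst 0)) (While (NLess (NVar a) b) (Seq c (NSet a (NAdd (NVar a) (NConst 1)))))"

abbreviation counter_update :: "nat \<Rightarrow> nat \<Rightarrow> state \<Rightarrow> state" where
  "counter_update a j s \<equiv> s\<lparr>nmem := upd (nmem s) a 0 0 j\<rparr>"

text \<open>\<open>frame\<close> says that the invariant does not depend on the counter cell, so
  that resetting and incrementing the counter preserve it.\<close>

lemma hoare_For:
  assumes body: "\<And>k. k < N \<Longrightarrow> hoare \<omega> (\<lambda>s. I k s \<and> nmem s a 0 0 = k) c T (\<lambda>s. I (Suc k) s \<and> nmem s a 0 0 = k)"
    and frame: "\<And>k j s. I k s \<Longrightarrow> I k (counter_update a j s)"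
    and bound: "\<And>k s. I k s \<Longrightarrow> nval b s = N"
  shows "hoare \<omega> (I 0) (For a b c) (N * (T + 4) + 3) (I N)"
proof -
  let ?J = "\<lambda>k s. I k s \<and> nmem s a 0 0 = k"
  have "hoare \<omega> (I 0) (NSet a (NConst 0)) 1 (?J 0)"
    by (rule hoare_straight) (auto simp: frame, simp add: upd_def)
  moreover have "hoare \<omega> (?J 0) (While (NLess (NVar a) b) (Seq c (NSet a (NAdd (NVar a) (NConst 1)))))
      (N * ((T + 1 + 1) + 2) + 1) (?J N)"
  proof (rule hoare_While)
    fix k assume k: "k < N"
    have "hoare \<omega> (\<lambda>s. I (Suc k) s \<and> nmem s a 0 0 = k) (NSet a (NAdd (NVar a) (NConst 1))) 1 (?J (Suc k))"
      by (rule hoare_straight) (auto simp: frame, simp add: upd_def)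
    then show "hoare \<omega> (?J k) (Seq c (NSet a (NAdd (NVar a) (NConst 1)))) (T + 1 + 1) (?J (Suc k))"
      by (rule hoare_Seq[OF body[OF k]])
  qed (auto simp: bound)
  ultimately have "hoare \<omega> (I 0) (For a b c) (1 + (N * ((T + 1 + 1) + 2) + 1) + 1) (?J N)"
    unfolding For_def by (rule hoare_Seq)
  then show ?thesis by (rule hoare_weaken) (auto simp: algebra_simps)
qed

definition before :: "nat \<Rightarrow> nat \<Rightarrow> nat \<Rightarrow> nat \<Rightarrow> edge set" where
  "before n m u v = {(i, j) \<in> edges n m. i < u \<or> i = u \<and> j < v}"

lemma before_simps:
  "before n m 0 0 = {}" "before n m n 0 = edges n m" "before n m (Suc u) 0 = before n m u m"
  "u < n \<Longrightarrow> v < m \<Longrightarrow> before n m u (Suc v) = insert (u, v) (before n m u v)"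
  "(u, v) \<notin> before n m u v"
  by (auto simp: before_def edges_def less_Suc_eq)

lemma finite_before [simp]: "finite (before n m u v)"
  by (rule finite_subset[of _ "edges n m"]) (auto simp: before_def)

abbreviation NN :: nexp where "NN \<equiv> NArr 0 (NConst 0) (NConst 0)"
abbreviation MM :: nexp where "MM \<equiv> NArr 0 (NConst 0) (NConst 1)"

definition For2 :: "com \<Rightarrow> com" where "For2 c = For 3 NN (For 4 MM c)"

text \<open>Indexing the invariant by the set of processed edges lets it speak of maxima and sums
  over that set, without reference to the loop order.\<close>

lemma hoare_For2:
  assumes body: "\<And>u v. u < n \<Longrightarrow> v < m \<Longrightarrow>
      hoare \<omega> (\<lambda>s. I (before n m u v) s \<and> nmem s 3 0 0 = u \<and> nmem s 4 0 0 = v) c T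
        (\<lambda>s. I (insert (u, v) (before n m u v)) s \<and> nmem s 3 0 0 = u \<and> nmem s 4 0 0 = v)"
    and frame: "\<And>S j s. I S s \<Longrightarrow> I S (counter_update 3 j s)" "\<And>S j s. I S s \<Longrightarrow> I S (counter_update 4 j s)"
    and size: "\<And>S s. I S s \<Longrightarrow> nmem s 0 0 0 = n" "\<And>S s. I S s \<Longrightarrow> nmem s 0 0 1 = m"
  shows "hoare \<omega> (I {}) (For2 c) (n * ((m * (T + 4) + 3) + 4) + 3) (I (edges n m))"
proof -
  have "hoare \<omega> (I (before n m 0 0)) (For 3 NN (For 4 MM c)) (n * ((m * (T + 4) + 3) + 4) + 3) (I (before n m n 0))"
  proof (rule hoare_For[where I = "\<lambda>u. I (before n m u 0)"])
    fix u assume u: "u < n"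
    have "hoare \<omega> (\<lambda>s. I (before n m u 0) s \<and> nmem s 3 0 0 = u) (For 4 MM c) (m * (T + 4) + 3)
        (\<lambda>s. I (before n m u m) s \<and> nmem s 3 0 0 = u)"
    proof (rule hoare_For[where I = "\<lambda>v s. I (before n m u v) s \<and> nmem s 3 0 0 = u"])
      fix v assume v: "v < m"
      show "hoare \<omega> (\<lambda>s. (I (before n m u v) s \<and> nmem s 3 0 0 = u) \<and> nmem s 4 0 0 = v) c T
          (\<lambda>s. (I (before n m u (Suc v)) s \<and> nmem s 3 0 0 = u) \<and> nmem s 4 0 0 = v)"
        unfolding before_simps(4)[OF u v] conj_assoc by (rule body[OF u v])
    qed (use size(2) in \<open>auto simp: frame\<close>)
    then show "hoare \<omega> (\<lambda>s. I (before n m u 0) s \<and> nmem s 3 0 0 = u) (For 4 MM c) (m * (T + 4) + 3)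
        (\<lambda>s. I (before n m (Suc u) 0) s \<and> nmem s 3 0 0 = u)"
      by (simp only: before_simps(3))
  qed (use size(1) in \<open>auto simp: frame\<close>)
  then show ?thesis unfolding For2_def before_simps .
qed

section \<open>The program\<close>

text \<open>
  Arrays of reals: 0 weights, 1 iterate, 2 row sums, 3 column sums, 4 prefix column sums of the
  fractional matching.  The following ones are scalars, kept in cell \<open>(0, 0)\<close>: 5 largest weight,
  6 \<open>H\<close>, 7 iteration counter, 8 scalar product of scaled weights and iterate, 9 accumulator for
  \<open>ent\<close>, 10-14 positive parts, 15 current sample, 16 cumulative and 17 current acceptance probability.
  Arrays of naturals: 0 input, 1 output, 2 marks of the right vertices already picked, 3-5 loop counters.
\<close>

abbreviation CU :: nexp where "CU \<equiv> NVar 3"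
abbreviation CV :: nexp where "CV \<equiv> NVar 4"
abbreviation CK :: nexp where "CK \<equiv> NVar 5"
abbreviation w_at :: rexp where "w_at \<equiv> RArr 0 CU CV"
abbreviation x_at :: rexp where "x_at \<equiv> RArr 1 CU CV"
abbreviation row_at :: rexp where "row_at \<equiv> RArr 2 CU (NConst 0)"
abbreviation col_at :: rexp where "col_at \<equiv> RArr 3 CV (NConst 0)"
abbreviation prefix_at :: rexp where "prefix_at \<equiv> RArr 4 CV (NConst 0)"

primrec rpow :: "rexp \<Rightarrow> nat \<Rightarrow> rexp" where
  "rpow x 0 = RConst 1"
| "rpow x (Suc k) = RMul x (rpow x k)"

lemma rval_rpow [simp]: "rval (rpow x k) s = rval x s ^ k"
  by (induction k) auto

definition X_exp :: "nat \<Rightarrow> rexp" where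
  "X_exp E = RMul (RConst (of_nat E)) (ROfNat (NAdd (NAdd NN MM) (NConst 2)))"

definition Pos :: "nat \<Rightarrow> rexp \<Rightarrow> com" where
  "Pos a x = Cond (RLess (RConst 0) x) (RSet a x) (RSet a (RConst 0))"

lemma straight_Pos [simp]: "straight (Pos a x)"
  by (simp add: Pos_def)

lemma exec_Pos [simp]: "exec \<omega> (Pos a x) s = s\<lparr>rmem := upd (rmem s) a 0 0 (max (rval x s) 0)\<rparr>"
  by (simp add: Pos_def max_def)

definition max_prog :: com where
  "max_prog = For2 (Cond (RLess (RVar 5) w_at) (RSet 5 w_at) Skip)"

definition harm_prog :: com where
  "harm_prog = Seq (RSet 6 (RConst 2))
     (For 5 MM (RSet 6 (RAdd (RVar 6) (RDiv (RConst 1) (ROfNat (NAdd CK (NConst 1)))))))"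

definition sums_body :: com where
  "sums_body = Seq (RAssign 2 CU (NConst 0) (RAdd row_at x_at))
     (Seq (RAssign 3 CV (NConst 0) (RAdd col_at x_at))
       (RSet 8 (RAdd (RVar 8) (RMul (RDiv w_at (RVar 5)) x_at))))"

definition sums_prog :: com where
  "sums_prog = Seq (RSet 8 (RConst 0))
     (Seq (For 3 NN (RAssign 2 CU (NConst 0) (RConst 0)))
       (Seq (For 4 MM (RAssign 3 CV (NConst 0) (RConst 0))) (For2 sums_body)))"

definition theta_exp :: "nat \<Rightarrow> rexp" where
  "theta_exp a = RDiv (RMul (RVar a) (RVar a)) (RAdd (RConst 1) (RVar a))"

definition step_exp :: "nat \<Rightarrow> rexp" where
  "step_exp E = RSub x_at (RMul (RDiv (RConst 1) (rpow (X_exp E) 14))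
     (RSub
       (RAdd
         (RMul (RDiv (RConst 1) (RMul (RMul (RConst (of_nat E)) (ROfNat (NAdd NN (NConst 1)))) (RVar 6))) (RVar 9))
         (RMul (RMul (RConst 4) (rpow (X_exp E) 3))
           (RSub (RAdd (theta_exp 11) (theta_exp 12)) (theta_exp 13))))
       (RMul (RDiv w_at (RVar 5))
         (RSub (RConst 1) (RDiv (RVar 8) (RAdd (RConst 1) (RVar 14)))))))"

definition ent_body :: com where
  "ent_body = RSet 9 (RAdd (RVar 9) (RDiv x_at (RAdd (RConst 1) (RMul (ROfNat CK) (RVar 10)))))"

definition step_tail :: "nat \<Rightarrow> com" where
  "step_tail E = Seq (Pos 11 (RSub row_at (RConst 1))) (Seq (Pos 12 (RSub col_at (RConst 1)))
     (Seq (Pos 13 (RSub (RConst 0) x_at)) (Seq (Pos 14 (RVar 8)) (RAssign 1 CU CV (step_exp E)))))"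

definition step_body :: "nat \<Rightarrow> com" where
  "step_body E = Seq (Seq (Pos 10 x_at) (RSet 9 (RConst 0)))
     (Seq (For 5 (NAdd MM (NConst 1)) ent_body) (step_tail E))"

text \<open>The counter is a real number: natural numbers have no multiplication, whereas
  \<open>X ^ 60\<close> is a fixed real expression in \<open>n\<close> and \<open>m\<close>.\<close>

definition iter_prog :: "nat \<Rightarrow> com" where
  "iter_prog E = While (RLess (RVar 7) (rpow (X_exp E) 60))
     (Seq (Seq sums_prog (For2 (step_body E))) (RSet 7 (RAdd (RVar 7) (RConst 1))))"

definition frac_exp :: "nat \<Rightarrow> rexp" where
  "frac_exp E = RDiv (RVar 10) (RAdd (RConst 1) (RDiv (RConst 1) (RConst (of_nat E))))"

text \<open>Inverse transform sampling: \<open>v\<close> is picked if the sample lies in the next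
  half-open interval, whose length is the acceptance probability. The mark of \<open>v\<close> gives
  priority to smaller left vertices.\<close>

definition round_body :: "nat \<Rightarrow> com" where
  "round_body E = Seq (Pos 10 x_at)
     (Seq (RSet 17 (RDiv (frac_exp E) (RSub (RConst 2) prefix_at)))
     (Seq (Cond (BAnd (BNot (RLess (RVar 15) (RVar 16)))
              (BAnd (RLess (RVar 15) (RAdd (RVar 16) (RVar 17)))
                (NLess (NArr 2 CV (NConst 0)) (NConst 1))))
            (Seq (NAssign 1 CU CV (NConst 1)) (NAssign 2 CV (NConst 0) (NConst 1))) Skip)
     (Seq (RSet 16 (RAdd (RVar 16) (RVar 17)))
       (RAssign 4 CV (NConst 0) (RAdd prefix_at (frac_exp E))))))"

definition round_prog :: "nat \<Rightarrow> com" where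
  "round_prog E = For 3 NN (Seq (Seq (Sample 15 (NConst 0) (NConst 0)) (RSet 16 (RConst 0)))
     (For 4 MM (round_body E)))"

definition prog :: "nat \<Rightarrow> com" where
  "prog E = Seq max_prog (Seq harm_prog (Seq (iter_prog E) (round_prog E)))"

section \<open>Correctness of the iteration phase\<close>

context size_params
begin

context
  fixes w :: "edge \<Rightarrow> real" and \<omega> :: "nat \<Rightarrow> real"
begin

text \<open>What the phases before rounding leave untouched: rounding relies on output, marks and
  prefix sums being zero and on no sample having been consumed.\<close>

definition base :: "state \<Rightarrow> bool" where
  "base s \<longleftrightarrow> nmem s 0 0 0 = n \<and> nmem s 0 0 (Suc 0) = m \<and> (\<forall>i j. rmem s 0 i j = w (i, j))
     \<and> (\<forall>i j. nmem s (Suc 0) i j = 0) \<and> (\<forall>i j. nmem s 2 i j = 0) \<and> (\<forall>i j. rmem s 4 i j = 0) \<and> tpos s = 0"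

definition start :: "state \<Rightarrow> bool" where
  "start s \<longleftrightarrow> base s \<and> (\<forall>i j. rmem s (Suc 0) i j = 0) \<and> rmem s 7 0 0 = 0"

definition holds :: "nat \<Rightarrow> (edge \<Rightarrow> real) \<Rightarrow> state \<Rightarrow> bool" where
  "holds k x s \<longleftrightarrow> base s \<and> rmem s 5 0 0 = wmax n m w \<and> rmem s 6 0 0 = H \<and> rmem s 7 0 0 = real k
     \<and> (\<forall>i<n. \<forall>j<m. rmem s (Suc 0) i j = x (i, j))"

lemma start_init: "start (init n m w) \<and> rmem (init n m w) 5 0 0 = 0"
  by (simp add: start_def base_def init_def upd_apply)

lemma hoare_max_prog:
  "hoare \<omega> (\<lambda>s. start s \<and> rmem s 5 0 0 = 0) max_prog (n * ((m * (2 + 4) + 3) + 4) + 3)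
     (\<lambda>s. start s \<and> rmem s 5 0 0 = wmax n m w)"
proof -
  let ?I = "\<lambda>S s. start s \<and> rmem s 5 0 0 = Max (insert 0 (w ` S))"
  have "hoare \<omega> (?I {}) max_prog (n * ((m * (2 + 4) + 3) + 4) + 3) (?I (edges n m))"
    unfolding max_prog_def
  proof (rule hoare_For2)
    fix u v
    show "hoare \<omega> (\<lambda>s. ?I (before n m u v) s \<and> nmem s 3 0 0 = u \<and> nmem s 4 0 0 = v)
        (Cond (RLess (RVar 5) w_at) (RSet 5 w_at) Skip) 2
        (\<lambda>s. ?I (insert (u, v) (before n m u v)) s \<and> nmem s 3 0 0 = u \<and> nmem s 4 0 0 = v)"
    proof (rule hoare_straight)
      fix s assume s: "?I (before n m u v) s \<and> nmem s 3 0 0 = u \<and> nmem s 4 0 0 = v"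
      define mx where "mx = Max (insert 0 (w ` before n m u v))"
      have new: "Max (insert 0 (w ` insert (u, v) (before n m u v))) = max (w (u, v)) mx"
        unfolding mx_def by (subst image_insert, subst insert_commute, subst Max_insert) auto
      show "?I (insert (u, v) (before n m u v)) (exec \<omega> (Cond (RLess (RVar 5) w_at) (RSet 5 w_at) Skip) s)
          \<and> nmem (exec \<omega> (Cond (RLess (RVar 5) w_at) (RSet 5 w_at) Skip) s) 3 0 0 = u
          \<and> nmem (exec \<omega> (Cond (RLess (RVar 5) w_at) (RSet 5 w_at) Skip) s) 4 0 0 = v"
        using s[folded mx_def] unfolding new by (auto simp: start_def base_def upd_apply)
    qed auto
  qed (auto simp: start_def base_def)
  then show ?thesis by (simp add: wmax_def)
qed

lemma hoare_harm_prog: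
  "hoare \<omega> (\<lambda>s. start s \<and> rmem s 5 0 0 = wmax n m w) harm_prog (1 + (m * (1 + 4) + 3) + 1) (holds 0 (\<lambda>e. 0))"
proof -
  let ?I = "\<lambda>k s. start s \<and> rmem s 5 0 0 = wmax n m w \<and> rmem s 6 0 0 = 2 + (\<Sum>i<k. 1 / real (Suc i))"
  have "hoare \<omega> (\<lambda>s. start s \<and> rmem s 5 0 0 = wmax n m w) (RSet 6 (RConst 2)) 1 (?I 0)"
    by (rule hoare_straight) (auto simp: start_def base_def upd_apply)
  moreover have "hoare \<omega> (?I 0) (For 5 MM (RSet 6 (RAdd (RVar 6) (RDiv (RConst 1) (ROfNat (NAdd CK (NConst 1)))))))
      (m * (1 + 4) + 3) (?I m)"
    by (rule hoare_For, rule hoare_straight) (auto simp: start_def base_def upd_apply)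
  ultimately have "hoare \<omega> (\<lambda>s. start s \<and> rmem s 5 0 0 = wmax n m w) harm_prog
      (1 + (m * (1 + 4) + 3) + 1) (?I m)"
    unfolding harm_prog_def by (rule hoare_Seq)
  then show ?thesis by (rule hoare_weaken) (auto simp: holds_def start_def H_def)
qed

text \<open>The iterate is overwritten in place: \<open>z\<close> is the current array content,
  while the sums and the scalar product still belong to the old iterate \<open>x\<close>. The effect
  is a simultaneous update of all entries.\<close>

definition summed :: "nat \<Rightarrow> (edge \<Rightarrow> real) \<Rightarrow> (edge \<Rightarrow> real) \<Rightarrow> state \<Rightarrow> bool" where
  "summed k x z s \<longleftrightarrow> holds k z s \<and> rmem s 8 0 0 = ip (scaled n m w) x
     \<and> (\<forall>i<n. rmem s 2 i 0 = row x i) \<and> (\<forall>j<m. rmem s 3 j 0 = col x j)"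

lemma row_eq_sum: "i < n \<Longrightarrow> (\<Sum>e\<in>edges n m. if fst e = i then x e else 0) = row x i"
proof -
  assume "i < n"
  then have "(\<Sum>u<n. \<Sum>v<m. if u = i then x (u, v) else 0) = (\<Sum>u\<in>{i}. \<Sum>v<m. if u = i then x (u, v) else 0)"
    by (intro sum.mono_neutral_right) auto
  then show ?thesis by (simp add: sum_edges row_def)
qed

lemma col_eq_sum: "j < m \<Longrightarrow> (\<Sum>e\<in>edges n m. if snd e = j then x e else 0) = col x j"
proof -
  assume "j < m"
  then have "(\<Sum>v<m. \<Sum>u<n. if v = j then x (u, v) else 0) = (\<Sum>v\<in>{j}. \<Sum>u<n. if v = j then x (u, v) else 0)"
    by (intro sum.mono_neutral_right) auto
  then show ?thesis by (simp add: sum_edges_swap col_def)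
qed

definition sums_time :: nat where
  "sums_time = 1 + ((n * (1 + 4) + 3) + ((m * (1 + 4) + 3) + (n * ((m * (5 + 4) + 3) + 4) + 3) + 1) + 1) + 1"

lemma hoare_sums_prog: "hoare \<omega> (holds k x) sums_prog sums_time (summed k x x)"
proof -
  let ?Z = "\<lambda>s. holds k x s \<and> rmem s 8 0 0 = 0"
  let ?A = "\<lambda>u s. ?Z s \<and> (\<forall>i<u. rmem s 2 i 0 = 0)"
  let ?B = "\<lambda>v s. ?A n s \<and> (\<forall>j<v. rmem s 3 j 0 = 0)"
  let ?I = "\<lambda>S s. holds k x s \<and> rmem s 8 0 0 = (\<Sum>e\<in>S. scaled n m w e * x e)
      \<and> (\<forall>i<n. rmem s 2 i 0 = (\<Sum>e\<in>S. if fst e = i then x e else 0))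
      \<and> (\<forall>j<m. rmem s 3 j 0 = (\<Sum>e\<in>S. if snd e = j then x e else 0))"
  have 1: "hoare \<omega> (holds k x) (RSet 8 (RConst 0)) 1 (?A 0)"
    by (rule hoare_straight) (auto simp: holds_def base_def upd_apply)
  have 2: "hoare \<omega> (?A 0) (For 3 NN (RAssign 2 CU (NConst 0) (RConst 0))) (n * (1 + 4) + 3) (?A n)"
    by (rule hoare_For, rule hoare_straight) (auto simp: holds_def base_def upd_apply less_Suc_eq)
  have 3: "hoare \<omega> (?B 0) (For 4 MM (RAssign 3 CV (NConst 0) (RConst 0))) (m * (1 + 4) + 3) (?B m)"
    by (rule hoare_For, rule hoare_straight) (auto simp: holds_def base_def upd_apply less_Suc_eq)
  have 4: "hoare \<omega> (?I {}) (For2 sums_body) (n * ((m * (5 + 4) + 3) + 4) + 3) (?I (edges n m))"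
  proof (rule hoare_For2)
    fix u v assume "u < n" "v < m"
    then show "hoare \<omega> (\<lambda>s. ?I (before n m u v) s \<and> nmem s 3 0 0 = u \<and> nmem s 4 0 0 = v) sums_body 5
        (\<lambda>s. ?I (insert (u, v) (before n m u v)) s \<and> nmem s 3 0 0 = u \<and> nmem s 4 0 0 = v)"
      by (intro hoare_straight)
        (auto simp: sums_body_def holds_def base_def upd_apply before_simps(5) scaled_def)
  qed (auto simp: holds_def base_def)
  have zero_cols: "hoare \<omega> (?A n) (For 4 MM (RAssign 3 CV (NConst 0) (RConst 0))) (m * (1 + 4) + 3) (?I {})"
    by (rule hoare_weaken[OF 3]) auto
  have "hoare \<omega> (holds k x) sums_prog sums_time (?I (edges n m))"
    unfolding sums_prog_def sums_time_def
    by (rule hoare_Seq[OF 1 hoare_Seq[OF 2 hoare_Seq[OF zero_cols 4]]])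
  then show ?thesis by (rule hoare_weaken) (auto simp: summed_def ip_def row_eq_sum col_eq_sum)
qed

definition next_iter :: "(edge \<Rightarrow> real) \<Rightarrow> edge \<Rightarrow> real" where
  "next_iter x e = x e - eta * grad (scaled n m w) x e"

definition step_time :: nat where
  "step_time = cost (Seq (Pos 10 x_at) (RSet 9 (RConst 0))) + (((m + 1) * (1 + 4) + 3) + cost (step_tail E) + 1) + 1"

lemma rval_X_exp: "nmem s 0 0 0 = n \<Longrightarrow> nmem s 0 0 (Suc 0) = m \<Longrightarrow> rval (X_exp E) s = X"
  by (simp add: X_exp_def X_def)

lemma rval_step_exp:
  assumes "nmem s 0 0 0 = n" "nmem s 0 0 (Suc 0) = m"
    and "nmem s 3 0 0 = u" "nmem s 4 0 0 = v"
    and "rmem s 0 u v = w (u, v)" "rmem s 5 0 0 = wmax n m w" "rmem s 6 0 0 = H"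
    and "rmem s (Suc 0) u v = x (u, v)" "rmem s 8 0 0 = ip (scaled n m w) x"
    and "rmem s 9 0 0 = ent m (x (u, v))"
    and "rmem s 11 0 0 = max (row x u - 1) 0" "rmem s 12 0 0 = max (col x v - 1) 0"
    and "rmem s 13 0 0 = max (- x (u, v)) 0" "rmem s 14 0 0 = max (ip (scaled n m w) x) 0"
  shows "rval (step_exp E) s = next_iter x (u, v)"
  using assms
  by (simp add: step_exp_def rval_X_exp theta_exp_def next_iter_def grad_def scaled_def eta_def lam_def
      Lam_def theta_def phi_def power2_eq_square)

lemma hoare_step_body:
  assumes "u < n" "v < m"
  shows "hoare \<omega> (\<lambda>s. summed k x (\<lambda>e. if e \<in> before n m u v then next_iter x e else x e) s
        \<and> nmem s 3 0 0 = u \<and> nmem s 4 0 0 = v) (step_body E) step_time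
      (\<lambda>s. summed k x (\<lambda>e. if e \<in> insert (u, v) (before n m u v) then next_iter x e else x e) s
        \<and> nmem s 3 0 0 = u \<and> nmem s 4 0 0 = v)"
proof -
  let ?z = "\<lambda>e. if e \<in> before n m u v then next_iter x e else x e"
  let ?P = "\<lambda>s. summed k x ?z s \<and> nmem s 3 0 0 = u \<and> nmem s 4 0 0 = v"
  let ?I = "\<lambda>k' s. ?P s \<and> rmem s 10 0 0 = max (x (u, v)) 0
      \<and> rmem s 9 0 0 = (\<Sum>i<k'. x (u, v) / (1 + real i * max (x (u, v)) 0))"
  have z: "?z (u, v) = x (u, v)" by (simp add: before_simps(5))
  have 1: "hoare \<omega> ?P (Seq (Pos 10 x_at) (RSet 9 (RConst 0))) (cost (Seq (Pos 10 x_at) (RSet 9 (RConst 0)))) (?I 0)"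
  proof (rule hoare_straight)
    fix s assume s: "?P s"
    then have "rmem s (Suc 0) u v = x (u, v)" using z assms by (auto simp: summed_def holds_def)
    then show "?I 0 (exec \<omega> (Seq (Pos 10 x_at) (RSet 9 (RConst 0))) s)"
      using s by (auto simp: summed_def holds_def base_def upd_apply)
  qed auto
  have 2: "hoare \<omega> (?I 0) (For 5 (NAdd MM (NConst 1)) ent_body) ((m + 1) * (1 + 4) + 3) (?I (m + 1))"
  proof (rule hoare_For)
    fix k' assume "k' < m + 1"
    show "hoare \<omega> (\<lambda>s. ?I k' s \<and> nmem s 5 0 0 = k') ent_body 1 (\<lambda>s. ?I (Suc k') s \<and> nmem s 5 0 0 = k')"
    proof (rule hoare_straight)
      fix s assume s: "?I k' s \<and> nmem s 5 0 0 = k'"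
      then have "rmem s (Suc 0) u v = x (u, v)" using z assms by (auto simp: summed_def holds_def)
      then show "?I (Suc k') (exec \<omega> ent_body s) \<and> nmem (exec \<omega> ent_body s) 5 0 0 = k'"
        using s by (auto simp: ent_body_def summed_def holds_def base_def upd_apply)
    qed (auto simp: ent_body_def)
  qed (auto simp: summed_def holds_def base_def)
  have 3: "hoare \<omega> (?I (m + 1)) (step_tail E) (cost (step_tail E))
      (\<lambda>s. summed k x (\<lambda>e. if e \<in> insert (u, v) (before n m u v) then next_iter x e else x e) s
        \<and> nmem s 3 0 0 = u \<and> nmem s 4 0 0 = v)"
  proof (rule hoare_straight)
    fix s assume s: "?I (m + 1) s"
    then have x: "rmem s (Suc 0) u v = x (u, v)" using z assms by (auto simp: summed_def holds_def)
    have e: "rmem s 9 0 0 = ent m (x (u, v))"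
      using s by (simp add: ent_def lessThan_Suc_atMost)
    define s1 where "s1 = exec \<omega> (Seq (Pos 11 (RSub row_at (RConst 1))) (Seq (Pos 12 (RSub col_at (RConst 1)))
     (Seq (Pos 13 (RSub (RConst 0) x_at)) (Pos 14 (RVar 8))))) s"
    have s1: "s1 = s\<lparr>rmem := upd (upd (upd (upd (rmem s) 11 0 0 (max (row x u - 1) 0)) 12 0 0 (max (col x v - 1) 0))
        13 0 0 (max (- x (u, v)) 0)) 14 0 0 (max (ip (scaled n m w) x) 0)\<rparr>"
      unfolding s1_def using s x assms by (simp add: summed_def upd_apply)
    have "rval (step_exp E) s1 = next_iter x (u, v)"
      by (rule rval_step_exp) (use s x e in \<open>auto simp: s1 summed_def holds_def base_def upd_apply\<close>)
    then have ex: "exec \<omega> (step_tail E) s = s1\<lparr>rmem := upd (rmem s1) (Suc 0) u v (next_iter x (u, v))\<rparr>"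
      unfolding step_tail_def using s by (simp add: s1_def)
    show "summed k x (\<lambda>e. if e \<in> insert (u, v) (before n m u v) then next_iter x e else x e) (exec \<omega> (step_tail E) s)
        \<and> nmem (exec \<omega> (step_tail E) s) 3 0 0 = u \<and> nmem (exec \<omega> (step_tail E) s) 4 0 0 = v"
      unfolding ex using s by (auto simp: s1 summed_def holds_def base_def upd_apply)
  qed (auto simp: step_tail_def)
  show ?thesis unfolding step_body_def step_time_def
    by (rule hoare_Seq[OF 1 hoare_Seq[OF 2 3]])
qed

definition iter_time :: nat where
  "iter_time = num_iter * (((sums_time + (n * ((m * (step_time + 4) + 3) + 4) + 3) + 1) + 1 + 1) + 2) + 1"

lemma hoare_iter_prog:
  "hoare \<omega> (holds 0 (\<lambda>e. 0)) (iter_prog E) iter_time (holds num_iter (sol (scaled n m w)))"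
proof -
  let ?x = "iter (scaled n m w)"
  have "hoare \<omega> (holds 0 (?x 0)) (iter_prog E) iter_time (holds num_iter (?x num_iter))"
    unfolding iter_prog_def iter_time_def
  proof (rule hoare_While[where I = "\<lambda>k. holds k (?x k)"])
    fix k
    let ?T = "n * ((m * (step_time + 4) + 3) + 4) + 3"
    have "hoare \<omega> (summed k (?x k) (\<lambda>e. if e \<in> {} then next_iter (?x k) e else ?x k e)) (For2 (step_body E)) ?T
        (summed k (?x k) (\<lambda>e. if e \<in> edges n m then next_iter (?x k) e else ?x k e))"
      by (rule hoare_For2[where I = "\<lambda>S. summed k (?x k) (\<lambda>e. if e \<in> S then next_iter (?x k) e else ?x k e)"],
          erule (1) hoare_step_body) (auto simp: summed_def holds_def base_def)
    then have "hoare \<omega> (summed k (?x k) (?x k)) (For2 (step_body E)) ?T (holds k (?x (Suc k)))"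
      by (rule hoare_weaken) (auto simp: summed_def holds_def next_iter_def edges_def)
    from hoare_Seq[OF hoare_sums_prog this]
    have "hoare \<omega> (holds k (?x k)) (Seq sums_prog (For2 (step_body E))) (sums_time + ?T + 1) (holds k (?x (Suc k)))" .
    moreover have "hoare \<omega> (holds k (?x (Suc k))) (RSet 7 (RAdd (RVar 7) (RConst 1))) 1 (holds (Suc k) (?x (Suc k)))"
      by (rule hoare_straight) (auto simp: holds_def base_def upd_apply)
    ultimately show "hoare \<omega> (holds k (?x k)) (Seq (Seq sums_prog (For2 (step_body E))) (RSet 7 (RAdd (RVar 7) (RConst 1))))
        ((sums_time + ?T + 1) + 1 + 1) (holds (Suc k) (?x (Suc k)))"
      by (rule hoare_Seq)
  next
    fix k s assume "k < num_iter" "holds k (?x k) s"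
    then show "bval (RLess (RVar 7) (rpow (X_exp E) 60)) s"
      by (simp add: holds_def base_def rval_X_exp real_num_iter[symmetric])
  next
    fix s assume "holds num_iter (?x num_iter) s"
    then show "\<not> bval (RLess (RVar 7) (rpow (X_exp E) 60)) s"
      by (simp add: holds_def base_def rval_X_exp real_num_iter[symmetric])
  qed
  then show ?thesis by (simp add: sol_def)
qed

end

end

section \<open>Correctness of the rounding phase\<close>

context size_params
begin

context
  fixes w :: "edge \<Rightarrow> real" and \<omega> :: "nat \<Rightarrow> real"
begin

abbreviation fw :: "edge \<Rightarrow> real" where "fw \<equiv> frac (scaled n m w)"

text \<open>For nonnegative acceptance probabilities the half-open intervals of a left vertex are
  disjoint, so it selects at most one right vertex, and none if the sample lies outside all of
  them.\<close>

definition selects :: "nat \<Rightarrow> nat \<Rightarrow> bool" where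
  "selects i j \<longleftrightarrow> (\<Sum>j'<j. accept fw i j') \<le> \<omega> i \<and> \<omega> i < (\<Sum>j'<Suc j. accept fw i j')"

definition wins :: "nat \<Rightarrow> nat \<Rightarrow> bool" where
  "wins i j \<longleftrightarrow> selects i j \<and> (\<forall>i'<i. \<not> selects i' j)"

text \<open>The first \<open>d j\<close> left vertices have been processed with respect to the right vertex \<open>j\<close>.\<close>

definition rounded :: "(nat \<Rightarrow> nat) \<Rightarrow> nat \<Rightarrow> state \<Rightarrow> bool" where
  "rounded d t s \<longleftrightarrow> nmem s 0 0 0 = n \<and> nmem s 0 0 (Suc 0) = m
     \<and> (\<forall>i<n. \<forall>j<m. rmem s (Suc 0) i j = sol (scaled n m w) (i, j))
     \<and> tpos s = t \<and> (\<forall>j<m. rmem s 4 j 0 = (\<Sum>i<d j. fw (i, j)))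
     \<and> (\<forall>i. \<forall>j<m. nmem s (Suc 0) i j = (if i < d j \<and> wins i j then 1 else 0))
     \<and> (\<forall>j<m. nmem s 2 j 0 = (if \<exists>i<d j. selects i j then 1 else 0))"

text \<open>In the middle of row \<open>u\<close> some columns have already seen \<open>u\<close>
  and others have not, which is why progress is recorded per column.\<close>

lemma hoare_round_body:
  assumes u: "u < n" and v: "v < m" and dv: "d v = u"
  shows "hoare \<omega> (\<lambda>s. rounded d t s \<and> nmem s 3 0 0 = u \<and> nmem s 4 0 0 = v
        \<and> rmem s 15 0 0 = \<omega> u \<and> rmem s 16 0 0 = (\<Sum>j<v. accept fw u j))
      (round_body E) (cost (round_body E))
      (\<lambda>s. rounded (d(v := Suc u)) t s \<and> nmem s 3 0 0 = u \<and> nmem s 4 0 0 = v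
        \<and> rmem s 15 0 0 = \<omega> u \<and> rmem s 16 0 0 = (\<Sum>j<Suc v. accept fw u j))"
    (is "hoare \<omega> ?P _ _ ?Q")
proof (rule hoare_straight)
  fix s assume s: "?P s"
  let ?x = "max (sol (scaled n m w) (u, v)) 0"
  define q where "q = accept fw u v"
  define s1 where "s1 = exec \<omega> (Seq (Pos 10 x_at) (RSet 17 (RDiv (frac_exp E) (RSub (RConst 2) prefix_at)))) s"
  have s1: "s1 = s\<lparr>rmem := upd (upd (rmem s) 10 0 0 ?x) 17 0 0 q\<rparr>"
    unfolding s1_def q_def accept_def frac_def
    using s u v by (simp add: rounded_def frac_exp_def upd_apply dv frac_def)
  let ?b = "BAnd (BNot (RLess (RVar 15) (RVar 16))) (BAnd (RLess (RVar 15) (RAdd (RVar 16) (RVar 17)))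
      (NLess (NArr 2 CV (NConst 0)) (NConst 1)))"
  have b: "bval ?b s1 \<longleftrightarrow> wins u v"
    using s u v by (auto simp: s1 upd_apply rounded_def wins_def selects_def q_def dv)
  define s2 where "s2 = (if wins u v then s1\<lparr>nmem := upd (upd (nmem s1) (Suc 0) u v 1) 2 v 0 1\<rparr> else s1)"
  have ex: "exec \<omega> (round_body E) s = s2\<lparr>rmem := upd (upd (rmem s2) 16 0 0 (rmem s 16 0 0 + q))
      4 v 0 (rmem s 4 v 0 + fw (u, v))\<rparr>"
  proof -
    have "exec \<omega> (round_body E) s = exec \<omega> (Seq (RSet 16 (RAdd (RVar 16) (RVar 17)))
       (RAssign 4 CV (NConst 0) (RAdd prefix_at (frac_exp E))))
      (exec \<omega> (Cond ?b (Seq (NAssign 1 CU CV (NConst 1)) (NAssign 2 CV (NConst 0) (NConst 1))) Skip) s1)"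
      by (simp add: round_body_def s1_def)
    also have "exec \<omega> (Cond ?b (Seq (NAssign 1 CU CV (NConst 1)) (NAssign 2 CV (NConst 0) (NConst 1))) Skip) s1 = s2"
      unfolding exec.simps(2) b using s by (simp add: s2_def s1 upd_apply)
    finally show ?thesis
      using s by (simp add: s2_def s1 upd_apply frac_exp_def frac_def)
  qed
  have ns2: "nmem s2 a i j = (if wins u v \<and> (a = 1 \<and> i = u \<and> j = v \<or> a = 2 \<and> i = v \<and> j = 0) then 1 else nmem s a i j)"
    for a i j
    by (auto simp: s2_def s1 upd_apply)
  have rs2: "rmem s2 = upd (upd (rmem s) 10 0 0 ?x) 17 0 0 q" "tpos s2 = tpos s"
    by (auto simp: s2_def s1)
  show "?Q (exec \<omega> (round_body E) s)"
    unfolding ex using s u v dv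
    by (auto simp: rounded_def ns2 rs2 upd_apply q_def less_Suc_eq wins_def)
qed (auto simp: round_body_def)

definition round_time :: nat where
  "round_time = n * ((3 + (m * (cost (round_body E) + 4) + 3) + 1) + 4) + 3"

lemma hoare_round_prog:
  "hoare \<omega> (rounded (\<lambda>j. 0) 0) (round_prog E) round_time (rounded (\<lambda>j. n) n)"
  unfolding round_prog_def round_time_def
proof (rule hoare_For[where I = "\<lambda>u. rounded (\<lambda>j. u) u"])
  fix u assume u: "u < n"
  let ?J = "\<lambda>v s. rounded (\<lambda>j. if j < v then Suc u else u) (Suc u) s \<and> nmem s 3 0 0 = u
      \<and> rmem s 15 0 0 = \<omega> u \<and> rmem s 16 0 0 = (\<Sum>j<v. accept fw u j)"
  have 1: "hoare \<omega> (\<lambda>s. rounded (\<lambda>j. u) u s \<and> nmem s 3 0 0 = u)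
      (Seq (Sample 15 (NConst 0) (NConst 0)) (RSet 16 (RConst 0))) 3 (?J 0)"
    by (rule hoare_straight) (auto simp: rounded_def upd_apply)
  have 2: "hoare \<omega> (?J 0) (For 4 MM (round_body E)) (m * (cost (round_body E) + 4) + 3) (?J m)"
  proof (rule hoare_For)
    fix v assume v: "v < m"
    have d: "(\<lambda>j. if j < Suc v then Suc u else u) = (\<lambda>j. if j < v then Suc u else u)(v := Suc u)"
      by (auto simp: fun_eq_iff)
    have "hoare \<omega> (\<lambda>s. rounded (\<lambda>j. if j < v then Suc u else u) (Suc u) s \<and> nmem s 3 0 0 = u \<and> nmem s 4 0 0 = v
        \<and> rmem s 15 0 0 = \<omega> u \<and> rmem s 16 0 0 = (\<Sum>j<v. accept fw u j)) (round_body E) (cost (round_body E))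
      (\<lambda>s. rounded ((\<lambda>j. if j < v then Suc u else u)(v := Suc u)) (Suc u) s \<and> nmem s 3 0 0 = u \<and> nmem s 4 0 0 = v
        \<and> rmem s 15 0 0 = \<omega> u \<and> rmem s 16 0 0 = (\<Sum>j<Suc v. accept fw u j))"
      by (rule hoare_round_body[OF u v]) simp
    then show "hoare \<omega> (\<lambda>s. ?J v s \<and> nmem s 4 0 0 = v) (round_body E) (cost (round_body E))
        (\<lambda>s. ?J (Suc v) s \<and> nmem s 4 0 0 = v)"
      unfolding d by (rule hoare_weaken) auto
  qed (auto simp: rounded_def)
  have 3: "?J m s \<Longrightarrow> rounded (\<lambda>j. Suc u) (Suc u) s \<and> nmem s 3 0 0 = u" for s
    by (auto simp: rounded_def)
  show "hoare \<omega> (\<lambda>s. rounded (\<lambda>j. u) u s \<and> nmem s 3 0 0 = u)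
      (Seq (Seq (Sample 15 (NConst 0) (NConst 0)) (RSet 16 (RConst 0))) (For 4 MM (round_body E)))
      (3 + (m * (cost (round_body E) + 4) + 3) + 1) (\<lambda>s. rounded (\<lambda>j. Suc u) (Suc u) s \<and> nmem s 3 0 0 = u)"
    by (rule hoare_weaken[OF hoare_Seq[OF 1 2] _ 3]) auto
qed (auto simp: rounded_def)

definition total_time :: nat where
  "total_time = (n * ((m * (2 + 4) + 3) + 4) + 3)
     + ((1 + (m * (1 + 4) + 3) + 1) + (iter_time + round_time + 1) + 1) + 1"

lemma hoare_prog:
  "hoare \<omega> (\<lambda>s. start w s \<and> rmem s 5 0 0 = 0) (prog E) total_time (rounded (\<lambda>j. n) n)"
  unfolding prog_def total_time_def
proof (intro hoare_Seq[OF hoare_max_prog] hoare_Seq[OF hoare_harm_prog] hoare_Seq[OF hoare_iter_prog])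
  show "hoare \<omega> (holds w num_iter (sol (scaled n m w))) (round_prog E) round_time (rounded (\<lambda>j. n) n)"
    by (rule hoare_weaken[OF hoare_round_prog]) (auto simp: rounded_def holds_def base_def)
qed

lemma run_prog:
  assumes "total_time \<le> t"
  shows "fst (run (prog E) n m w t \<omega>) = Skip"
    and "out_edges n m (snd (run (prog E) n m w t \<omega>)) = {(i, j) \<in> edges n m. wins i j}"
proof -
  obtain t0 s where t0: "t0 \<le> total_time" "(step \<omega> ^^ t0) (prog E, init n m w) = (Skip, s)"
    and s: "rounded (\<lambda>j. n) n s"
    using hoare_prog start_init unfolding hoare_def by blast
  have r: "run (prog E) n m w t \<omega> = (Skip, s)"
    unfolding run_def using steps_Skip_mono[OF t0(2)] t0(1) assms by simp
  then show "fst (run (prog E) n m w t \<omega>) = Skip" by simp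
  show "out_edges n m (snd (run (prog E) n m w t \<omega>)) = {(i, j) \<in> edges n m. wins i j}"
  proof -
    have "nmem s (Suc 0) i j = (if wins i j then 1 else 0)" if "i < n" "j < m" for i j
      using s that by (simp add: rounded_def)
    then show ?thesis unfolding r by (auto simp: out_edges_def edges_def split: if_splits)
  qed
qed

end

end

section \<open>Sampling by quantiles\<close>

text \<open>The value for \<open>x < 0\<close> is dictated by the program, which selects nothing
  then: thus program and \<open>quantile\<close> agree on every tape, not just almost
  surely.\<close>

definition quantile :: "(nat \<Rightarrow> real) \<Rightarrow> nat \<Rightarrow> real \<Rightarrow> nat" where
  "quantile q m x = (if x < 0 \<or> (\<Sum>j<m. q j) \<le> x then m else LEAST v. x < (\<Sum>j<Suc v. q j))"

lemma prefix_sum_mono: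
  fixes q :: "nat \<Rightarrow> real"
  assumes "\<And>v. v < m \<Longrightarrow> 0 \<le> q v" "i \<le> j" "j \<le> m"
  shows "(\<Sum>v<i. q v) \<le> (\<Sum>v<j. q v)"
  using assms by (intro sum_mono2) auto

lemma quantile_eq_iff:
  assumes q: "\<And>v. v < m \<Longrightarrow> 0 \<le> q v" and v: "v < m"
  shows "quantile q m x = v \<longleftrightarrow> (\<Sum>j<v. q j) \<le> x \<and> x < (\<Sum>j<Suc v. q j)"
proof
  assume eq: "quantile q m x = v"
  then have x: "0 \<le> x" "x < (\<Sum>j<m. q j)" and L: "(LEAST v. x < (\<Sum>j<Suc v. q j)) = v"
    using v by (auto simp: quantile_def split: if_splits)
  have "x < (\<Sum>j<Suc (m - 1). q j)" using x v by simp
  then have "x < (\<Sum>j<Suc v. q j)" unfolding L[symmetric] by (rule LeastI)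
  moreover have "(\<Sum>j<v. q j) \<le> x"
  proof (cases v)
    case (Suc k)
    then show ?thesis using not_less_Least[of k "\<lambda>v. x < (\<Sum>j<Suc v. q j)"] L by auto
  qed (use x in simp)
  ultimately show "(\<Sum>j<v. q j) \<le> x \<and> x < (\<Sum>j<Suc v. q j)" by simp
next
  assume x: "(\<Sum>j<v. q j) \<le> x \<and> x < (\<Sum>j<Suc v. q j)"
  have "0 \<le> x" using prefix_sum_mono[of m q 0 v, OF q] x v by auto
  moreover have "x < (\<Sum>j<m. q j)" using prefix_sum_mono[of m q "Suc v" m, OF q] x v by auto
  moreover have "(LEAST v. x < (\<Sum>j<Suc v. q j)) = v"
  proof (rule Least_equality)
    show "x < (\<Sum>j<Suc v. q j)" using x by simp
    fix k assume k: "x < (\<Sum>j<Suc k. q j)"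
    show "v \<le> k"
    proof (rule ccontr)
      assume "\<not> v \<le> k"
      then have "(\<Sum>j<Suc k. q j) \<le> (\<Sum>j<v. q j)" using v by (intro prefix_sum_mono[OF q]) auto
      then show False using x k by linarith
    qed
  qed
  ultimately show "quantile q m x = v" by (simp add: quantile_def)
qed

lemma quantile_le:
  assumes q: "\<And>v. v < m \<Longrightarrow> 0 \<le> q v"
  shows "quantile q m x \<le> m"
proof (cases "x < 0 \<or> (\<Sum>j<m. q j) \<le> x")
  case False
  then have "0 < m" by (cases m) auto
  then have "x < (\<Sum>j<Suc (m - 1). q j)" using False by simp
  then have "(LEAST v. x < (\<Sum>j<Suc v. q j)) \<le> m - 1" by (rule Least_le)
  then show ?thesis using False by (simp add: quantile_def)
qed (simp add: quantile_def)

lemma quantile_eq_m_iff: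
  assumes q: "\<And>v. v < m \<Longrightarrow> 0 \<le> q v"
  shows "quantile q m x = m \<longleftrightarrow> x < 0 \<or> (\<Sum>j<m. q j) \<le> x"
proof
  assume eq: "quantile q m x = m"
  show "x < 0 \<or> (\<Sum>j<m. q j) \<le> x"
  proof (rule ccontr)
    assume a: "\<not> (x < 0 \<or> (\<Sum>j<m. q j) \<le> x)"
    then have "0 < m" by (cases m) auto
    then have "x < (\<Sum>j<Suc (m - 1). q j)" using a by simp
    then have "(LEAST v. x < (\<Sum>j<Suc v. q j)) \<le> m - 1" by (rule Least_le)
    then show False using eq a \<open>0 < m\<close> by (simp add: quantile_def)
  qed
qed (simp add: quantile_def)

abbreviation unif :: "real measure" where "unif \<equiv> uniform_measure lborel {0..1}"

lemma prob_space_unif: "prob_space unif"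
  by (rule prob_space_uniform_measure) auto

lemma quantile_distribution:
  assumes q: "\<And>v. v < m \<Longrightarrow> 0 \<le> q v" and le: "(\<Sum>v<m. q v) \<le> 1" and v: "v \<le> m"
  shows "{x. quantile q m x = v} \<in> sets borel" "measure unif {x. quantile q m x = v} = pmf (pick m q) v"
proof -
  let ?P = "\<lambda>v. \<Sum>j<v. q j"
  have P0: "0 \<le> ?P v" if "v \<le> m" for v using q that by (intro sum_nonneg) auto
  have "{x. quantile q m x = v} \<in> sets borel \<and> measure unif {x. quantile q m x = v} = pmf (pick m q) v"
  proof (cases "v < m")
    case True
    have set: "{x. quantile q m x = v} = {?P v..<?P (Suc v)}"
      using quantile_eq_iff[OF q True] by auto
    have le1: "?P v \<le> ?P (Suc v)" "?P (Suc v) \<le> 1"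
      using prefix_sum_mono[of m q v "Suc v", OF q] prefix_sum_mono[of m q "Suc v" m, OF q] True le by auto
    have "{0..1} \<inter> {?P v..<?P (Suc v)} = {?P v..<?P (Suc v)}"
      using P0[of v] le1 True by auto
    then have "measure unif {x. quantile q m x = v} = ?P (Suc v) - ?P v"
      unfolding set using le1(1) by (subst measure_uniform_measure) auto
    then show ?thesis using True by (simp add: set pmf_pick[OF q le])
  next
    case False
    then have vm: "v = m" using v by simp
    have set: "{x. quantile q m x = v} = {..<0} \<union> {?P m..}"
      using quantile_eq_m_iff[of m q] q by (auto simp: vm)
    have "{0..1} \<inter> ({..<0} \<union> {?P m..}) = {?P m..1}" using P0[of m] by auto
    then have "measure unif {x. quantile q m x = v} = 1 - ?P m"
      unfolding set using le by (subst measure_uniform_measure) auto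
    moreover have "{x. quantile q m x = v} \<in> sets borel" unfolding set by simp
    moreover have "pmf (pick m q) v = 1 - ?P m" using pmf_pick[OF q le] vm by simp
    ultimately show ?thesis by simp
  qed
  then show "{x. quantile q m x = v} \<in> sets borel" "measure unif {x. quantile q m x = v} = pmf (pick m q) v"
    by auto
qed

lemma distr_eq_pmf_finite_range:
  assumes M: "prob_space M" and F: "finite F" "\<And>\<omega>. c \<omega> \<in> F" "set_pmf p \<subseteq> F"
    and meas: "\<And>f. f \<in> F \<Longrightarrow> c -` {f} \<inter> space M \<in> sets M"
    and eq: "\<And>f. f \<in> F \<Longrightarrow> measure M (c -` {f} \<inter> space M) = pmf p f"
  shows "c \<in> M \<rightarrow>\<^sub>M count_space UNIV" "distr M (count_space UNIV) c = measure_pmf p"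
proof -
  interpret prob_space M by fact
  have pre: "c -` A \<inter> space M = (\<Union>f\<in>A \<inter> F. c -` {f} \<inter> space M)" for A using F(2) by auto
  have set: "c -` A \<inter> space M \<in> sets M" for A
    using F(1) meas by (subst pre[of A], intro sets.finite_UN) auto
  show c: "c \<in> M \<rightarrow>\<^sub>M count_space UNIV" using set by (intro measurableI) auto
  show "distr M (count_space UNIV) c = measure_pmf p"
  proof (rule measure_eqI)
    fix A assume "A \<in> sets (distr M (count_space UNIV) c)"
    have "emeasure (distr M (count_space UNIV) c) A = emeasure M (\<Union>f\<in>A \<inter> F. c -` {f} \<inter> space M)"
      unfolding pre[of A, symmetric] using c by (subst emeasure_distr) auto
    also have "\<dots> = (\<Sum>f\<in>A \<inter> F. emeasure M (c -` {f} \<inter> space M))"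
      using F(1) meas by (intro sum_emeasure[symmetric]) (auto simp: disjoint_family_on_def)
    also have "\<dots> = (\<Sum>f\<in>A \<inter> F. ennreal (pmf p f))"
      by (intro sum.cong) (auto simp: emeasure_eq_measure eq)
    also have "\<dots> = emeasure (measure_pmf p) (A \<inter> F)"
      using F(1) by (simp add: emeasure_measure_pmf_finite)
    also have "\<dots> = emeasure (measure_pmf p) A"
      using F(3) by (intro emeasure_eq_AE) (auto simp: AE_measure_pmf_iff)
    finally show "emeasure (distr M (count_space UNIV) c) A = emeasure (measure_pmf p) A" .
  qed simp
qed

text \<open>The preimage of a vector of picks is a cylinder over the first \<open>n\<close> samples,
  so its probability is a product. Beyond \<open>n\<close> the vector takes the default value of
  \<open>Pi_pmf\<close>.\<close>

lemma distr_tapes_quantile: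
  assumes q: "\<And>u v. u < n \<Longrightarrow> v < m \<Longrightarrow> 0 \<le> q u v" "\<And>u. u < n \<Longrightarrow> (\<Sum>v<m. q u v) \<le> 1"
  defines "c \<equiv> \<lambda>\<omega> u. if u < n then quantile (q u) m (\<omega> u) else m"
  shows "c \<in> tapes \<rightarrow>\<^sub>M count_space UNIV"
    "distr tapes (count_space UNIV) c = measure_pmf (Pi_pmf {..<n} m (\<lambda>u. pick m (q u)))"
proof -
  interpret product_prob_space "\<lambda>_. unif" "UNIV :: nat set"
    by (rule product_prob_spaceI) (rule prob_space_unif)
  let ?F = "PiE_dflt {..<n} m (\<lambda>_. {..m})"
  let ?p = "Pi_pmf {..<n} m (\<lambda>u. pick m (q u))"
  have sp: "prob_space tapes" unfolding tapes_def by unfold_locales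
  have fin: "finite ?F" by (intro finite_PiE_dflt) auto
  have cF: "c \<omega> \<in> ?F" for \<omega> using quantile_le[OF q(1)] by (auto simp: c_def PiE_dflt_def)
  have pF: "set_pmf ?p \<subseteq> ?F"
    using set_pick_subset[OF q] by (subst set_Pi_pmf) (auto simp: PiE_dflt_def subset_iff)
  have pre: "c -` {f} \<inter> space tapes
      = prod_emb UNIV (\<lambda>_. unif) {..<n} (Pi\<^sub>E {..<n} (\<lambda>u. {x. quantile (q u) m x = f u}))" if "f \<in> ?F" for f
    using that by (auto simp: c_def prod_emb_def tapes_def space_PiM PiE_dflt_def fun_eq_iff PiE_iff extensional_def)
  have B: "{x. quantile (q u) m x = f u} \<in> sets unif"
    "measure unif {x. quantile (q u) m x = f u} = pmf (pick m (q u)) (f u)" if "f \<in> ?F" "u < n" for f u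
    using quantile_distribution[OF q(1)[OF that(2)] q(2)[OF that(2)], of "f u"] that
    by (auto simp: PiE_dflt_def)
  have meas: "c -` {f} \<inter> space tapes \<in> sets tapes" if "f \<in> ?F" for f
    unfolding pre[OF that] unfolding tapes_def using B(1)[OF that] by (intro sets_PiM_I) auto
  have eq: "measure tapes (c -` {f} \<inter> space tapes) = pmf ?p f" if f: "f \<in> ?F" for f
  proof -
    have "emeasure tapes (c -` {f} \<inter> space tapes) = (\<Prod>u<n. emeasure unif {x. quantile (q u) m x = f u})"
      unfolding pre[OF f] unfolding tapes_def using B(1)[OF f] by (intro emeasure_PiM_emb) auto
    also have "\<dots> = (\<Prod>u<n. ennreal (pmf (pick m (q u)) (f u)))"
      using B(2)[OF f] by (intro prod.cong) (auto simp:
          finite_measure.emeasure_eq_measure[OF prob_space.finite_measure[OF prob_space_unif]])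
    also have "\<dots> = ennreal (\<Prod>u<n. pmf (pick m (q u)) (f u))" by (simp add: prod_ennreal)
    also have "(\<Prod>u<n. pmf (pick m (q u)) (f u)) = pmf ?p f"
      using f by (subst pmf_Pi') (auto simp: PiE_dflt_def)
    finally show ?thesis by (simp add: measure_def)
  qed
  show "c \<in> tapes \<rightarrow>\<^sub>M count_space UNIV"
    by (rule distr_eq_pmf_finite_range(1)[OF sp fin cF pF meas eq])
  show "distr tapes (count_space UNIV) c = measure_pmf ?p"
    by (rule distr_eq_pmf_finite_range(2)[OF sp fin cF pF meas eq])
qed

section \<open>The algorithm\<close>

definition alg :: "nat \<Rightarrow> algorithm" where
  "alg E n m w = rounding n m (size_params.frac n m E (scaled n m w))"

lemma (in size_params) fractional_frac: "w \<in> weightings n m \<Longrightarrow> fractional n m (frac (scaled n m w))"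
  unfolding fractional_def
  using frac_nonneg frac_row_le[OF unit_weights_scaled] frac_col_le[OF unit_weights_scaled] by auto

section \<open>Polynomial running time\<close>

definition poly_bounded :: "(nat \<Rightarrow> nat \<Rightarrow> nat) \<Rightarrow> bool" where
  "poly_bounded f \<longleftrightarrow> (\<exists>p :: nat poly. \<forall>n m. f n m \<le> poly p (n + m))"

lemma poly_bounded_const: "poly_bounded (\<lambda>n m. c)"
  unfolding poly_bounded_def by (rule exI[of _ "[:c:]"]) simp

lemma poly_bounded_args: "poly_bounded (\<lambda>n m. n)" "poly_bounded (\<lambda>n m. m)"
  unfolding poly_bounded_def by (rule exI[of _ "[:0, 1:]"]; simp)+

lemma poly_bounded_add: "poly_bounded f \<Longrightarrow> poly_bounded g \<Longrightarrow> poly_bounded (\<lambda>n m. f n m + g n m)"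
  unfolding poly_bounded_def by (metis add_mono poly_add)

lemma poly_bounded_mult: "poly_bounded f \<Longrightarrow> poly_bounded g \<Longrightarrow> poly_bounded (\<lambda>n m. f n m * g n m)"
  unfolding poly_bounded_def by (metis mult_le_mono poly_mult)

lemma poly_bounded_power: "poly_bounded f \<Longrightarrow> poly_bounded (\<lambda>n m. f n m ^ k)"
  by (induction k) (auto intro: poly_bounded_mult poly_bounded_const)

text \<open>\<open>E\<close> is a constant here, so \<open>num_iter\<close> is polynomial in
  \<open>n + m\<close>, and the costs of the loop-free pieces are constants.\<close>

lemma poly_bounded_total_time:
  assumes "5 \<le> E"
  shows "poly_bounded (\<lambda>n m. size_params.total_time n m E)"
proof -
  have e: "size_params E" using assms by unfold_locales
  note defs = size_params.total_time_def[OF e] size_params.iter_time_def[OF e]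
    size_params.round_time_def[OF e] size_params.sums_time_def[OF e] size_params.step_time_def[OF e]
    size_params.num_iter_def[OF e]
  show ?thesis unfolding defs
    by (intro poly_bounded_const poly_bounded_args poly_bounded_power poly_bounded_add poly_bounded_mult)
qed

context size_params
begin

lemma winners_eq_first_wins:
  assumes w: "w \<in> weightings n m"
  shows "{(i, j) \<in> edges n m. wins w \<omega> i j} = first_wins n m
    (\<lambda>u. if u < n then quantile (accept (frac (scaled n m w)) u) m (\<omega> u) else m)"
proof -
  let ?q = "accept (frac (scaled n m w))"
  have "selects w \<omega> i j \<longleftrightarrow> quantile (?q i) m (\<omega> i) = j" if "i < n" "j < m" for i j
    using quantile_eq_iff[of m "?q i" j "\<omega> i"] accept_bounds(1)[OF fractional_frac[OF w]] that
    by (simp add: selects_def)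
  then show ?thesis by (auto simp: first_wins_def wins_def edges_def)
qed

lemma distr_run_prog:
  assumes w: "w \<in> weightings n m" and t: "total_time \<le> t"
  defines "out \<equiv> \<lambda>\<omega>. out_edges n m (snd (run (prog E) n m w t \<omega>))"
  shows "out \<in> tapes \<rightarrow>\<^sub>M count_space UNIV" "distr tapes (count_space UNIV) out = measure_pmf (alg E n m w)"
proof -
  let ?q = "accept (frac (scaled n m w))"
  define c where "c = (\<lambda>\<omega> u. if u < n then quantile (?q u) m (\<omega> u) else m)"
  have out: "out = first_wins n m \<circ> c"
    unfolding out_def run_prog(2)[OF t] winners_eq_first_wins[OF w] c_def by (simp add: comp_def)
  have c: "c \<in> tapes \<rightarrow>\<^sub>M count_space UNIV"
    "distr tapes (count_space UNIV) c = measure_pmf (Pi_pmf {..<n} m (\<lambda>u. pick m (?q u)))"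
    unfolding c_def using accept_bounds(1)[OF fractional_frac[OF w]] sum_accept_le[OF fractional_frac[OF w]]
    by (intro distr_tapes_quantile; simp)+
  show "out \<in> tapes \<rightarrow>\<^sub>M count_space UNIV" unfolding out by (rule measurable_comp[OF c(1)]) simp
  have "distr tapes (count_space UNIV) out = distr (distr tapes (count_space UNIV) c) (count_space UNIV) (first_wins n m)"
    unfolding out by (rule distr_distr[symmetric]) (use c(1) in auto)
  then show "distr tapes (count_space UNIV) out = measure_pmf (alg E n m w)"
    by (simp add: c(2) alg_def rounding_def map_pmf_rep_eq)
qed

end

lemma polynomial_time_alg:
  assumes "5 \<le> E"
  shows "polynomial_time (alg E)"
proof -
  obtain p :: "nat poly" where p: "\<And>n m. size_params.total_time n m E \<le> poly p (n + m)"
    using poly_bounded_total_time[OF assms] unfolding poly_bounded_def by blast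
  have e: "size_params E" using assms by unfold_locales
  show ?thesis
    unfolding polynomial_time_def Let_def
    using size_params.run_prog(1)[OF e p] size_params.distr_run_prog[OF e _ p]
    by (intro exI[of _ "prog E"] exI[of _ p]) auto
qed

lemma approximates_matching_alg:
  assumes "5 \<le> E" and \<epsilon>: "5 / (2 * real E) \<le> \<epsilon>"
  shows "approximates_matching (1 / 2 - \<epsilon>) (alg E)"
  unfolding approximates_matching_def
proof (intro allI ballI conjI)
  fix n m w assume w: "w \<in> weightings n m"
  interpret size_params n m E using assms by unfold_locales
  note f = fractional_frac[OF w]
  show "set_pmf (alg E n m w) \<subseteq> matchings n m" unfolding alg_def by (rule set_rounding_subset[OF f])
  have "0 \<le> opt n m w" using wmax_le_opt[of n m w] wmax_nonneg[of n m w] by linarith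
  then have "(1 / 2 - \<epsilon>) * opt n m w \<le> (1 / 2 - 5 / (2 * real E)) * opt n m w"
    using \<epsilon> by (intro mult_right_mono) auto
  also have "\<dots> = ((1 - 5 / real E) * opt n m w) / 2" by (simp add: field_simps)
  also have "\<dots> \<le> (\<Sum>e\<in>edges n m. w e * frac (scaled n m w) e) / 2"
    using frac_weight[OF w] by (intro divide_right_mono) auto
  also have "\<dots> = measure_pmf.expectation (alg E n m w) (\<lambda>M. \<Sum>e\<in>M. w e)"
    unfolding alg_def by (rule expectation_rounding[OF f, symmetric])
  finally show "(1 / 2 - \<epsilon>) * opt n m w \<le> measure_pmf.expectation (alg E n m w) (\<lambda>M. \<Sum>e\<in>M. w e)" .
qed

section \<open>The pointwise Lipschitz constant\<close>

lemma tendsto_l1_dist: "((\<lambda>w'. l1_dist n m w w') \<longlongrightarrow> 0) (at w within S)"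
proof -
  have "((\<lambda>w'. w' e) \<longlongrightarrow> w e) (at w within S)" for e
    using continuous_on_product_coordinates[of e]
    by (auto simp: continuous_on_def intro: tendsto_within_subset)
  then have "((\<lambda>w'. \<Sum>e\<in>edges n m. \<bar>w e - w' e\<bar>) \<longlongrightarrow> (\<Sum>e\<in>edges n m. \<bar>w e - w e\<bar>)) (at w within S)"
    by (intro tendsto_intros)
  then show ?thesis by (simp add: l1_dist_def)
qed

lemma l1_dist_pos:
  assumes "w \<in> weightings n m" "w' \<in> weightings n m" "w \<noteq> w'"
  shows "0 < l1_dist n m w w'"
proof -
  obtain e where e: "w e \<noteq> w' e" using assms(3) by (auto simp: fun_eq_iff)
  then have "e \<in> edges n m"
    using weighting_outside[OF assms(1), of e] weighting_outside[OF assms(2), of e] by metis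
  from component_le_l1_dist[OF this, of w w'] show ?thesis using e by linarith
qed

lemma harmonic_le: "0 < m \<Longrightarrow> (\<Sum>k<m. 1 / real (Suc k)) \<le> 1 + ln (real m)"
proof (induction m)
  case (Suc m)
  show ?case
  proof (cases "m = 0")
    case False
    have "ln (real m / real (Suc m)) \<le> real m / real (Suc m) - 1"
      using False by (intro ln_le_minus_one) auto
    also have "\<dots> = - (1 / real (Suc m))" by (simp add: field_simps)
    finally have "1 / real (Suc m) \<le> ln (real (Suc m)) - ln (real m)"
      using False by (simp add: ln_div)
    then show ?thesis using Suc False by simp
  qed simp
qed simp

text \<open>With \<open>L = ln (max 2 m) \<ge> 2 / 3\<close> one has
  \<open>H \<le> 3 + ln m \<le> (9 / 2 + 1) * L\<close>. The maximum with \<open>2\<close> keeps the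
  logarithm away from \<open>0\<close>.\<close>

lemma (in size_params) H_le:
  assumes "0 < m"
  shows "H \<le> 6 * ln (max 2 (real m))"
proof -
  have "2 / 3 \<le> ln (2::real)" by (rule ln2_ge_two_thirds)
  also have "\<dots> \<le> ln (max 2 (real m))" by (subst ln_le_cancel_iff) auto
  finally have 1: "2 / 3 \<le> ln (max 2 (real m))" .
  have "ln (real m) \<le> ln (max 2 (real m))" using assms by (subst ln_le_cancel_iff) auto
  then show ?thesis using harmonic_le[OF assms] 1 unfolding H_def by linarith
qed

text \<open>The constant is \<open>8 * 40 * 12\<close>: from rounding, from
  \<open>frac_l1_lipschitz\<close>, and from \<open>1 / lam\<close> by way of
  \<open>n + 1 \<le> 2 * n\<close> and \<open>H_le\<close>.\<close>

lemma (in size_params) EM_u_alg_le: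
  assumes w: "w \<in> weightings n m" and w': "w' \<in> weightings n m"
    and pos: "0 < wmax n m w" and small: "l1_dist n m w w' \<le> wmax n m w / X ^ 20"
  shows "EM_u (alg E n m w) (alg E n m w')
    \<le> ennreal (3840 * real E * real n powr (3 / 2) * ln (max 2 (real m)) / opt n m w * l1_dist n m w w')"
proof -
  obtain e where "e \<in> edges n m" using wmax_attained[OF pos] by blast
  then have nm: "0 < n" "0 < m" by (auto simp: edges_def)
  have opt: "0 < opt n m w" using pos wmax_le_opt[of n m w] by linarith
  let ?L = "ln (max 2 (real m))" and ?\<delta> = "l1_dist n m w w'"
  have "EM_u (alg E n m w) (alg E n m w')
      \<le> ennreal (8 * (\<Sum>e\<in>edges n m. \<bar>frac (scaled n m w) e - frac (scaled n m w') e\<bar>))"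
    unfolding alg_def by (rule EM_u_rounding_le[OF fractional_frac[OF w] fractional_frac[OF w']])
  also have "\<dots> \<le> ennreal (8 * (40 * sqrt (real n) * (?\<delta> / opt n m w) / lam))"
    using frac_l1_lipschitz[OF w w' pos small] by (intro ennreal_leI) auto
  also have "\<dots> \<le> ennreal (3840 * real E * real n powr (3 / 2) * ?L / opt n m w * ?\<delta>)"
  proof (rule ennreal_leI)
    have powr: "real n powr (3 / 2) = sqrt (real n) * real n"
    proof -
      have "real n powr (3 / 2) = real n powr (1 / 2 + 1)" by simp
      also have "\<dots> = sqrt (real n) * real n" using nm by (simp only: powr_add powr_half_sqrt) simp
      finally show ?thesis .
    qed
    have "1 / lam = real E * (real (n + 1) * H)" by (simp add: lam_def)
    also have "\<dots> \<le> real E * ((2 * real n) * (6 * ?L))"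
      using nm H_le H_bounds by (intro mult_left_mono mult_mono) auto
    finally have lam: "1 / lam \<le> 12 * real E * real n * ?L" by simp
    have "8 * (40 * sqrt (real n) * (?\<delta> / opt n m w) / lam)
        = (320 * sqrt (real n) * (?\<delta> / opt n m w)) * (1 / lam)" by simp
    also have "\<dots> \<le> (320 * sqrt (real n) * (?\<delta> / opt n m w)) * (12 * real E * real n * ?L)"
      using lam opt l1_dist_nonneg by (intro mult_left_mono mult_nonneg_nonneg divide_nonneg_pos) auto
    also have "\<dots> = 3840 * real E * real n powr (3 / 2) * ?L / opt n m w * ?\<delta>"
      unfolding powr by simp
    finally show "8 * (40 * sqrt (real n) * (?\<delta> / opt n m w) / lam)
        \<le> 3840 * real E * real n powr (3 / 2) * ?L / opt n m w * ?\<delta>" .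
  qed
  finally show ?thesis .
qed

lemma pointwise_lipschitz_alg:
  assumes E: "5 \<le> E" and w: "w \<in> weightings n m"
  shows "pointwise_lipschitz (alg E) n m w
    \<le> ennreal (3840 * real E * real n powr (3 / 2) * ln (max 2 (real m))) / ennreal (opt n m w)"
proof -
  interpret size_params n m E using E by unfold_locales
  let ?B = "3840 * real E * real n powr (3 / 2) * ln (max 2 (real m))"
  have B: "0 \<le> ?B" by (intro mult_nonneg_nonneg) auto
  have near: "\<forall>\<^sub>F w' in at w within weightings n m. w' \<in> weightings n m \<and> w' \<noteq> w"
    by (auto simp: eventually_at_filter)
  show ?thesis
  proof (cases "n = 0")
    case True
    \<comment> \<open>Without edges \<open>w\<close> is the only weight function, so the punctured
      filter is trivial.\<close>
    then have "w' = w" if "w' \<in> weightings n m" for w'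
      using that w by (auto simp: weightings_def edges_def fun_eq_iff)
    then have "\<forall>\<^sub>F w' in at w within weightings n m.
        EM_u (alg E n m w) (alg E n m w') / ennreal (l1_dist n m w w') \<le> ennreal ?B / ennreal (opt n m w)"
      using near by (auto elim: eventually_mono)
    then show ?thesis unfolding pointwise_lipschitz_def by (rule Limsup_bounded)
  next
    case n: False
    show ?thesis
    proof (cases "0 < wmax n m w")
      case False
      \<comment> \<open>All weights vanish; the bound is a positive number divided by
        \<open>0\<close>, that is, infinite.\<close>
      then have "opt n m w \<le> 0" using opt_le_wmax[of n m w] wmax_nonneg[of n m w] by simp
      moreover have "0 < ?B" using n E by (intro mult_pos_pos) auto
      ultimately have "ennreal ?B / ennreal (opt n m w) = top"
        by (simp only: ennreal_neg ennreal_divide_eq_top_iff ennreal_eq_0_iff) simp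
      then show ?thesis by simp
    next
      case True
      then have opt: "0 < opt n m w" using wmax_le_opt[of n m w] by linarith
      have "\<forall>\<^sub>F w' in at w within weightings n m. l1_dist n m w w' < wmax n m w / X ^ 20"
        using True by (intro order_tendstoD(2)[OF tendsto_l1_dist]) simp
      then have "\<forall>\<^sub>F w' in at w within weightings n m.
          EM_u (alg E n m w) (alg E n m w') / ennreal (l1_dist n m w w') \<le> ennreal ?B / ennreal (opt n m w)"
        using near
      proof eventually_elim
        case (elim w')
        have \<delta>: "0 < l1_dist n m w w'" using elim by (intro l1_dist_pos[OF w]) auto
        have "EM_u (alg E n m w) (alg E n m w') / ennreal (l1_dist n m w w')
            \<le> ennreal (?B / opt n m w * l1_dist n m w w') / ennreal (l1_dist n m w w')"
          using elim True by (intro divide_right_mono_ennreal EM_u_alg_le[OF w]) auto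
        also have "\<dots> = ennreal (?B / opt n m w)"
          using \<delta> B opt by (subst divide_ennreal) auto
        also have "\<dots> = ennreal ?B / ennreal (opt n m w)"
          using B opt by (simp add: divide_ennreal)
        finally show ?case .
      qed
      then show ?thesis unfolding pointwise_lipschitz_def by (rule Limsup_bounded)
    qed
  qed
qed

section \<open>The trivial range of \<epsilon>\<close>

lemma EM_u_self: "EM_u p p = 0"
proof -
  have "map_pmf (\<lambda>x. (x, x)) p \<in> couplings p p" by (simp add: couplings_def pmf.map_comp o_def)
  then have "EM_u p p \<le> (\<integral>\<^sup>+ (F, F'). of_nat (card (sym_diff F F')) \<partial>measure_pmf (map_pmf (\<lambda>x. (x, x)) p))"
    unfolding EM_u_def by (rule INF_lower)
  then show ?thesis by simp
qed

text \<open>For \<open>\<epsilon> \<ge> 1 / 2\<close> the required approximation factor is not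
  positive, and a constant output has Lipschitz constant \<open>0\<close>.\<close>

definition trivial_alg :: algorithm where "trivial_alg n m w = return_pmf {}"

lemma polynomial_time_trivial_alg: "polynomial_time trivial_alg"
  unfolding polynomial_time_def Let_def
proof (intro exI[of _ Skip] exI[of _ 0] allI ballI conjI impI)
  fix n m w assume "w \<in> weightings n m"
  have out: "out_edges n m (snd (run Skip n m w (poly 0 (n + m)) \<omega>)) = {}" for \<omega>
    by (auto simp: run_def init_def out_edges_def upd_apply)
  have "prob_space tapes" unfolding tapes_def
    by (intro prob_space_PiM prob_space_unif)
  then interpret prob_space tapes .
  show "fst (run Skip n m w (poly 0 (n + m)) \<omega>) = Skip" for \<omega> by (simp add: run_def)
  show "(\<lambda>\<omega>. out_edges n m (snd (run Skip n m w (poly 0 (n + m)) \<omega>))) \<in> tapes \<rightarrow>\<^sub>M count_space UNIV"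
    unfolding out by simp
  show "distr tapes (count_space UNIV) (\<lambda>\<omega>. out_edges n m (snd (run Skip n m w (poly 0 (n + m)) \<omega>)))
      = measure_pmf (trivial_alg n m w)"
    unfolding out trivial_alg_def
    by (rule measure_eqI) (auto simp: emeasure_distr emeasure_space_1 indicator_def)
qed

theorem theorem7p7:
  shows "\<exists>C::real. C > 0 \<and> (\<forall>\<epsilon>::real. \<epsilon> > 0 \<longrightarrow>
    (\<exists>A :: algorithm.
       polynomial_time A \<and>
       approximates_matching (1/2 - \<epsilon>) A \<and>
       (\<forall>n m. \<forall>w\<in>weightings n m.
          pointwise_lipschitz A n m w
            \<le> ennreal (C * (1/\<epsilon>) * real n powr (3/2) * ln (max 2 (real m)))
               / ennreal (opt n m w))))"
proof (intro exI[of _ 11520] conjI allI impI)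
  fix \<epsilon> :: real assume \<epsilon>: "0 < \<epsilon>"
  show "\<exists>A. polynomial_time A \<and> approximates_matching (1/2 - \<epsilon>) A \<and>
      (\<forall>n m. \<forall>w\<in>weightings n m. pointwise_lipschitz A n m w
        \<le> ennreal (11520 * (1/\<epsilon>) * real n powr (3/2) * ln (max 2 (real m))) / ennreal (opt n m w))"
  proof (cases "\<epsilon> < 1 / 2")
    case True
    \<comment> \<open>\<open>E \<ge> 5 / (2 * \<epsilon>)\<close> yields the approximation
      guarantee. Rounding up adds at most \<open>1 \<le> 1 / (2 * \<epsilon>)\<close>, so
      \<open>E \<le> 3 / \<epsilon>\<close>, and the final constant is
      \<open>3 * 3840 = 11520\<close>.\<close>
    define E where "E = nat \<lceil>5 / (2 * \<epsilon>)\<rceil>"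
    have ge: "5 / (2 * \<epsilon>) \<le> real E" unfolding E_def by linarith
    have "5 < 5 / (2 * \<epsilon>)" using True \<epsilon> by (simp add: field_simps)
    then have E: "5 \<le> E" using ge by linarith
    have "real E \<le> 5 / (2 * \<epsilon>) + 1" unfolding E_def using \<open>5 < 5 / (2 * \<epsilon>)\<close> by linarith
    also have "\<dots> \<le> 3 / \<epsilon>" using True \<epsilon> by (simp add: field_simps)
    finally have le: "real E \<le> 3 / \<epsilon>" .
    have "5 / (2 * real E) \<le> \<epsilon>" using ge \<epsilon> E by (simp add: field_simps)
    then have "approximates_matching (1/2 - \<epsilon>) (alg E)" by (rule approximates_matching_alg[OF E])
    moreover have "pointwise_lipschitz (alg E) n m w
        \<le> ennreal (11520 * (1/\<epsilon>) * real n powr (3/2) * ln (max 2 (real m))) / ennreal (opt n m w)"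
      if w: "w \<in> weightings n m" for n m w
    proof -
      have "3840 * real E * real n powr (3/2) * ln (max 2 (real m))
          \<le> 11520 * (1/\<epsilon>) * real n powr (3/2) * ln (max 2 (real m))"
        using le by (intro mult_right_mono) auto
      then show ?thesis
        using pointwise_lipschitz_alg[OF E w] divide_right_mono_ennreal[OF ennreal_leI] order_trans by blast
    qed
    ultimately show ?thesis using polynomial_time_alg[OF E] by blast
  next
    case False
    have "approximates_matching (1/2 - \<epsilon>) trivial_alg"
      unfolding approximates_matching_def trivial_alg_def
    proof (intro allI ballI conjI)
      fix n m w
      have "0 \<le> opt n m w" using wmax_le_opt[of n m w] wmax_nonneg[of n m w] by linarith
      then show "(1/2 - \<epsilon>) * opt n m w \<le> measure_pmf.expectation (return_pmf {}) (\<lambda>M. \<Sum>e\<in>M. w e)"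
        using False by (simp add: mult_nonpos_nonneg)
    qed (simp add: empty_matching)
    moreover have "pointwise_lipschitz trivial_alg n m w \<le> B" for n m w B
      unfolding pointwise_lipschitz_def trivial_alg_def EM_u_self
      by (intro Limsup_bounded) simp
    ultimately show ?thesis using polynomial_time_trivial_alg by blast
  qed
qed simp

end
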